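(* Let $J=[0,2\pi]$, and consider the random parameter-dependent product $T_{n,a,\omega}=A_n(a)\cdots A_1(a)$, $a\in J$, where the random maps $A_j\in C^1(J,\mathrm{SL}(2,\mathbb{R}))$ are independent with laws $\mu_j$ equal to $\mu''$ if $n_i<j\le 2n_i$ for some $i$, and equal to $\mu'$ otherwise (with $\mu',\mu''$ and the sequence $\{n_i\}$ defined in the context). Let $L_n(a)=\mathbb{E}\log\|T_{n,a,\omega}\|$. Then almost surely there exists a (random) dense set $X'\subset J$ of parameters such that for every $a\in X'$ one has the strict inequality $$\limsup_{n\to\infty}\frac1n\log\|T_{n,a,\omega}\|<\limsup_{n\to\infty}\frac1n L_n(a).$$ In particular, $\limsup_{n\to\infty}\frac1n\log\|T_{n,a,\omega}\|$ is (almost surely) not a continuous function of $a\in J$, contrary to the continuous (in fact, constant) function $\limsup_{n\to\infty}\frac1nL_n(a)$.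
   Context: Let $H'=\begin{pmatrix}2&0\\0&1/2\end{pmatrix}$ and $H''=\begin{pmatrix}100&0\\0&1/100\end{pmatrix}$, and let $R_\theta$ denote the rotation of $\mathbb{R}^2$ by the angle $\theta$. The measure $\mu'$ (respectively $\mu''$) on $C^1(J,\mathrm{SL}(2,\mathbb{R}))$ is the law of the random map $$A(a)=R_a\cdot H\cdot R_\alpha,\quad a\in J,$$ with $H=H'$ (respectively $H=H''$), where $\alpha$ is uniformly distributed on $[0,2\pi]$. The sequence $\{n_i\}$ is defined by $n_1=1000$, $n_{i+1}=10^{10^{n_i}}$. *)

theory Defs
  imports "HOL-Probability.Probability"
begin

abbreviation J :: "real set" where "J \<equiv> {0..2 * pi}"

section \<open>The space of continuously differentiable maps from J to SL(2,R)\<close>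

text \<open>Maps on \<open>J\<close> are extensional functions. Derivatives are taken within \<open>J\<close>, hence one-sided at
  the endpoints; for this reason the library's \<open>C1_differentiable_on\<close> (two-sided) is not used.\<close>

definition C1_SL2 :: "(real \<Rightarrow> real^2^2) set" where
  "C1_SL2 = {f \<in> extensional J. (\<forall>a\<in>J. det (f a) = 1) \<and>
     (\<exists>f'. (\<forall>a\<in>J. (f has_vector_derivative f' a) (at a within J)) \<and> continuous_on J f')}"

text \<open>The value outside \<open>C1_SL2\<close> is irrelevant; it only makes \<open>C1_dist\<close> total and nonnegative.\<close>

definition C1_dist :: "(real \<Rightarrow> real^2^2) \<Rightarrow> (real \<Rightarrow> real^2^2) \<Rightarrow> real" where
  "C1_dist f g = (if f \<in> C1_SL2 \<and> g \<in> C1_SL2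
     then (SUP a\<in>J. norm (f a - g a)) +
          (SUP a\<in>J. norm (vector_derivative f (at a within J) - vector_derivative g (at a within J)))
     else 0)"

lemma C1_SL2_D:
  assumes "f \<in> C1_SL2"
  shows "a \<in> J \<Longrightarrow> (f has_vector_derivative vector_derivative f (at a within J)) (at a within J)"
    and "continuous_on J f"
    and "continuous_on J (\<lambda>a. vector_derivative f (at a within J))"
proof -
  obtain f' where f': "\<And>a. a \<in> J \<Longrightarrow> (f has_vector_derivative f' a) (at a within J)"
    "continuous_on J f'"
    using assms unfolding C1_SL2_def by blast
  have eq: "vector_derivative f (at a within J) = f' a" if "a \<in> J" for a
    using that f'(1)[OF that] by (intro vector_derivative_within_closed_interval) auto
  show "a \<in> J \<Longrightarrow> (f has_vector_derivative vector_derivative f (at a within J)) (at a within J)"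
    using eq f'(1) by metis
  show "continuous_on J f"
    unfolding continuous_on_eq_continuous_within
    by (intro ballI has_vector_derivative_continuous[OF f'(1)])
  show "continuous_on J (\<lambda>a. vector_derivative f (at a within J))"
    using continuous_on_cong[OF refl eq, of J] f'(2) by simp
qed

lemma bdd_above_norm_J:
  fixes f :: "real \<Rightarrow> real^2^2"
  assumes "continuous_on J f"
  shows "bdd_above ((\<lambda>a. norm (f a)) ` J)"
  by (intro bounded_imp_bdd_above compact_imp_bounded compact_continuous_image
      continuous_on_norm assms) auto

lemma SUP_norm_J:
  fixes f g :: "real \<Rightarrow> real^2^2"
  assumes "continuous_on J f" "continuous_on J g"
  shows "0 \<le> (SUP a\<in>J. norm (f a))"
    and "a \<in> J \<Longrightarrow> norm (f a) \<le> (SUP a\<in>J. norm (f a))"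
    and "(SUP a\<in>J. norm (f a + g a)) \<le> (SUP a\<in>J. norm (f a)) + (SUP a\<in>J. norm (g a))"
proof -
  have up: "norm (h a) \<le> (SUP a\<in>J. norm (h a))"
    if "continuous_on J h" "a \<in> J" for h :: "real \<Rightarrow> real^2^2" and a
    using that by (intro cSUP_upper bdd_above_norm_J) auto
  have "0 \<le> norm (f 0)" by simp
  also have "\<dots> \<le> (SUP a\<in>J. norm (f a))" using up[OF assms(1), of 0] by simp
  finally show "0 \<le> (SUP a\<in>J. norm (f a))" .
  show "a \<in> J \<Longrightarrow> norm (f a) \<le> (SUP a\<in>J. norm (f a))" using up[OF assms(1)] .
  show "(SUP a\<in>J. norm (f a + g a)) \<le> (SUP a\<in>J. norm (f a)) + (SUP a\<in>J. norm (g a))"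
  proof (rule cSUP_least)
    fix a assume "a \<in> J"
    then show "norm (f a + g a) \<le> (SUP a\<in>J. norm (f a)) + (SUP a\<in>J. norm (g a))"
      using up[OF assms(1)] up[OF assms(2)] norm_triangle_mono by blast
  qed auto
qed

interpretation C1: Metric_space C1_SL2 C1_dist
proof
  let ?D = "\<lambda>f a. vector_derivative f (at a within J)"
  have c: "continuous_on J (\<lambda>a. f a - g a)" "continuous_on J (\<lambda>a. ?D f a - ?D g a)"
    if "f \<in> C1_SL2" "g \<in> C1_SL2" for f g
    using that C1_SL2_D by (auto intro!: continuous_on_diff)
  fix f g h :: "real \<Rightarrow> real^2^2"
  show "0 \<le> C1_dist f g"
    using SUP_norm_J(1)[OF c(1) c(1)] SUP_norm_J(1)[OF c(2) c(2)]
    by (auto simp: C1_dist_def)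
  show "C1_dist f g = C1_dist g f"
    by (simp add: C1_dist_def norm_minus_commute)
  show "C1_dist f g = 0 \<longleftrightarrow> f = g" if fg: "f \<in> C1_SL2" "g \<in> C1_SL2"
  proof
    assume "C1_dist f g = 0"
    then have "(SUP a\<in>J. norm (f a - g a)) = 0"
      using fg SUP_norm_J(1)[OF c(1)[OF fg] c(1)[OF fg]] SUP_norm_J(1)[OF c(2)[OF fg] c(2)[OF fg]]
      by (simp add: C1_dist_def)
    then have "f a = g a" if "a \<in> J" for a
      using SUP_norm_J(2)[OF c(1)[OF fg] c(1)[OF fg] that] by simp
    then show "f = g"
      using fg by (auto simp: C1_SL2_def intro: extensionalityI)
  qed (use fg in \<open>simp add: C1_dist_def\<close>)
  show "C1_dist f h \<le> C1_dist f g + C1_dist g h"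
    if "f \<in> C1_SL2" "g \<in> C1_SL2" "h \<in> C1_SL2"
    using that SUP_norm_J(3)[OF c(1) c(1), of f g g h] SUP_norm_J(3)[OF c(2) c(2), of f g g h]
    by (simp add: C1_dist_def)
qed

definition C1_borel :: "(real \<Rightarrow> real^2^2) measure" where
  "C1_borel = sigma C1_SL2 {U. openin C1.mtopology U}"

section \<open>The laws\<close>

definition Rot :: "real \<Rightarrow> real^2^2" where
  "Rot \<theta> = vector [vector [cos \<theta>, - sin \<theta>], vector [sin \<theta>, cos \<theta>]]"

definition H1 :: "real^2^2" where
  "H1 = vector [vector [2, 0], vector [0, 1/2]]"

definition H2 :: "real^2^2" where
  "H2 = vector [vector [100, 0], vector [0, 1/100]]"

definition rand_map :: "real^2^2 \<Rightarrow> real \<Rightarrow> real \<Rightarrow> real^2^2" where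
  "rand_map H \<alpha> = (\<lambda>a\<in>J. Rot a ** H ** Rot \<alpha>)"

definition law :: "real^2^2 \<Rightarrow> (real \<Rightarrow> real^2^2) measure" where
  "law H = distr (uniform_measure lborel {0..2 * pi}) C1_borel (rand_map H)"

text \<open>Indexing is shifted by one: \<open>nseq i\<close> is the term \<open>n\<^sub>i\<^sub>+\<^sub>1\<close> of the sequence starting
  with \<open>n\<^sub>1 = 1000\<close>.\<close>

primrec nseq :: "nat \<Rightarrow> nat" where
  "nseq 0 = 1000"
| "nseq (Suc i) = 10 ^ (10 ^ nseq i)"

definition step_law :: "nat \<Rightarrow> (real \<Rightarrow> real^2^2) measure" where
  "step_law j = (if \<exists>i. nseq i < j \<and> j \<le> 2 * nseq i then law H2 else law H1)"

section \<open>Random products\<close>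

primrec rprod :: "(nat \<Rightarrow> 'w \<Rightarrow> real \<Rightarrow> real^2^2) \<Rightarrow> nat \<Rightarrow> real \<Rightarrow> 'w \<Rightarrow> real^2^2" where
  "rprod A 0 a \<omega> = mat 1"
| "rprod A (Suc n) a \<omega> = A (Suc n) \<omega> a ** rprod A n a \<omega>"

definition log_norm :: "(nat \<Rightarrow> 'w \<Rightarrow> real \<Rightarrow> real^2^2) \<Rightarrow> nat \<Rightarrow> real \<Rightarrow> 'w \<Rightarrow> real" where
  "log_norm A n a \<omega> = ln (onorm ((*v) (rprod A n a \<omega>)))"

definition mean_log_norm ::
  "'w measure \<Rightarrow> (nat \<Rightarrow> 'w \<Rightarrow> real \<Rightarrow> real^2^2) \<Rightarrow> nat \<Rightarrow> real \<Rightarrow> real" where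
  "mean_log_norm M A n a = (\<integral>\<omega>. log_norm A n a \<omega> \<partial>M)"

definition upper_exponent :: "(nat \<Rightarrow> 'w \<Rightarrow> real \<Rightarrow> real^2^2) \<Rightarrow> 'w \<Rightarrow> real \<Rightarrow> ereal" where
  "upper_exponent A \<omega> a = limsup (\<lambda>n. ereal (1 / real n * log_norm A n a \<omega>))"

definition upper_mean_exponent ::
  "'w measure \<Rightarrow> (nat \<Rightarrow> 'w \<Rightarrow> real \<Rightarrow> real^2^2) \<Rightarrow> real \<Rightarrow> ereal" where
  "upper_mean_exponent M A a = limsup (\<lambda>n. ereal (1 / real n * mean_log_norm M A n a))"

text \<open>The laws are genuine push-forwards: \<open>rand_map H\<close> takes values in \<open>C1_SL2\<close> and is measurable
  (\<open>distr\<close> along a non-measurable map would be a degenerate measure).\<close>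

lemma bounded_bilinear_matrix_mult:
  "bounded_bilinear ((**) :: real^2^2 \<Rightarrow> real^2^2 \<Rightarrow> real^2^2)"
proof -
  have "bilinear ((**) :: real^2^2 \<Rightarrow> real^2^2 \<Rightarrow> real^2^2)"
    unfolding bilinear_def
    by (intro conjI allI linearI)
      (simp_all add: matrix_matrix_mult_def vec_eq_iff sum_2 distrib_left distrib_right mult.assoc mult.left_commute)
  then show ?thesis
    by (simp add: bilinear_conv_bounded_bilinear)
qed

lemma Rot_eq: "Rot a = cos a *\<^sub>R Rot 0 + sin a *\<^sub>R Rot (pi / 2)"
  by (simp add: Rot_def vec_eq_iff forall_2)

lemma det_Rot: "det (Rot a) = 1"
  by (simp add: Rot_def det_2 flip: power2_eq_square)

lemma has_vector_derivative_Rot: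
  "(Rot has_vector_derivative Rot (a + pi / 2)) (at a within S)"
proof -
  have "((\<lambda>a. cos a *\<^sub>R Rot 0 + sin a *\<^sub>R Rot (pi / 2)) has_vector_derivative
      (- sin a *\<^sub>R Rot 0 + cos a *\<^sub>R Rot (pi / 2))) (at a within S)"
    by (auto intro!: derivative_eq_intros)
  moreover have "- sin a *\<^sub>R Rot 0 + cos a *\<^sub>R Rot (pi / 2) = Rot (a + pi / 2)"
    by (simp add: Rot_eq[of "a + pi / 2"] cos_add sin_add)
  ultimately show ?thesis
    by (simp only: Rot_eq[symmetric])
qed

lemma continuous_on_Rot: "continuous_on S Rot"
  unfolding continuous_on_eq_continuous_within
  by (intro ballI has_vector_derivative_continuous[OF has_vector_derivative_Rot])

lemma has_vector_derivative_rand_map: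
  assumes "a \<in> J"
  shows "(rand_map H \<alpha> has_vector_derivative Rot (a + pi / 2) ** H ** Rot \<alpha>) (at a within J)"
proof -
  interpret m: bounded_bilinear "(**) :: real^2^2 \<Rightarrow> real^2^2 \<Rightarrow> real^2^2"
    by (rule bounded_bilinear_matrix_mult)
  have "((\<lambda>a. Rot a ** (H ** Rot \<alpha>)) has_vector_derivative Rot (a + pi / 2) ** (H ** Rot \<alpha>))
      (at a within J)"
    using bounded_linear.has_vector_derivative[OF m.bounded_linear_left has_vector_derivative_Rot] .
  then have "((\<lambda>a. Rot a ** H ** Rot \<alpha>) has_vector_derivative Rot (a + pi / 2) ** H ** Rot \<alpha>)
      (at a within J)"
    by (simp only: matrix_mul_assoc)
  then show ?thesis
    by (rule has_vector_derivative_transform[OF assms, rotated]) (simp add: rand_map_def)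
qed

lemma rand_map_in_C1_SL2:
  assumes "det H = 1"
  shows "rand_map H \<alpha> \<in> C1_SL2"
proof -
  interpret m: bounded_bilinear "(**) :: real^2^2 \<Rightarrow> real^2^2 \<Rightarrow> real^2^2"
    by (rule bounded_bilinear_matrix_mult)
  have "continuous_on J (\<lambda>a. Rot (a + pi / 2))"
    by (rule continuous_on_compose2[OF continuous_on_Rot[of UNIV]]) (auto intro!: continuous_intros)
  then have "continuous_on J (\<lambda>a. Rot (a + pi / 2) ** H ** Rot \<alpha>)"
    by (intro m.continuous_on continuous_on_const)
  then have "\<exists>f'. (\<forall>a\<in>J. (rand_map H \<alpha> has_vector_derivative f' a) (at a within J)) \<and> continuous_on J f'"
    by (intro exI[of _ "\<lambda>a. Rot (a + pi / 2) ** H ** Rot \<alpha>"] conjI ballI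
        has_vector_derivative_rand_map)
  moreover have "rand_map H \<alpha> \<in> extensional J" "\<forall>a\<in>J. det (rand_map H \<alpha> a) = 1"
    by (simp_all add: rand_map_def det_mul det_Rot assms)
  ultimately show ?thesis
    by (simp add: C1_SL2_def)
qed

lemma measurable_rand_map:
  assumes "det H = 1"
  shows "rand_map H \<in> borel \<rightarrow>\<^sub>M C1_borel"
  unfolding C1_borel_def
proof (rule measurable_measure_of)
  show "{U. openin C1.mtopology U} \<subseteq> Pow C1_SL2"
    by (rule subsetI, rule PowI) (metis C1.topspace_mtopology mem_Collect_eq openin_subset)
  show "rand_map H \<in> space borel \<rightarrow> C1_SL2"
    by (intro Pi_I rand_map_in_C1_SL2 assms)
  have "\<exists>B>0. \<forall>(X :: real^2^2) (Y :: real^2^2). norm (X ** Y) \<le> norm X * norm Y * B"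
    by (rule bounded_bilinear.pos_bounded[OF bounded_bilinear_matrix_mult])
  then obtain B where B: "B > 0" "\<And>(X :: real^2^2) (Y :: real^2^2). norm (X ** Y) \<le> norm X * norm Y * B"
    by blast
  define C where "C = norm (Rot 0) + norm (Rot (pi / 2))"
  have C: "norm (Rot a) \<le> C" for a
  proof -
    have "norm (Rot a) \<le> \<bar>cos a\<bar> * norm (Rot 0) + \<bar>sin a\<bar> * norm (Rot (pi / 2))"
      by (subst Rot_eq) (metis norm_scaleR norm_triangle_ineq)
    also have "\<dots> \<le> C"
      unfolding C_def by (intro add_mono mult_left_le_one_le) auto
    finally show ?thesis .
  qed
  define K where "K = C * norm H * B * B"
  have K: "norm (Rot a ** H ** Rot \<alpha> - Rot a ** H ** Rot \<beta>) \<le> K * norm (Rot \<alpha> - Rot \<beta>)" for a \<alpha> \<beta>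
  proof -
    have "Rot a ** H ** Rot \<alpha> - Rot a ** H ** Rot \<beta> = Rot a ** H ** (Rot \<alpha> - Rot \<beta>)"
      by (simp add: bounded_bilinear.diff_right[OF bounded_bilinear_matrix_mult])
    also have "norm \<dots> \<le> norm (Rot a ** H) * norm (Rot \<alpha> - Rot \<beta>) * B"
      by (rule B)
    also have "\<dots> \<le> (norm (Rot a) * norm H * B) * norm (Rot \<alpha> - Rot \<beta>) * B"
      using B by (intro mult_right_mono) auto
    also have "\<dots> \<le> (C * norm H * B) * norm (Rot \<alpha> - Rot \<beta>) * B"
      using B C by (intro mult_right_mono) auto
    finally show ?thesis by (simp add: K_def mult_ac)
  qed
  have dist: "C1_dist (rand_map H \<alpha>) (rand_map H \<beta>) \<le> 2 * K * norm (Rot \<alpha> - Rot \<beta>)" for \<alpha> \<beta>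
  proof -
    have vd: "vector_derivative (rand_map H \<gamma>) (at a within J) = Rot (a + pi / 2) ** H ** Rot \<gamma>"
      if "a \<in> J" for a \<gamma>
      using that has_vector_derivative_rand_map[OF that]
      by (intro vector_derivative_within_closed_interval) auto
    have "(SUP a\<in>J. norm (rand_map H \<alpha> a - rand_map H \<beta> a)) \<le> K * norm (Rot \<alpha> - Rot \<beta>)"
      by (rule cSUP_least) (auto simp: rand_map_def K)
    moreover have "(SUP a\<in>J. norm (vector_derivative (rand_map H \<alpha>) (at a within J) -
        vector_derivative (rand_map H \<beta>) (at a within J))) \<le> K * norm (Rot \<alpha> - Rot \<beta>)"
      by (rule cSUP_least) (auto simp: vd K)
    ultimately show ?thesis
      using rand_map_in_C1_SL2[OF assms] by (simp add: C1_dist_def)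
  qed
  fix U assume "U \<in> {U. openin C1.mtopology U}"
  then have U: "\<And>f. f \<in> U \<Longrightarrow> \<exists>r>0. C1.mball f r \<subseteq> U"
    unfolding mem_Collect_eq C1.openin_mtopology by blast
  have "open (rand_map H -` U)"
    unfolding open_dist
  proof
    fix \<beta> assume "\<beta> \<in> rand_map H -` U"
    then have "rand_map H \<beta> \<in> U" by simp
    from U[OF this] obtain r where r: "r > 0" "C1.mball (rand_map H \<beta>) r \<subseteq> U"
      by blast
    have "((\<lambda>\<alpha>. 2 * K * norm (Rot \<alpha> - Rot \<beta>)) \<longlongrightarrow> 2 * K * norm (Rot \<beta> - Rot \<beta>)) (nhds \<beta>)"
    proof -
      have "isCont Rot \<beta>"
        using continuous_on_Rot[of UNIV] by (simp add: continuous_on_eq_continuous_at)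
      then show ?thesis
        unfolding isCont_def tendsto_at_iff_tendsto_nhds by (intro tendsto_intros)
    qed
    then have "\<forall>\<^sub>F \<alpha> in nhds \<beta>. 2 * K * norm (Rot \<alpha> - Rot \<beta>) < r"
      using r(1) by (intro order_tendstoD(2)) auto
    then have "\<forall>\<^sub>F \<alpha> in nhds \<beta>. \<alpha> \<in> rand_map H -` U"
    proof eventually_elim
      case (elim \<alpha>)
      have "C1_dist (rand_map H \<beta>) (rand_map H \<alpha>) < r"
        using dist[of \<alpha> \<beta>] elim by (simp add: C1.commute)
      then have "rand_map H \<alpha> \<in> C1.mball (rand_map H \<beta>) r"
        using rand_map_in_C1_SL2[OF assms] by simp
      then show ?case
        using r(2) by (simp only: vimage_eq subsetD)
    qed
    then show "\<exists>e>0. \<forall>\<alpha>. dist \<alpha> \<beta> < e \<longrightarrow> \<alpha> \<in> rand_map H -` U"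
      by (simp add: eventually_nhds_metric)
  qed
  then show "rand_map H -` U \<inter> space borel \<in> sets borel"
    by simp
qed

lemma prob_space_law:
  assumes "det H = 1"
  shows "prob_space (law H)"
  unfolding law_def
proof (rule prob_space.prob_space_distr)
  show "prob_space (uniform_measure lborel {0..2 * pi})"
    by (rule prob_space_uniform_measure) auto
  have "measurable (uniform_measure lborel {0..2 * pi}) C1_borel = measurable borel C1_borel"
    by (rule measurable_cong_sets) simp_all
  then show "rand_map H \<in> uniform_measure lborel {0..2 * pi} \<rightarrow>\<^sub>M C1_borel"
    by (simp only: measurable_rand_map[OF assms])
qed

lemma det_H1: "det H1 = 1" and det_H2: "det H2 = 1"
  by (simp_all add: H1_def H2_def det_2)

end

(*
In the complex coordinate v of the plane, a matrix in SL(2,R) acts as v |-> p v + q cnj v with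
|p|^2 - |q|^2 = 1, and its operator norm is |p| + |q|. Write T_n in this way. The mean value property
of Ln (1 + b z^2) shows that multiplication by a random step with diagonal part diag (s, 1/s) increases
the expectation of ln |p| by exactly ln ((s + 1/s) / 2). So L_n is, up to ln 2, the sum of these numbers;
its upper growth rate is a constant, at least ln (125/2) / 2 because of the windows (n_i, 2 n_i]. The
increments have bounded variance, so for fixed a (hence, almost surely, for all rational a) the random
upper exponent is at least that large too.

Small exponents come from one cancellation in each window. Cut (n_i, 1.6 n_i] as C * P * B, where B and
C have lengths at most about 0.3 n_i and P is a short run in which every second angle is such that two
consecutive steps almost compose to a rotation. As a runs through a small interval, P turns many times,
whereas the relative position of the singular directions of C and B cannot turn back noticeably, since
all directions rotate in the positive sense. So for some a the expanding direction of P * B is mapped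
to the contracting direction of C and the norm of C * P * B is at most about max (|B|, |C|). With the
trivial bounds 2 and 100 for the norms of the steps this already keeps ln |T_n(a)| / n below
2.9 ln 2 < ln (125/2) / 2 for all n up to the next window. The cancellation persists on an interval of
length 10^(-0.7 n_i); since n_(i+1) is doubly exponential in n_i, Borel-Cantelli yields runs that turn
sufficiently within every such interval, and nested intervals give a dense set of parameters.
*)

theory Submission
  imports Defs "HOL-Complex_Analysis.Complex_Analysis" "HOL-Real_Asymp.Real_Asymp"
begin

section \<open>Matrices as real-linear maps of the complex plane\<close>

text \<open>The favourable parameter depends on \<open>\<omega>\<close>, so an estimate that holds
  almost surely for each fixed \<open>a\<close> says nothing at that parameter. Hence the upper
  bound is deterministic once the angles contain the required runs, and the runs are required in all
  cells of \<open>J\<close> at once. The price is crude norm bounds. In units of \<open>ln 2\<close>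
  the logarithm of the norm grows by at most 1 per step outside the windows and by at most
  \<open>20 / 3\<close> inside. Without a cancellation this allows \<open>(1 + 20/3) / 2\<close>,
  about 3.8, at time \<open>2 * n_i\<close>; one cancellation lowers it to about 2.87. The proof
  separates the rates \<open>29/10 < 73/25 < 59/20\<close>: upper bound on the dense set, lower
  bound at rational parameters, lower bound for the mean. A pair of steps turns only by the length
  of a cell, so with \<open>G\<close> cells a run needs about \<open>G\<close> pairs, each
  constraint having probability at least \<open>1 / G\<close>. With \<open>G\<close> about
  \<open>10^(0.7 n_i)\<close> the waiting time is at most a power \<open>G^(4 G)\<close>, which is
  small compared with \<open>n_(i+1) = 10^(10^n_i)\<close>.\<close>

definition cp :: "real^2^2 \<Rightarrow> complex" where
  "cp S = Complex ((S$1$1 + S$2$2) / 2) ((S$2$1 - S$1$2) / 2)"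

definition cq :: "real^2^2 \<Rightarrow> complex" where
  "cq S = Complex ((S$1$1 - S$2$2) / 2) ((S$2$1 + S$1$2) / 2)"

definition opn :: "real^2^2 \<Rightarrow> real" where
  "opn S = cmod (cp S) + cmod (cq S)"

lemma cp_mult: "cp (A ** B) = cp A * cp B + cq A * cnj (cq B)"
  by (simp add: complex_eq_iff cp_def cq_def matrix_matrix_mult_def sum_2) (auto simp: field_simps)

lemma cq_mult: "cq (A ** B) = cp A * cq B + cq A * cnj (cp B)"
  by (simp add: complex_eq_iff cp_def cq_def matrix_matrix_mult_def sum_2) (auto simp: field_simps)

lemma det_cp_cq: "det S = (cmod (cp S))\<^sup>2 - (cmod (cq S))\<^sup>2"
  unfolding cmod_power2 by (simp add: cp_def cq_def det_2 power2_eq_square field_simps)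

lemma cp_one [simp]: "cp (mat 1) = 1" and cq_one [simp]: "cq (mat 1) = 0"
  by (simp_all add: cp_def cq_def mat_def complex_eq_iff)

lemma cp_Rot [simp]: "cp (Rot a) = cis a" and cq_Rot [simp]: "cq (Rot a) = 0"
  by (simp_all add: cp_def cq_def Rot_def complex_eq_iff)

definition to_c :: "real^2 \<Rightarrow> complex" where
  "to_c v = Complex (v$1) (v$2)"

lemma norm_to_c: "cmod (to_c v) = norm v"
  by (simp add: to_c_def cmod_def norm_vec_def L2_set_def sum_2)

lemma to_c_mult: "to_c (S *v v) = cp S * to_c v + cq S * cnj (to_c v)"
  by (simp add: complex_eq_iff cp_def cq_def to_c_def matrix_vector_mult_def sum_2)
    (auto simp: field_simps)

text \<open>The value \<open>|p| + |q|\<close> is attained at a \<open>z\<close> for which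
  \<open>cp S * z\<close> and \<open>cq S * cnj z\<close> have the same argument: this holds when
  \<open>z * z\<close> is a positive multiple of \<open>cnj (cp S) * cq S\<close>, and any nonzero
  \<open>z\<close> serves when one coefficient vanishes.\<close>

lemma onorm_eq_opn: "onorm ((*v) S) = opn S"
proof (rule antisym)
  show "onorm ((*v) S) \<le> opn S"
  proof (rule onorm_le)
    fix v
    have "norm (S *v v) \<le> cmod (cp S * to_c v) + cmod (cq S * cnj (to_c v))"
      by (metis norm_to_c norm_triangle_ineq to_c_mult)
    then show "norm (S *v v) \<le> opn S * norm v"
      by (simp add: norm_mult norm_to_c opn_def distrib_right)
  qed
  define z where "z = (if cp S * cq S = 0 then 1 else csqrt (cnj (cp S) * cq S))"
  have z0: "z \<noteq> 0" by (auto simp: z_def)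
  define v :: "real^2" where "v = vector [Re z, Im z]"
  have zv: "to_c v = z" by (simp add: to_c_def v_def)
  have "cmod (cp S * z + cq S * cnj z) = opn S * cmod z"
  proof (cases "cp S * cq S = 0")
    case True then show ?thesis by (auto simp: z_def opn_def)
  next
    case False
    have z2: "z * z = cnj (cp S) * cq S"
      using False by (simp add: z_def flip: power2_eq_square)
    have cz: "cmod z * cmod z = cmod (cp S) * cmod (cq S)"
      by (metis z2 norm_mult complex_mod_cnj)
    have "(cmod (cp S * z + cq S * cnj z) * cmod z)\<^sup>2 = (cmod (cp S * (z * z) + cq S * (cnj z * z)))\<^sup>2"
      by (simp add: norm_mult[symmetric] algebra_simps)
    also have "cp S * (z * z) + cq S * (cnj z * z) = cq S * of_real ((cmod (cp S))\<^sup>2 + cmod z * cmod z)"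
      by (simp add: z2 complex_norm_square[symmetric] algebra_simps power2_eq_square)
    also have "\<dots> = cq S * of_real (cmod (cp S) * opn S)"
      by (simp only: cz opn_def power2_eq_square distrib_left)
    also have "(cmod \<dots>)\<^sup>2 = (cmod (cp S) * cmod (cq S) * opn S)\<^sup>2"
      by (simp only: norm_mult norm_of_real power2_abs power_mult_distrib ac_simps)
    also have "\<dots> = (opn S * cmod z * cmod z)\<^sup>2"
      by (metis cz mult.assoc mult.commute)
    finally have "cmod (cp S * z + cq S * cnj z) * cmod z = opn S * cmod z * cmod z"
      by (rule power2_eq_imp_eq) (auto simp: opn_def)
    then show ?thesis using z0 by simp
  qed
  then have "norm (S *v v) = opn S * norm v"
    using to_c_mult[of S v] norm_to_c[of v] norm_to_c[of "S *v v"] zv by simp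
  moreover have "norm (S *v v) \<le> onorm ((*v) S) * norm v"
    by (rule onorm) (rule matrix_vector_mul_bounded_linear)
  moreover have "norm v > 0" using z0 zv norm_to_c[of v] by auto
  ultimately show "opn S \<le> onorm ((*v) S)" by simp
qed

lemma opn_nonneg: "0 \<le> opn S" by (simp add: opn_def)

lemma opn_one [simp]: "opn (mat 1) = 1" by (simp add: opn_def)

lemma opn_mult: "opn (A ** B) \<le> opn A * opn B"
proof -
  have "opn (A ** B) \<le> (cmod (cp A * cp B) + cmod (cq A * cnj (cq B))) +
      (cmod (cp A * cq B) + cmod (cq A * cnj (cp B)))"
    unfolding opn_def cp_mult cq_mult by (intro add_mono norm_triangle_ineq)
  then show ?thesis by (simp add: opn_def norm_mult algebra_simps)
qed

text \<open>The inverse of \<open>A\<close> has the coefficients \<open>cnj (cp A)\<close> and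
  \<open>- cq A\<close>, hence the same norm as \<open>A\<close>; the claim is submultiplicativity
  applied to this inverse and \<open>A ** B\<close>.\<close>

lemma opn_le_mult:
  assumes "det A = 1"
  shows "opn B \<le> opn A * opn (A ** B)"
proof -
  have d: "cp A * cnj (cp A) - cq A * cnj (cq A) = 1"
    using assms unfolding det_cp_cq
    by (metis complex_norm_square of_real_1 of_real_diff)
  have "cp B = (cp A * cnj (cp A) - cq A * cnj (cq A)) * cp B"
    "cq B = (cp A * cnj (cp A) - cq A * cnj (cq A)) * cq B"
    by (simp_all add: d)
  then have *: "cp B = cnj (cp A) * cp (A ** B) - cq A * cnj (cq (A ** B))"
    "cq B = cnj (cp A) * cq (A ** B) - cq A * cnj (cp (A ** B))"
    unfolding cp_mult cq_mult by (simp_all add: algebra_simps)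
  have "opn B \<le> (cmod (cnj (cp A) * cp (A ** B)) + cmod (cq A * cnj (cq (A ** B)))) +
      (cmod (cnj (cp A) * cq (A ** B)) + cmod (cq A * cnj (cp (A ** B))))"
    unfolding opn_def[of B] by (metis * add_mono norm_triangle_ineq4)
  then show ?thesis by (simp add: opn_def norm_mult algebra_simps)
qed

lemma det_one_cmod:
  assumes "det A = 1"
  shows "(cmod (cp A))\<^sup>2 = 1 + (cmod (cq A))\<^sup>2" "1 \<le> cmod (cp A)" "cmod (cq A) < cmod (cp A)"
    "cp A \<noteq> 0" "opn A \<le> 2 * cmod (cp A)" "1 \<le> opn A"
proof -
  show *: "(cmod (cp A))\<^sup>2 = 1 + (cmod (cq A))\<^sup>2" using assms by (simp add: det_cp_cq)
  show 1: "1 \<le> cmod (cp A)" using * by (smt (verit) norm_ge_zero one_power2 power2_le_imp_le zero_le_power2)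
  show 2: "cmod (cq A) < cmod (cp A)" using * by (intro power2_less_imp_less[of "cmod (cq A)"]) simp_all
  show "cp A \<noteq> 0" using 1 by auto
  show "opn A \<le> 2 * cmod (cp A)" "1 \<le> opn A" using 1 2 unfolding opn_def by (auto intro: add_increasing2)
qed

definition dg :: "real \<Rightarrow> real^2^2" where
  "dg s = vector [vector [s, 0], vector [0, 1 / s]]"

text \<open>\<open>cosh\<close> and \<open>sinh\<close> of \<open>ln s\<close>, the two complex
  coefficients of \<open>dg s\<close>.\<close>

definition dgp :: "real \<Rightarrow> real" where "dgp s = (s + 1 / s) / 2"
definition dgq :: "real \<Rightarrow> real" where "dgq s = (s - 1 / s) / 2"

lemma H1_eq: "H1 = dg 2" and H2_eq: "H2 = dg 100"
  by (simp_all add: H1_def H2_def dg_def)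

lemma cp_dg [simp]: "cp (dg s) = of_real (dgp s)" and cq_dg [simp]: "cq (dg s) = of_real (dgq s)"
  by (simp_all add: cp_def cq_def dg_def dgp_def dgq_def complex_eq_iff)

lemma det_dg: "s \<noteq> 0 \<Longrightarrow> det (dg s) = 1"
  by (simp add: dg_def det_2)

lemma dgp_dgq:
  assumes "s \<ge> 1"
  shows "dgq s \<ge> 0" "dgp s \<ge> 1" "dgq s < dgp s" "dgp s + dgq s = s" "(dgp s)\<^sup>2 - (dgq s)\<^sup>2 = 1"
proof -
  have "1 / s \<le> 1" using assms by simp
  then have "1 / s \<le> s" using assms by linarith
  then show "dgq s \<ge> 0" by (simp add: dgq_def)
  have "0 \<le> (s - 1)\<^sup>2" by simp
  then have "2 * s \<le> s * s + 1" by (simp add: power2_eq_square algebra_simps)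
  then show "dgp s \<ge> 1" using assms by (simp add: dgp_def field_simps)
  show "dgq s < dgp s" using assms by (simp add: dgp_def dgq_def field_simps)
  show "dgp s + dgq s = s" by (simp add: dgp_def dgq_def field_simps)
  show "(dgp s)\<^sup>2 - (dgq s)\<^sup>2 = 1" using assms by (simp add: dgp_def dgq_def power2_eq_square field_simps)
qed

definition stp :: "real \<Rightarrow> real \<Rightarrow> real \<Rightarrow> real^2^2" where
  "stp s \<alpha> a = Rot a ** dg s ** Rot \<alpha>"

lemma cp_stp: "cp (stp s \<alpha> a) = of_real (dgp s) * cis (a + \<alpha>)"
  and cq_stp: "cq (stp s \<alpha> a) = of_real (dgq s) * cis (a - \<alpha>)"
  by (simp_all add: stp_def cp_mult cq_mult cis_mult[symmetric] cis_cnj cis_divide[symmetric] divide_inverse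
      cis_inverse)

lemma opn_stp: "s \<ge> 1 \<Longrightarrow> opn (stp s \<alpha> a) = s"
  using dgp_dgq[of s] by (simp add: opn_def cp_stp cq_stp norm_mult)

lemma det_stp: "s \<noteq> 0 \<Longrightarrow> det (stp s \<alpha> a) = 1"
  by (simp add: stp_def det_mul det_Rot det_dg)

text \<open>Steps \<open>k + 1\<close> to \<open>k + m\<close>, the last one leftmost. The angles
  are a fixed sequence and the parameter ranges over all reals, so derivatives are two-sided and no
  probability enters the geometry.\<close>

primrec blk :: "(nat \<Rightarrow> real) \<Rightarrow> (nat \<Rightarrow> real) \<Rightarrow> nat \<Rightarrow> nat \<Rightarrow> real \<Rightarrow> real^2^2" where
  "blk s \<alpha> k 0 a = mat 1"
| "blk s \<alpha> k (Suc m) a = stp (s (Suc (k + m))) (\<alpha> (Suc (k + m))) a ** blk s \<alpha> k m a"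

lemma blk_add: "blk s \<alpha> k (m + m') a = blk s \<alpha> (k + m) m' a ** blk s \<alpha> k m a"
  by (induction m') (simp_all add: matrix_mul_assoc add.assoc)

lemma det_blk: "(\<And>j. s j \<ge> 1) \<Longrightarrow> det (blk s \<alpha> k m a) = 1"
proof (induction m)
  case (Suc m)
  have "s (Suc (k + m)) \<noteq> 0" using Suc.prems[of "Suc (k + m)"] by auto
  then show ?case using Suc by (simp add: det_mul det_stp)
qed simp

lemma opn_blk:
  assumes "\<And>j. s j \<ge> 1"
  shows "opn (blk s \<alpha> k m a) \<le> (\<Prod>j\<in>{k<..k + m}. s j)"
proof (induction m)
  case (Suc m)
  have "opn (blk s \<alpha> k (Suc m) a) \<le> s (Suc (k + m)) * opn (blk s \<alpha> k m a)"
    using opn_mult[of "stp (s (Suc (k + m))) (\<alpha> (Suc (k + m))) a" "blk s \<alpha> k m a"] assms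
    by (simp add: opn_stp)
  also have "\<dots> \<le> s (Suc (k + m)) * (\<Prod>j\<in>{k<..k + m}. s j)"
    using assms[of "Suc (k + m)"] Suc by (intro mult_left_mono) auto
  also have "\<dots> = (\<Prod>j\<in>{k<..k + Suc m}. s j)"
  proof -
    have "{k<..k + Suc m} = insert (Suc (k + m)) {k<..k + m}" by auto
    then show ?thesis by simp
  qed
  finally show ?case .
qed simp

section \<open>Monotone rotation\<close>

lemma cis_shift_has_vector_derivative:
  "((\<lambda>a. of_real c * cis (a + \<beta>)) has_vector_derivative \<i> * (of_real c * cis (x + \<beta>))) (at x)"
proof -
  have "((\<lambda>z. of_real c * exp (\<i> * (z + of_real \<beta>))) has_field_derivative
      \<i> * (of_real c * exp (\<i> * (of_real x + of_real \<beta>)))) (at (of_real x))"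
    by (auto intro!: derivative_eq_intros)
  from has_vector_derivative_real_field[OF this, of UNIV] show ?thesis
    by (simp add: cis_conv_exp)
qed

text \<open>With \<open>w = p * v + q * cnj v\<close>, the last expression is \<open>|w|^2\<close>
  times the angular speed of the image of \<open>v\<close>. A further step sends \<open>w\<close> to
  \<open>W = X * w + Y * cnj w\<close>: its outer rotation by \<open>a\<close> contributes
  \<open>|W|^2\<close>, and determinant 1 carries \<open>Im (cnj w * w')\<close> over
  unchanged.\<close>

lemma blk_has_derivative:
  assumes s: "\<And>j. s j \<ge> 1"
  obtains p' q' where
    "\<And>a. ((\<lambda>a. cp (blk s \<alpha> k m a)) has_vector_derivative p' a) (at a)"
    "\<And>a. ((\<lambda>a. cq (blk s \<alpha> k m a)) has_vector_derivative q' a) (at a)"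
    "\<And>a v. 0 \<le> Im (cnj (cp (blk s \<alpha> k m a) * v + cq (blk s \<alpha> k m a) * cnj v) * (p' a * v + q' a * cnj v))"
proof -
  have "\<exists>p' q'. (\<forall>a. ((\<lambda>a. cp (blk s \<alpha> k m a)) has_vector_derivative p' a) (at a)) \<and>
    (\<forall>a. ((\<lambda>a. cq (blk s \<alpha> k m a)) has_vector_derivative q' a) (at a)) \<and>
    (\<forall>a v. 0 \<le> Im (cnj (cp (blk s \<alpha> k m a) * v + cq (blk s \<alpha> k m a) * cnj v) * (p' a * v + q' a * cnj v)))"
  proof (induction m)
    case 0
    show ?case by (intro exI[of _ "\<lambda>_. 0"]) simp
  next
    case (Suc m)
    then obtain p' q' where
      p': "\<And>a. ((\<lambda>a. cp (blk s \<alpha> k m a)) has_vector_derivative p' a) (at a)" and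
      q': "\<And>a. ((\<lambda>a. cq (blk s \<alpha> k m a)) has_vector_derivative q' a) (at a)" and
      pos: "\<And>a v. 0 \<le> Im (cnj (cp (blk s \<alpha> k m a) * v + cq (blk s \<alpha> k m a) * cnj v) * (p' a * v + q' a * cnj v))"
      by blast
    define \<sigma> \<beta> where "\<sigma> = s (Suc (k + m))" and "\<beta> = \<alpha> (Suc (k + m))"
    define X Y where "X = (\<lambda>a. of_real (dgp \<sigma>) * cis (a + \<beta>))" and "Y = (\<lambda>a. of_real (dgq \<sigma>) * cis (a + (- \<beta>)))"
    define p q where "p = (\<lambda>a. cp (blk s \<alpha> k m a))" and "q = (\<lambda>a. cq (blk s \<alpha> k m a))"
    have X': "(X has_vector_derivative \<i> * X a) (at a)" and Y': "(Y has_vector_derivative \<i> * Y a) (at a)" for a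
      unfolding X_def Y_def by (rule cis_shift_has_vector_derivative)+
    have pq': "(p has_vector_derivative p' a) (at a)" "(q has_vector_derivative q' a) (at a)" for a
      using p' q' by (simp_all add: p_def q_def)
    have eqs: "cp (blk s \<alpha> k (Suc m) a) = X a * p a + Y a * cnj (q a)"
      "cq (blk s \<alpha> k (Suc m) a) = X a * q a + Y a * cnj (p a)" for a
      by (simp_all add: cp_mult cq_mult cp_stp cq_stp X_def Y_def p_def q_def \<sigma>_def \<beta>_def)
    have cn: "((\<lambda>a. cnj (p a)) has_vector_derivative cnj (p' a)) (at a)"
      "((\<lambda>a. cnj (q a)) has_vector_derivative cnj (q' a)) (at a)" for a
      using bounded_linear.has_vector_derivative[OF bounded_linear_cnj] pq' by auto
    define P' where "P' = (\<lambda>a. X a * p' a + (\<i> * X a) * p a + (Y a * cnj (q' a) + (\<i> * Y a) * cnj (q a)))"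
    define Q' where "Q' = (\<lambda>a. X a * q' a + (\<i> * X a) * q a + (Y a * cnj (p' a) + (\<i> * Y a) * cnj (p a)))"
    have 1: "((\<lambda>a. X a * p a + Y a * cnj (q a)) has_vector_derivative P' a) (at a)" for a
      unfolding P'_def by (intro has_vector_derivative_add has_vector_derivative_mult X' Y' pq' cn)
    have 2: "((\<lambda>a. X a * q a + Y a * cnj (p a)) has_vector_derivative Q' a) (at a)" for a
      unfolding Q'_def by (intro has_vector_derivative_add has_vector_derivative_mult X' Y' pq' cn)
    have 3: "0 \<le> Im (cnj ((X a * p a + Y a * cnj (q a)) * v + (X a * q a + Y a * cnj (p a)) * cnj v) * (P' a * v + Q' a * cnj v))" for a v
    proof -
      define w w' where "w = p a * v + q a * cnj v" and "w' = p' a * v + q' a * cnj v"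
      define W where "W = X a * w + Y a * cnj w"
      have e1: "(X a * p a + Y a * cnj (q a)) * v + (X a * q a + Y a * cnj (p a)) * cnj v = W"
        by (simp add: W_def w_def algebra_simps)
      have e2: "P' a * v + Q' a * cnj v = \<i> * W + (X a * w' + Y a * cnj w')"
        by (simp add: P'_def Q'_def W_def w_def w'_def algebra_simps)
      have "Im (cnj W * (\<i> * W)) = (cmod W)\<^sup>2"
        unfolding cmod_power2 by (simp add: power2_eq_square)
      moreover have "Im (cnj W * (X a * w' + Y a * cnj w')) = ((cmod (X a))\<^sup>2 - (cmod (Y a))\<^sup>2) * Im (cnj w * w')"
        unfolding cmod_power2 by (simp add: W_def power2_eq_square algebra_simps)
      moreover have "(cmod (X a))\<^sup>2 - (cmod (Y a))\<^sup>2 = 1"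
        using dgp_dgq[OF s, of "Suc (k + m)"] by (simp add: X_def Y_def norm_mult \<sigma>_def)
      moreover have "0 \<le> Im (cnj w * w')"
        using pos[of a v] by (simp add: w_def w'_def p_def q_def)
      ultimately show ?thesis
        unfolding e1 e2 distrib_left by simp
    qed
    show ?case
      unfolding eqs using 1 2 3 by blast
  qed
  then show ?thesis using that by blast
qed

text \<open>For nonzero \<open>q\<close> this says that \<open>|q|\<close> times the absolute
  angular speed of \<open>q\<close> is at most \<open>|p|\<close> times the angular speed of
  \<open>p\<close>. It is enough to test the hypothesis on the most expanded and the most contracted
  direction, where the quadratic form in \<open>v\<close> factors.\<close>

lemma positive_rotation_ineq:
  assumes pos: "\<And>v. 0 \<le> Im (cnj (p * v + q * cnj v) * (p' * v + q' * cnj v))"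
    and lt: "cmod q < cmod p"
  shows "\<bar>Im (cnj q * q')\<bar> * cmod p \<le> cmod q * Im (cnj p * p')"
proof (cases "q = 0")
  case False
  define x y where "x = Im (cnj p * p')" and "y = Im (cnj q * q')"
  have P: "cmod p > 0" using lt by (smt (verit) norm_ge_zero)
  have Q: "cmod q > 0" using False by simp
  have *: "0 \<le> cmod p * cmod q * (x + y) + \<sigma> * ((cmod p)\<^sup>2 * y + (cmod q)\<^sup>2 * x)" if "\<sigma> = 1 \<or> \<sigma> = -1" for \<sigma> :: real
  proof -
    define v where "v = csqrt (of_real \<sigma> * cnj p * q)"
    have v2: "v * v = of_real \<sigma> * cnj p * q" by (simp add: v_def flip: power2_eq_square)
    have vv: "v * cnj v = of_real (cmod p * cmod q)"
    proof -
      have "cmod v * cmod v = cmod p * cmod q"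
        unfolding norm_mult[symmetric] v2 using that by (auto simp: norm_mult)
      then show ?thesis
        by (simp add: complex_norm_square[symmetric] power2_eq_square flip: of_real_mult)
    qed
    have "cnj (p * v + q * cnj v) * (p' * v + q' * cnj v) =
      (v * cnj v) * (cnj p * p' + cnj q * q') + cnj p * q' * cnj (v * v) + cnj q * p' * (v * v)"
      by (simp add: algebra_simps)
    also have "\<dots> = of_real (cmod p * cmod q) * (cnj p * p' + cnj q * q') +
      of_real \<sigma> * (of_real ((cmod p)\<^sup>2) * (cnj q * q') + of_real ((cmod q)\<^sup>2) * (cnj p * p'))"
      unfolding v2 vv complex_norm_square by (simp add: algebra_simps)
    also have "Im \<dots> = cmod p * cmod q * (x + y) + \<sigma> * ((cmod p)\<^sup>2 * y + (cmod q)\<^sup>2 * x)"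
      by (simp add: x_def y_def flip: of_real_power)
    finally show ?thesis using pos[of v] by simp
  qed
  have "0 \<le> (cmod p - cmod q) * (cmod q * x - cmod p * y)"
    using *[of "-1"] by (simp add: algebra_simps power2_eq_square)
  then have 1: "cmod p * y \<le> cmod q * x" using lt by (simp add: zero_le_mult_iff)
  have "0 \<le> (cmod p + cmod q) * (cmod q * x + cmod p * y)"
    using *[of 1] by (simp add: algebra_simps power2_eq_square)
  then have "- (cmod p * y) \<le> cmod q * x" using P Q by (simp add: zero_le_mult_iff)
  with 1 have "\<bar>cmod p * y\<bar> \<le> cmod q * x" by (simp add: abs_le_iff)
  then show ?thesis
    by (simp add: abs_mult mult.commute[of _ "cmod p"] x_def y_def)
qed simp

text \<open>Continuity keeps \<open>L y - L x\<close> in the strip on which \<open>Ln\<close>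
  inverts \<open>exp\<close>, so near \<open>x\<close> the given logarithm equals
  \<open>L x + Ln (g y / g x)\<close> and inherits the derivative of \<open>Ln\<close> at 1.\<close>

lemma has_real_derivative_Im_log:
  fixes L g :: "real \<Rightarrow> complex"
  assumes "open S" "x \<in> S" "continuous_on S L" "\<And>y. y \<in> S \<Longrightarrow> exp (L y) = g y"
    and g': "(g has_vector_derivative d) (at x)"
  shows "((\<lambda>y. Im (L y)) has_real_derivative Im (d / g x)) (at x)"
proof -
  have gx: "g x \<noteq> 0" using assms(4)[OF assms(2)] by (metis exp_not_eq_zero)
  have "isCont L x" using assms(1-3) continuous_on_eq_continuous_at by blast
  then have "(L \<longlongrightarrow> L x) (nhds x)"
    unfolding isCont_def tendsto_at_iff_tendsto_nhds .
  from tendstoD[OF this pi_gt_zero]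
  have ev1: "\<forall>\<^sub>F y in nhds x. cmod (L y - L x) < pi" unfolding dist_norm .
  have ev2: "\<forall>\<^sub>F y in nhds x. y \<in> S" using assms(1,2) by (rule eventually_nhds_in_open)
  have ev: "\<forall>\<^sub>F y in nhds x. L y = L x + Ln (g y / g x)"
    using ev1 ev2
  proof eventually_elim
    case (elim y)
    have "\<bar>Im (L y - L x)\<bar> < pi" using elim(1) abs_Im_le_cmod[of "L y - L x"] by linarith
    then have "Ln (exp (L y - L x)) = L y - L x" by (intro Ln_exp) auto
    then show ?case using elim(2) assms(2,4) by (simp add: exp_diff)
  qed
  have "((\<lambda>y. g y / g x) has_vector_derivative d / g x) (at x)"
    by (intro derivative_intros g')
  moreover have "(Ln has_field_derivative inverse 1) (at (g x / g x))"
    using gx has_field_derivative_Ln[of 1] by simp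
  ultimately have "(Ln \<circ> (\<lambda>y. g y / g x) has_vector_derivative (d / g x) * inverse 1) (at x)"
    by (rule field_vector_diff_chain_at)
  then have "((\<lambda>y. Ln (g y / g x)) has_vector_derivative (d / g x)) (at x)"
    by (simp add: o_def)
  then have "((\<lambda>y. L x + Ln (g y / g x)) has_vector_derivative (d / g x)) (at x)"
    by (auto intro!: derivative_eq_intros)
  then have "((\<lambda>y. Im (L x + Ln (g y / g x))) has_vector_derivative Im (d / g x)) (at x)"
    using bounded_linear.has_vector_derivative[OF bounded_linear_Im] by blast
  then have D: "((\<lambda>y. Im (L x + Ln (g y / g x))) has_real_derivative Im (d / g x)) (at x)"
    by (simp add: has_real_derivative_iff_has_vector_derivative)
  have "\<forall>\<^sub>F y in nhds x. Im (L y) = Im (L x + Ln (g y / g x))"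
    using ev by eventually_elim simp
  from DERIV_cong_ev[OF refl this refl] D show ?thesis by simp
qed

section \<open>Continuous logarithms\<close>

lemma continuous_blk:
  assumes s: "\<And>j. s j \<ge> 1"
  shows "continuous_on A (\<lambda>a. cp (blk s \<alpha> k m a))" "continuous_on A (\<lambda>a. cq (blk s \<alpha> k m a))"
proof -
  obtain p' q' where
    *: "\<And>a. ((\<lambda>a. cp (blk s \<alpha> k m a)) has_vector_derivative p' a) (at a)"
    "\<And>a. ((\<lambda>a. cq (blk s \<alpha> k m a)) has_vector_derivative q' a) (at a)"
    using blk_has_derivative[where s=s, OF s] by metis
  show "continuous_on A (\<lambda>a. cp (blk s \<alpha> k m a))" "continuous_on A (\<lambda>a. cq (blk s \<alpha> k m a))"
    by (intro continuous_at_imp_continuous_on ballI has_vector_derivative_continuous[OF *(1)]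
        has_vector_derivative_continuous[OF *(2)])+
qed

lemma Ln_one_plus:
  assumes "cmod z < 1"
  shows "1 + z \<noteq> 0" "1 + z \<notin> \<real>\<^sub>\<le>\<^sub>0" "\<bar>Im (Ln (1 + z))\<bar> < pi / 2"
proof -
  have "Re (1 + z) > 0" using assms abs_Re_le_cmod[of z] by simp
  then show "1 + z \<noteq> 0" "1 + z \<notin> \<real>\<^sub>\<le>\<^sub>0" "\<bar>Im (Ln (1 + z))\<bar> < pi / 2"
    using Re_Ln_pos_lt[of "1 + z"] by (auto simp: complex_nonpos_Reals_iff complex_eq_iff)
qed

text \<open>A further step multiplies \<open>cp\<close> by
  \<open>dgp \<sigma> * cis (a + \<beta>) * (1 + z a)\<close> with \<open>|z a| < 1\<close>. The
  principal logarithm of the last factor is continuous with imaginary part in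
  \<open>(- pi / 2, pi / 2)\<close>, so the step adds at most \<open>\<bar>a - b\<bar> + pi\<close>
  to the variation of the argument.\<close>

lemma continuous_log_blk:
  assumes s: "\<And>j. s j \<ge> 1"
  obtains L where "continuous_on UNIV L" "\<And>a. exp (L a) = cp (blk s \<alpha> k m a)"
    "\<And>a b. \<bar>Im (L a) - Im (L b)\<bar> \<le> m * (\<bar>a - b\<bar> + pi)"
proof -
  have "\<exists>L. continuous_on UNIV L \<and> (\<forall>a. exp (L a) = cp (blk s \<alpha> k m a)) \<and>
      (\<forall>a b. \<bar>Im (L a) - Im (L b)\<bar> \<le> m * (\<bar>a - b\<bar> + pi))"
  proof (induction m)
    case 0
    show ?case by (intro exI[of _ "\<lambda>_. 0"]) simp
  next
    case (Suc m)
    then obtain L where L: "continuous_on UNIV L" "\<And>a. exp (L a) = cp (blk s \<alpha> k m a)"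
      "\<And>a b. \<bar>Im (L a) - Im (L b)\<bar> \<le> m * (\<bar>a - b\<bar> + pi)" by blast
    define \<sigma> \<beta> where "\<sigma> = s (Suc (k + m))" and "\<beta> = \<alpha> (Suc (k + m))"
    have \<sigma>: "\<sigma> \<ge> 1" using s by (simp add: \<sigma>_def)
    define p q where "p = (\<lambda>a. cp (blk s \<alpha> k m a))" and "q = (\<lambda>a. cq (blk s \<alpha> k m a))"
    define z where "z = (\<lambda>a. of_real (dgq \<sigma> / dgp \<sigma>) * cis (- 2 * \<beta>) * (cnj (q a) / p a))"
    have det: "det (blk s \<alpha> k m a) = 1" for a by (rule det_blk[OF s])
    have pq: "p a \<noteq> 0" "cmod (q a) < cmod (p a)" for a
      using det_one_cmod[OF det] by (auto simp: p_def q_def)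
    have z1: "cmod (z a) < 1" for a
    proof -
      have "cmod (z a) = dgq \<sigma> / dgp \<sigma> * (cmod (q a) / cmod (p a))"
        using dgp_dgq[OF \<sigma>] by (simp add: z_def norm_mult norm_divide)
      also have "\<dots> \<le> 1 * (cmod (q a) / cmod (p a))"
        using dgp_dgq[OF \<sigma>] by (intro mult_right_mono) auto
      also have "\<dots> < 1" using pq[of a] by (simp add: divide_less_eq)
      finally show ?thesis .
    qed
    have rec: "cp (blk s \<alpha> k (Suc m) a) = of_real (dgp \<sigma>) * cis (a + \<beta>) * p a * (1 + z a)" for a
    proof -
      have "cp (blk s \<alpha> k (Suc m) a) = of_real (dgp \<sigma>) * cis (a + \<beta>) * p a + of_real (dgq \<sigma>) * cis (a - \<beta>) * cnj (q a)"
        by (simp add: cp_mult cp_stp cq_stp p_def q_def \<sigma>_def \<beta>_def)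
      also have "cis (a - \<beta>) = cis (a + \<beta>) * cis (- 2 * \<beta>)" by (simp add: cis_mult)
      also have "of_real (dgp \<sigma>) * cis (a + \<beta>) * p a + of_real (dgq \<sigma>) * (cis (a + \<beta>) * cis (- 2 * \<beta>)) * cnj (q a)
         = of_real (dgp \<sigma>) * cis (a + \<beta>) * p a * (1 + z a)"
        using pq[of a] dgp_dgq[OF \<sigma>] by (simp add: z_def field_simps)
      finally show ?thesis .
    qed
    define L' where "L' = (\<lambda>a. L a + of_real (ln (dgp \<sigma>)) + \<i> * of_real (a + \<beta>) + Ln (1 + z a))"
    have "continuous_on UNIV z"
      unfolding z_def p_def q_def
      by (intro continuous_intros continuous_blk s ballI) (use pq in \<open>auto simp: p_def\<close>)
    then have "continuous_on UNIV L'"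
      unfolding L'_def by (intro continuous_intros L continuous_on_Ln) (use Ln_one_plus[OF z1] in auto)
    moreover have "exp (L' a) = cp (blk s \<alpha> k (Suc m) a)" for a
    proof -
      have "exp (complex_of_real (ln (dgp \<sigma>))) = of_real (dgp \<sigma>)"
        using dgp_dgq(2)[OF \<sigma>] by (simp only: exp_of_real exp_ln)
      then show ?thesis
        using Ln_one_plus[OF z1, of a]
        by (simp only: L'_def exp_add L(2) rec exp_Ln cis_conv_exp p_def) (simp add: mult_ac)
    qed
    moreover have "\<bar>Im (L' a) - Im (L' b)\<bar> \<le> Suc m * (\<bar>a - b\<bar> + pi)" for a b
    proof -
      have "Im (L' a) - Im (L' b) = (Im (L a) - Im (L b)) + (a - b) + (Im (Ln (1 + z a)) - Im (Ln (1 + z b)))"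
        by (simp add: L'_def)
      then have "\<bar>Im (L' a) - Im (L' b)\<bar> \<le> \<bar>Im (L a) - Im (L b)\<bar> + \<bar>a - b\<bar> + pi"
        using Ln_one_plus(3)[OF z1, of a] Ln_one_plus(3)[OF z1, of b] by linarith
      then show ?thesis using L(3)[of a b] by (simp add: algebra_simps)
    qed
    ultimately show ?case by blast
  qed
  then show ?thesis using that by blast
qed

text \<open>For diagonal \<open>H\<close> of determinant 1 one has
  \<open>H ** Rot (pi / 2) ** H = Rot (pi / 2)\<close>; hence a pair of steps whose second angle is
  \<open>pi / 2 - b\<close> is a rotation at the parameter \<open>b\<close>. The proof follows the
  image \<open>w\<close> of the vector 1. A pair multiplies \<open>w\<close> by
  \<open>\<i> * cis (a + \<beta>) * z a\<close>, where \<open>Im (z a)\<close> has the sign of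
  \<open>a - b\<close>; from \<open>lo\<close> to \<open>hi\<close> the argument of \<open>z\<close>
  therefore does not decrease, and the pair contributes at least \<open>hi - lo\<close>. The loss
  \<open>pi\<close> comes from passing from \<open>w = cp + cq\<close> to \<open>cp\<close>.\<close>

lemma rotating_run:
  assumes s: "\<And>j. s j \<ge> 1" and \<sigma>: "\<And>j. j \<in> {k<..k + 2 * K} \<Longrightarrow> s j = \<sigma>"
    and lohi: "lo \<le> hi" "hi - lo < pi"
    and run: "\<And>j. j < K \<Longrightarrow> \<exists>b\<in>{lo..hi}. cis (\<alpha> (k + 2 * j + 2)) = cis (pi / 2 - b)"
  obtains L where "continuous_on {lo..hi} L" "\<And>a. a \<in> {lo..hi} \<Longrightarrow> exp (L a) = cp (blk s \<alpha> k (2 * K) a)"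
    "Im (L hi) - Im (L lo) \<ge> K * (hi - lo) - pi"
proof -
  have det: "det (blk s \<alpha> k m a) = 1" for m a by (rule det_blk[OF s])
  have "\<exists>L. continuous_on {lo..hi} L \<and> (\<forall>a\<in>{lo..hi}. exp (L a) = cp (blk s \<alpha> k (2 * n) a) + cq (blk s \<alpha> k (2 * n) a)) \<and>
      Im (L hi) - Im (L lo) \<ge> n * (hi - lo)" if "n \<le> K" for n
    using that
  proof (induction n)
    case 0
    show ?case by (intro exI[of _ "\<lambda>_. 0"]) simp
  next
    case (Suc n)
    then obtain L where L: "continuous_on {lo..hi} L"
      "\<And>a. a\<in>{lo..hi} \<Longrightarrow> exp (L a) = cp (blk s \<alpha> k (2 * n) a) + cq (blk s \<alpha> k (2 * n) a)"
      "Im (L hi) - Im (L lo) \<ge> n * (hi - lo)" by auto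
    from run[of n] Suc.prems obtain b where b: "b \<in> {lo..hi}" "cis (\<alpha> (k + 2 * n + 2)) = cis (pi / 2 - b)"
      by auto
    define \<beta> where "\<beta> = \<alpha> (k + 2 * n + 1)"
    have ss: "s (k + 2 * n + 1) = \<sigma>" "s (k + 2 * n + 2) = \<sigma>"
      using Suc.prems by (auto intro!: \<sigma>)
    have \<sigma>1: "\<sigma> \<ge> 1" using s[of "k + 2 * n + 1"] ss by simp
    define c t where "c = dgp \<sigma>" and "t = dgq \<sigma>"
    have ct: "t \<ge> 0" "t < c" "c\<^sup>2 - t\<^sup>2 = 1" using dgp_dgq[OF \<sigma>1] by (auto simp: c_def t_def)
    define w where "w = (\<lambda>a. cp (blk s \<alpha> k (2 * n) a) + cq (blk s \<alpha> k (2 * n) a))"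
    have w0: "w a \<noteq> 0" for a
      using det_one_cmod(3)[OF det[of "2 * n" a]] norm_diff_ineq[of "cp (blk s \<alpha> k (2 * n) a)" "cq (blk s \<alpha> k (2 * n) a)"]
      by (auto simp: w_def)
    define e where "e = (\<lambda>a. cis (- 2 * \<beta>) * cnj (w a) / w a)"
    have e1: "cmod (e a) = 1" for a using w0[of a] by (simp add: e_def norm_mult norm_divide)
    define z where "z = (\<lambda>a. of_real (cos (a - b)) + \<i> * of_real (sin (a - b)) * (of_real (c\<^sup>2 + t\<^sup>2) + of_real (2 * c * t) * e a))"
    have rec: "cp (blk s \<alpha> k (2 * Suc n) a) + cq (blk s \<alpha> k (2 * Suc n) a) = \<i> * cis (a + \<beta>) * w a * z a" for a
    proof -
      define p q where "p = cp (blk s \<alpha> k (2 * n) a)" and "q = cq (blk s \<alpha> k (2 * n) a)"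
      define x where "x = cis (a - b)"
      have cis2: "cis (a + \<alpha> (k + 2 * n + 2)) = \<i> * x"
        by (simp only: cis_mult[symmetric] b(2) x_def minus_real_def) (simp add: cis_mult)
      have cis3: "cis (a - \<alpha> (k + 2 * n + 2)) = - \<i> * (cis a * cis a) * cnj x"
      proof -
        have "cis (a - \<alpha> (k + 2 * n + 2)) = cis a * cnj (cis (\<alpha> (k + 2 * n + 2)))"
          unfolding cis_cnj cis_mult by simp
        also have "\<dots> = cis a * cnj (\<i> * cis (- b))"
          unfolding b(2) by (metis cis_mult cis_pi_half minus_real_def)
        also have "\<dots> = - \<i> * (cis a * cis b)" by (simp add: cis_cnj)
        also have "cis a * cis b = (cis a * cis a) * cnj x"
          by (simp add: x_def cis_cnj cis_mult)
        finally show ?thesis by (simp only: mult.assoc)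
      qed
      have X: "blk s \<alpha> k (2 * Suc n) a = stp \<sigma> (\<alpha> (k + 2 * n + 2)) a ** (stp \<sigma> \<beta> a ** blk s \<alpha> k (2 * n) a)"
        using ss by (simp add: \<beta>_def)
      define u v where "u = cis (a + \<beta>)" and "v = cis (a - \<beta>)"
      have aa: "cis a * cis a = u * v" by (simp add: u_def v_def cis_mult)
      have uv: "u * cnj u = 1" "v * cnj v = 1" by (simp_all add: u_def v_def cis_cnj cis_mult)
      have eu: "u * w a * e a = v * cnj (w a)"
      proof -
        have "cis (a + \<beta>) * cis (- 2 * \<beta>) = cis (a - \<beta>)" by (simp add: cis_mult)
        then show ?thesis using w0[of a] by (simp add: e_def u_def v_def field_simps)
      qed
      have "cp (blk s \<alpha> k (2 * Suc n) a) + cq (blk s \<alpha> k (2 * Suc n) a) =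
        of_real c * (\<i> * x) * (of_real c * u * (p + q) + of_real t * v * cnj (p + q)) +
        of_real t * (- \<i> * (u * v) * cnj x) * cnj (of_real c * u * (p + q) + of_real t * v * cnj (p + q))"
        unfolding X cp_mult cq_mult cp_stp cq_stp cis2 cis3 p_def q_def c_def t_def u_def[symmetric] v_def[symmetric] aa
        by (simp add: algebra_simps)
      also have "p + q = w a" by (simp add: w_def p_def q_def)
      also have "of_real c * (\<i> * x) * (of_real c * u * w a + of_real t * v * cnj (w a)) +
        of_real t * (- \<i> * (u * v) * cnj x) * cnj (of_real c * u * w a + of_real t * v * cnj (w a)) =
        \<i> * (of_real c * of_real c * x * (u * w a) + of_real c * of_real t * x * (v * cnj (w a))
        - of_real c * of_real t * cnj x * (u * cnj u) * (v * cnj (w a))  - of_real t * of_real t * cnj x * (v * cnj v) * (u * w a))"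
        by (simp add: algebra_simps)
      also have "\<dots> = \<i> * (u * w a) * (of_real (c\<^sup>2) * x - of_real (t\<^sup>2) * cnj x + of_real (c * t) * (x - cnj x) * e a)"
        unfolding uv eu[symmetric] by (simp add: algebra_simps power2_eq_square)
      also have "of_real (c\<^sup>2) * x - of_real (t\<^sup>2) * cnj x + of_real (c * t) * (x - cnj x) * e a = z a"
      proof -
        have "x = of_real (cos (a - b)) + \<i> * of_real (sin (a - b))"
          "cnj x = of_real (cos (a - b)) - \<i> * of_real (sin (a - b))"
          by (simp_all add: x_def complex_eq_iff)
        moreover have "complex_of_real (c\<^sup>2) = 1 + of_real (t\<^sup>2)" using ct(3) by (metis add.commute diff_add_cancel of_real_1 of_real_add)
        ultimately show ?thesis
          by (simp add: z_def algebra_simps)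
      qed
      finally show ?thesis by (simp add: u_def mult_ac)
    qed
    define r where "r = (\<lambda>a. c\<^sup>2 + t\<^sup>2 + 2 * c * t * Re (e a))"
    have r0: "r a > 0" for a
    proof -
      have "Re (e a) \<ge> -1" using abs_Re_le_cmod[of "e a"] e1[of a] by linarith
      then have "2 * c * t * Re (e a) \<ge> 2 * c * t * (-1)" using ct by (intro mult_left_mono) auto
      moreover have "(c - t)\<^sup>2 > 0" using ct by simp
      ultimately show ?thesis by (simp add: r_def power2_eq_square algebra_simps)
    qed
    have Imz: "Im (z a) = sin (a - b) * r a" for a
      by (simp add: z_def r_def flip: of_real_power)
    have zb: "z a \<notin> \<real>\<^sub>\<le>\<^sub>0" if "a \<in> {lo..hi}" for a
    proof (cases "a = b")
      case True then show ?thesis by (simp add: z_def)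
    next
      case False
      have "\<bar>a - b\<bar> < pi" using that b lohi by auto
      then have "sin (a - b) \<noteq> 0"
        using False sin_gt_zero[of "a - b"] sin_gt_zero[of "b - a"] sin_minus[of "b - a"] by (cases "a < b") auto
      then have "Im (z a) \<noteq> 0" using r0[of a] by (simp add: Imz)
      then show ?thesis by (auto simp: complex_nonpos_Reals_iff)
    qed
    then have z0: "z a \<noteq> 0" if "a \<in> {lo..hi}" for a using that by force
    define L' where "L' = (\<lambda>a. L a + \<i> * of_real (pi / 2 + (a + \<beta>)) + Ln (z a))"
    have "continuous_on {lo..hi} z"
      unfolding z_def e_def w_def
      by (intro continuous_intros continuous_blk s) (use w0 in \<open>auto simp: w_def\<close>)
    then have "continuous_on {lo..hi} L'"
      unfolding L'_def by (intro continuous_intros L continuous_on_Ln) (use zb in auto)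
    moreover have "exp (L' a) = cp (blk s \<alpha> k (2 * Suc n) a) + cq (blk s \<alpha> k (2 * Suc n) a)" if "a \<in> {lo..hi}" for a
    proof -
      have "exp (\<i> * of_real (pi / 2 + (a + \<beta>))) = \<i> * cis (a + \<beta>)"
        unfolding cis_conv_exp[symmetric] by (metis cis_mult cis_pi_half)
      then show ?thesis
        using z0[OF that] L(2)[OF that] unfolding rec by (simp add: L'_def exp_add w_def mult_ac)
    qed
    moreover have "Im (L' hi) - Im (L' lo) \<ge> Suc n * (hi - lo)"
    proof -
      have "Im (z hi) \<ge> 0" using b lohi r0[of hi] unfolding Imz by (intro mult_nonneg_nonneg sin_ge_zero) auto
      then have 1: "Im (Ln (z hi)) \<ge> 0" using Im_Ln_pos_le[OF z0[of hi]] lohi by auto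
      have "Im (z lo) \<le> 0"
        using b lohi r0[of lo] sin_ge_zero[of "b - lo"] sin_minus[of "b - lo"] unfolding Imz
        by (intro mult_nonpos_nonneg) auto
      then have 2: "Im (Ln (z lo)) \<le> 0"
        using Im_Ln_pos_lt[OF z0[of lo]] Im_Ln_less_pi[OF zb[of lo]] lohi by force
      have "Im (L' hi) - Im (L' lo) = (Im (L hi) - Im (L lo)) + (hi - lo) + Im (Ln (z hi)) - Im (Ln (z lo))"
        by (simp add: L'_def)
      then show ?thesis using 1 2 L(3) by (simp add: algebra_simps)
    qed
    ultimately show ?case by blast
  qed
  from this[OF order_refl] obtain L where L: "continuous_on {lo..hi} L"
    "\<And>a. a\<in>{lo..hi} \<Longrightarrow> exp (L a) = cp (blk s \<alpha> k (2 * K) a) + cq (blk s \<alpha> k (2 * K) a)"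
    "Im (L hi) - Im (L lo) \<ge> K * (hi - lo)" by auto
  define z where "z = (\<lambda>a. cq (blk s \<alpha> k (2 * K) a) / cp (blk s \<alpha> k (2 * K) a))"
  have z1: "cmod (z a) < 1" for a
    using det_one_cmod[OF det[of "2 * K" a]] by (simp add: z_def norm_divide divide_less_eq)
  have p0: "cp (blk s \<alpha> k (2 * K) a) \<noteq> 0" for a by (rule det_one_cmod[OF det])
  show ?thesis
  proof (rule that[of "\<lambda>a. L a - Ln (1 + z a)"])
    show "continuous_on {lo..hi} (\<lambda>a. L a - Ln (1 + z a))"
      by (intro continuous_intros L continuous_on_Ln)
        (use Ln_one_plus[OF z1] p0 in \<open>auto simp: z_def intro!: continuous_intros continuous_blk s\<close>)
    show "exp (L a - Ln (1 + z a)) = cp (blk s \<alpha> k (2 * K) a)" if "a \<in> {lo..hi}" for a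
    proof -
      have "cp (blk s \<alpha> k (2 * K) a) + cq (blk s \<alpha> k (2 * K) a) = cp (blk s \<alpha> k (2 * K) a) * (1 + z a)"
        using p0[of a] by (simp add: z_def field_simps)
      then show ?thesis using L(2)[OF that] Ln_one_plus[OF z1, of a] by (simp add: exp_diff)
    qed
    show "Im (L hi - Ln (1 + z hi)) - Im (L lo - Ln (1 + z lo)) \<ge> K * (hi - lo) - pi"
      using L(3) Ln_one_plus(3)[OF z1, of hi] Ln_one_plus(3)[OF z1, of lo] by simp
  qed
qed

section \<open>Cancellation\<close>

lemma has_vector_derivative_quotient:
  fixes f g :: "real \<Rightarrow> complex"
  assumes "(f has_vector_derivative f') (at x)" "(g has_vector_derivative g') (at x)" "g x \<noteq> 0"
  shows "((\<lambda>x. f x / g x) has_vector_derivative (f' * g x - f x * g') / (g x * g x)) (at x)"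
proof -
  have "((\<lambda>x. f x / g x) has_derivative (\<lambda>h. ((h *\<^sub>R f') * g x - f x * (h *\<^sub>R g')) / (g x * g x))) (at x)"
    using assms unfolding has_vector_derivative_def by (rule has_derivative_divide')
  also have "(\<lambda>h. ((h *\<^sub>R f') * g x - f x * (h *\<^sub>R g')) / (g x * g x)) =
      (\<lambda>h. h *\<^sub>R ((f' * g x - f x * g') / (g x * g x)))"
    by (simp add: fun_eq_iff scaleR_conv_of_real algebra_simps diff_divide_distrib)
  finally show ?thesis unfolding has_vector_derivative_def .
qed

text \<open>With \<open>p1 = cosh x\<close>, \<open>p2 = cosh y\<close> and \<open>x\<close>,
  \<open>y\<close> nonnegative, the left-hand side is \<open>cosh (x - y)\<close>.\<close>

lemma hyperbolic_difference_le:
  fixes p1 q1 p2 q2 :: real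
  assumes "p1\<^sup>2 = 1 + q1\<^sup>2" "p2\<^sup>2 = 1 + q2\<^sup>2" "1 \<le> p1" "1 \<le> p2" "0 \<le> q1" "0 \<le> q2"
  shows "p2 * p1 - q2 * q1 \<le> max p1 p2"
proof -
  have *: "P * p - Q * q \<le> p" if "P\<^sup>2 = 1 + Q\<^sup>2" "p\<^sup>2 = 1 + q\<^sup>2" "1 \<le> P" "P \<le> p" "0 \<le> q" "0 \<le> Q"
    for P Q p q :: real
  proof -
    have "(P - 1) * p \<le> Q * q"
    proof (rule power2_le_imp_le)
      have "P + 1 \<le> 2 * p\<^sup>2"
      proof -
        have "p * 1 \<le> p * p" using that by (intro mult_left_mono) auto
        then show ?thesis using that(3,4) unfolding power2_eq_square by linarith
      qed
      then have "(P - 1) * ((P - 1) * p\<^sup>2) \<le> (P - 1) * ((P + 1) * (p\<^sup>2 - 1))"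
        using that by (intro mult_left_mono) (auto simp: algebra_simps)
      also have "\<dots> = (P\<^sup>2 - 1) * (p\<^sup>2 - 1)" by (simp add: algebra_simps power2_eq_square)
      also have "\<dots> = (Q * q)\<^sup>2" using that by (simp add: power_mult_distrib)
      finally show "((P - 1) * p)\<^sup>2 \<le> (Q * q)\<^sup>2" by (simp add: power_mult_distrib power2_eq_square mult_ac)
    qed (use that in auto)
    then show ?thesis by (simp add: algebra_simps)
  qed
  show ?thesis
    using *[of p2 q2 p1 q1] *[of p1 q1 p2 q2] assms by (cases "p2 \<le> p1") (auto simp: max_def mult.commute)
qed

lemma opn_le_of_cq:
  assumes "det A = 1" "cmod (cq A) < Q"
  shows "opn A \<le> 2 * (Q + 1)"
proof -
  have "cmod (cp A) \<le> 1 + cmod (cq A)"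
    by (rule power2_le_imp_le) (simp_all add: det_one_cmod(1)[OF assms(1)] power2_sum)
  then show ?thesis using assms(2) unfolding opn_def by argo
qed

text \<open>If the singular directions of \<open>C\<close> and \<open>P ** B\<close> never matched on \<open>[lo, hi]\<close>, the argument of
  \<open>\<zeta>\<close> would stay in \<open>(-\<pi>, \<pi>)\<close>. It differs by a bounded amount from the argument of \<open>\<zeta>\<^sub>0\<close>, which
  hardly increases as long as \<open>B\<close> and \<open>C\<close> are strongly hyperbolic, minus twice the argument of
  \<open>cp P\<close>, which increases a lot because of the rotating run.\<close>

lemma cancellation:
  fixes s \<alpha> :: "nat \<Rightarrow> real" and k mB K mC :: nat and lo hi :: real
  defines "B \<equiv> \<lambda>a. blk s \<alpha> k mB a" and "P \<equiv> \<lambda>a. blk s \<alpha> (k + mB) (2 * K) a"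
    and "C \<equiv> \<lambda>a. blk s \<alpha> (k + mB + 2 * K) mC a"
  assumes s: "\<And>j. s j \<ge> 1" and \<sigma>: "\<And>j. j \<in> {k + mB<..k + mB + 2 * K} \<Longrightarrow> s j = \<sigma>"
    and lohi: "lo < hi" "hi - lo < pi"
    and run: "\<And>j. j < K \<Longrightarrow> \<exists>b\<in>{lo..hi}. cis (\<alpha> (k + mB + 2 * j + 2)) = cis (pi / 2 - b)"
    and K: "K * (hi - lo) \<ge> 8 * pi"
    and Q0: "Q0 \<ge> 1" "(mB + mC) * (2 * pi) \<le> Q0\<^sup>2" "\<And>a. opn (P a) \<le> Q0"
    and Mx: "\<And>a. opn (B a) \<le> Mx" "\<And>a. opn (C a) \<le> Mx"
  shows "\<exists>a\<in>{lo..hi}. opn (blk s \<alpha> k (mB + 2 * K + mC) a) \<le> 2 * Q0 * (Q0 + 1) * Mx"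
proof -
  have split: "blk s \<alpha> k (mB + 2 * K + mC) a = C a ** (P a ** B a)" for a
    by (simp add: blk_add B_def P_def C_def add.assoc matrix_mul_assoc)
  have det: "det (B a) = 1" "det (P a) = 1" "det (C a) = 1" "det (P a ** B a) = 1" for a
    using det_blk[OF s] by (auto simp: B_def P_def C_def det_mul)
  note dB = det_one_cmod[OF det(1)] and dP = det_one_cmod[OF det(2)] and dC = det_one_cmod[OF det(3)]
    and dPB = det_one_cmod[OF det(4)]
  have Mx1: "Mx \<ge> 1" using dB(6)[of 0] Mx(1)[of 0] by linarith
  \<comment> \<open>\<open>cp (C a ** (P a ** B a))\<close> equals
    \<open>cp (C a) * cp (P a ** B a) * (1 + \<zeta> a)\<close>, so the best possible cancellation
    occurs where \<open>\<zeta> a\<close> is a nonpositive real.\<close>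
  define \<zeta> where "\<zeta> = (\<lambda>a. cq (C a) / cp (C a) * (cnj (cq (P a ** B a)) / cp (P a ** B a)))"
  show ?thesis
  proof (rule ccontr)
    assume neg: "\<not> ?thesis"
    have big: "opn (C a ** (P a ** B a)) > 2 * Q0 * (Q0 + 1) * Mx" if "a \<in> {lo..hi}" for a
      using neg that unfolding split by force
    \<comment> \<open>If \<open>B a\<close> were only weakly hyperbolic, submultiplicativity alone
      would give the asserted bound; the same holds for \<open>C a\<close> below.\<close>
    have cq_B: "cmod (cq (B a)) \<ge> Q0" if "a \<in> {lo..hi}" for a
    proof (rule ccontr)
      assume "\<not> ?thesis"
      then have "opn (B a) \<le> 2 * (Q0 + 1)" using opn_le_of_cq[OF det(1)] by auto
      then have "opn (C a) * (opn (P a) * opn (B a)) \<le> Mx * (Q0 * (2 * (Q0 + 1)))"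
        using Mx Q0 Mx1 by (intro mult_mono) (auto intro!: opn_nonneg mult_nonneg_nonneg)
      moreover have "opn (C a ** (P a ** B a)) \<le> opn (C a) * (opn (P a) * opn (B a))"
        by (meson opn_mult opn_nonneg mult_left_mono order_trans)
      ultimately show False using big[OF that] by (simp add: algebra_simps)
    qed
    have cq_C: "cmod (cq (C a)) \<ge> Q0" if "a \<in> {lo..hi}" for a
    proof (rule ccontr)
      assume "\<not> ?thesis"
      then have "opn (C a) \<le> 2 * (Q0 + 1)" using opn_le_of_cq[OF det(3)] by auto
      then have "opn (C a) * (opn (P a) * opn (B a)) \<le> 2 * (Q0 + 1) * (Q0 * Mx)"
        using Mx Q0 Mx1 by (intro mult_mono) (auto intro!: opn_nonneg mult_nonneg_nonneg)
      moreover have "opn (C a ** (P a ** B a)) \<le> opn (C a) * (opn (P a) * opn (B a))"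
        by (meson opn_mult opn_nonneg mult_left_mono order_trans)
      ultimately show False using big[OF that] by (simp add: algebra_simps)
    qed
    have \<zeta>: "\<zeta> a \<notin> \<real>\<^sub>\<le>\<^sub>0" if a: "a \<in> {lo..hi}" for a
    proof
      assume "\<zeta> a \<in> \<real>\<^sub>\<le>\<^sub>0"
      define p1 q1 p2 q2 where "p1 = cp (P a ** B a)" and "q1 = cq (P a ** B a)" and "p2 = cp (C a)" and "q2 = cq (C a)"
      note d1 = dPB[of a, folded p1_def q1_def] and d2 = dC[of a, folded p2_def q2_def]
      have z: "\<zeta> a = - of_real (cmod q2 / cmod p2 * (cmod q1 / cmod p1))"
      proof -
        from \<open>\<zeta> a \<in> \<real>\<^sub>\<le>\<^sub>0\<close> have "\<zeta> a = - of_real (cmod (\<zeta> a))"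
          by (auto elim!: nonpos_Reals_cases)
        moreover have "cmod (\<zeta> a) = cmod q2 / cmod p2 * (cmod q1 / cmod p1)"
          by (simp add: \<zeta>_def p1_def q1_def p2_def q2_def norm_mult norm_divide)
        ultimately show ?thesis by simp
      qed
      have "cp (C a ** (P a ** B a)) = p2 * p1 * (1 + \<zeta> a)"
        using d1(4) d2(4) by (simp add: cp_mult[of "C a"] p1_def[symmetric] q1_def[symmetric] p2_def[symmetric] q2_def[symmetric] \<zeta>_def field_simps)
      also have "1 + \<zeta> a = of_real (1 - cmod q2 / cmod p2 * (cmod q1 / cmod p1))" unfolding z by simp
      finally have "cmod (cp (C a ** (P a ** B a))) = cmod p2 * cmod p1 * \<bar>1 - cmod q2 / cmod p2 * (cmod q1 / cmod p1)\<bar>"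
        by (simp add: norm_mult del: of_real_diff of_real_mult of_real_divide)
      also have "\<dots> = \<bar>cmod p2 * cmod p1 * (1 - cmod q2 / cmod p2 * (cmod q1 / cmod p1))\<bar>"
        by (simp add: abs_mult)
      also have "cmod p2 * cmod p1 * (1 - cmod q2 / cmod p2 * (cmod q1 / cmod p1)) = cmod p2 * cmod p1 - cmod q2 * cmod q1"
        using d1(4) d2(4) by (simp add: field_simps)
      also have "\<bar>\<dots>\<bar> = cmod p2 * cmod p1 - cmod q2 * cmod q1"
        using mult_mono[of "cmod q2" "cmod p2" "cmod q1" "cmod p1"] d1(3) d2(3) by simp
      also have "\<dots> \<le> max (cmod p1) (cmod p2)"
        by (rule hyperbolic_difference_le) (use d1 d2 in auto)
      also have "\<dots> \<le> Q0 * Mx"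
      proof -
        have "cmod p1 \<le> opn (P a ** B a)" by (simp add: p1_def opn_def)
        also have "\<dots> \<le> opn (P a) * opn (B a)" by (rule opn_mult)
        also have "\<dots> \<le> Q0 * Mx" using Mx Q0 by (intro mult_mono) (auto intro: opn_nonneg)
        finally have 1: "cmod p1 \<le> Q0 * Mx" .
        have "cmod p2 \<le> opn (C a)" by (simp add: p2_def opn_def)
        also have "\<dots> \<le> 1 * Mx" using Mx by simp
        also have "\<dots> \<le> Q0 * Mx" using Q0 Mx1 by (intro mult_right_mono) auto
        finally show ?thesis using 1 by simp
      qed
      finally have "opn (C a ** (P a ** B a)) \<le> 2 * (Q0 * Mx)"
        using det_one_cmod(5)[of "C a ** (P a ** B a)"] det by (simp add: det_mul)
      also have "\<dots> \<le> 2 * Q0 * (Q0 + 1) * Mx"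
      proof -
        have "Q0 * Mx * 1 \<le> Q0 * Mx * (Q0 + 1)" using Q0 Mx1 by (intro mult_left_mono) auto
        moreover have "0 \<le> Q0 * Mx * (Q0 + 1)" using Q0 Mx1 by simp
        ultimately show ?thesis by argo
      qed
      finally show False using big[OF a] by simp
    qed
    obtain LP where LP: "continuous_on {lo..hi} LP" "\<And>a. a \<in> {lo..hi} \<Longrightarrow> exp (LP a) = cp (P a)"
      "Im (LP hi) - Im (LP lo) \<ge> K * (hi - lo) - pi"
      using rotating_run[of s "k + mB" K \<sigma> lo hi \<alpha>] s \<sigma> lohi run unfolding P_def by (metis less_imp_le)
    obtain LB where LB: "continuous_on UNIV LB" "\<And>a. exp (LB a) = cp (B a)"
      "\<And>a b. \<bar>Im (LB a) - Im (LB b)\<bar> \<le> mB * (\<bar>a - b\<bar> + pi)"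
      using continuous_log_blk[of s \<alpha> k mB] s unfolding B_def by metis
    obtain LC where LC: "continuous_on UNIV LC" "\<And>a. exp (LC a) = cp (C a)"
      "\<And>a b. \<bar>Im (LC a) - Im (LC b)\<bar> \<le> mC * (\<bar>a - b\<bar> + pi)"
      using continuous_log_blk[of s \<alpha> "k + mB + 2 * K" mC] s unfolding C_def by metis
    obtain pB' qB' where
      B': "\<And>a. ((\<lambda>a. cp (B a)) has_vector_derivative pB' a) (at a)"
      "\<And>a. ((\<lambda>a. cq (B a)) has_vector_derivative qB' a) (at a)"
      "\<And>a v. 0 \<le> Im (cnj (cp (B a) * v + cq (B a) * cnj v) * (pB' a * v + qB' a * cnj v))"
      using blk_has_derivative[of s \<alpha> k mB] s unfolding B_def by metis
    obtain pC' qC' where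
      C': "\<And>a. ((\<lambda>a. cp (C a)) has_vector_derivative pC' a) (at a)"
      "\<And>a. ((\<lambda>a. cq (C a)) has_vector_derivative qC' a) (at a)"
      "\<And>a v. 0 \<le> Im (cnj (cp (C a) * v + cq (C a) * cnj v) * (pC' a * v + qC' a * cnj v))"
      using blk_has_derivative[of s \<alpha> "k + mB + 2 * K" mC] s unfolding C_def by metis
    have cont: "continuous_on S (\<lambda>a. cp (B a))" "continuous_on S (\<lambda>a. cq (B a))"
      "continuous_on S (\<lambda>a. cp (P a))" "continuous_on S (\<lambda>a. cq (P a))"
      "continuous_on S (\<lambda>a. cp (C a))" "continuous_on S (\<lambda>a. cq (C a))" for S
      unfolding B_def P_def C_def by (intro continuous_blk s)+
    define f where "f = (\<lambda>a. cnj (cq (B a)) / cp (B a))"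
    \<comment> \<open>\<open>\<zeta>0\<close> is \<open>\<zeta>\<close> with \<open>P\<close>
      removed: \<open>\<zeta>\<close> equals \<open>\<zeta>0\<close> times
      \<open>cnj (cp P) / cp P\<close> times \<open>(1 + u') / (1 + u)\<close>. Since
      \<open>u\<close> and \<open>u'\<close> have modulus below 1, the last quotient moves the
      argument only by a bounded amount.\<close>
    define \<zeta>0 where "\<zeta>0 = (\<lambda>a. cq (C a) / cp (C a) * f a)"
    define u where "u = (\<lambda>a. cq (P a) / cp (P a) * f a)"
    define u' where "u' = (\<lambda>a. cnj (cq (P a) / cp (P a)) / f a)"
    have qB0: "cq (B a) \<noteq> 0" and qC0: "cq (C a) \<noteq> 0" if "a \<in> {lo..hi}" for a
      using cq_B[OF that] cq_C[OF that] Q0(1) by auto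
    have f0: "f a \<noteq> 0" if "a \<in> {lo..hi}" for a
      using qB0[OF that] dB(4)[of a] by (simp add: f_def)
    have u1: "cmod (u a) < 1" for a
    proof -
      have "cmod (cq (P a) / cp (P a)) < 1" "cmod (f a) < 1"
        using dP(3)[of a] dB(3)[of a] dP(4)[of a] dB(4)[of a] by (auto simp: f_def norm_divide divide_less_eq)
      then show ?thesis unfolding u_def norm_mult
        by (metis mult_strict_mono' norm_ge_zero mult_1)
    qed
    \<comment> \<open>This needs \<open>B\<close> to be more hyperbolic than \<open>P\<close>,
      because \<open>|q| / |p|\<close> increases with \<open>|p|\<close>. The bound
      \<open>Q0\<close> on the norm of \<open>P\<close> and \<open>cq_B\<close> provide it.\<close>
    have u'1: "cmod (u' a) < 1" if "a \<in> {lo..hi}" for a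
    proof -
      have "cmod (cp (P a)) < cmod (cp (B a))"
      proof (cases "cmod (cq (P a)) = 0")
        case True
        then have "(cmod (cp (P a)))\<^sup>2 < (cmod (cp (B a)))\<^sup>2" using dP(1)[of a] dB(1)[of a] qB0[OF that] by simp
        then show ?thesis by (rule power2_less_imp_less) simp
      next
        case False
        then have "0 < cmod (cq (P a))" by simp
        then have "cmod (cp (P a)) < Q0" using Q0(3)[of a] unfolding opn_def by linarith
        also have "\<dots> \<le> cmod (cq (B a))" by (rule cq_B[OF that])
        also have "\<dots> < cmod (cp (B a))" by (rule dB)
        finally show ?thesis .
      qed
      then have sq: "(cmod (cp (P a)))\<^sup>2 < (cmod (cp (B a)))\<^sup>2" by (intro power_strict_mono) auto
      have "(cmod (cq (P a)) * cmod (cp (B a)))\<^sup>2 < (cmod (cp (P a)) * cmod (cq (B a)))\<^sup>2"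
      proof -
        have "(cmod (cq (P a)))\<^sup>2 = (cmod (cp (P a)))\<^sup>2 - 1" "(cmod (cq (B a)))\<^sup>2 = (cmod (cp (B a)))\<^sup>2 - 1"
          using dP(1)[of a] dB(1)[of a] by auto
        then show ?thesis using sq unfolding power_mult_distrib by (simp add: left_diff_distrib right_diff_distrib)
      qed
      then have "cmod (cq (P a)) * cmod (cp (B a)) < cmod (cp (P a)) * cmod (cq (B a))"
        by (rule power2_less_imp_less) auto
      then show ?thesis using dP(4)[of a] dB(4)[of a] qB0[OF that]
        by (simp add: u'_def f_def norm_divide norm_mult divide_less_eq mult.commute)
    qed
    \<comment> \<open>A continuous logarithm of \<open>\<zeta>0\<close>: under the assumption to be
      refuted, \<open>\<zeta>\<close> avoids the slit of \<open>Ln\<close>, and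
      \<open>2 * \<i> * of_real (Im (LP a))\<close> is a continuous logarithm of
      \<open>cp P / cnj (cp P)\<close>.\<close>
    define \<Lambda> where "\<Lambda> = (\<lambda>a. Ln (\<zeta> a) + 2 * \<i> * of_real (Im (LP a)) - Ln (1 + u' a) + Ln (1 + u a))"
    have "continuous_on {lo..hi} \<Lambda>"
    proof -
      have cf: "continuous_on {lo..hi} f"
        unfolding f_def by (intro continuous_intros cont) (use dB(4) in auto)
      have "continuous_on {lo..hi} \<zeta>"
        unfolding \<zeta>_def cp_mult[of "P _"] cq_mult[of "P _"]
        by (intro continuous_intros cont) (use dC(4) dPB(4) in \<open>auto simp: cp_mult[of "P _"]\<close>)
      moreover have "continuous_on {lo..hi} u" "continuous_on {lo..hi} u'"
        unfolding u_def u'_def by (intro continuous_intros cont cf; use dP(4) f0 in auto)+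
      ultimately show ?thesis
        unfolding \<Lambda>_def
        by (intro continuous_intros continuous_on_Ln LP(1)) (use \<zeta> Ln_one_plus[OF u'1] Ln_one_plus[OF u1] in auto)
    qed
    have exp\<Lambda>: "exp (\<Lambda> a) = \<zeta>0 a" if a: "a \<in> {lo..hi}" for a
    proof -
      have \<zeta>0: "\<zeta> a \<noteq> 0" using \<zeta>[OF a] by auto
      have p: "cp (P a) \<noteq> 0" by (rule dP)
      have "exp (2 * \<i> * of_real (Im (LP a))) = cp (P a) / cnj (cp (P a))"
      proof -
        have "LP a - cnj (LP a) = 2 * \<i> * of_real (Im (LP a))" by (simp add: complex_eq_iff)
        then show ?thesis using LP(2)[OF a] by (metis exp_diff exp_cnj)
      qed
      then have "exp (\<Lambda> a) = \<zeta> a * (cp (P a) / cnj (cp (P a))) / (1 + u' a) * (1 + u a)"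
        using \<zeta>0 Ln_one_plus[OF u'1[OF a]] Ln_one_plus[OF u1[of a]]
        by (simp add: \<Lambda>_def exp_add exp_diff)
      also have "\<zeta> a = cq (C a) / cp (C a) * (cnj (cp (P a)) / cp (P a) * f a * (1 + u' a) / (1 + u a))"
      proof -
        have 1: "cnj (cq (P a ** B a)) = cnj (cp (P a)) * cp (B a) * f a * (1 + u' a)"
          using p dB(4)[of a] f0[OF a] qB0[OF a] by (simp add: cq_mult u'_def f_def field_simps)
        have 2: "cp (P a ** B a) = cp (P a) * cp (B a) * (1 + u a)"
          using p dB(4)[of a] by (simp add: cp_mult u_def f_def field_simps)
        show ?thesis unfolding \<zeta>_def 1 2 using p dB(4)[of a] by simp
      qed
      finally show ?thesis
        using Ln_one_plus[OF u'1[OF a]] Ln_one_plus[OF u1[of a]] p by (simp add: \<zeta>0_def)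
    qed
    \<comment> \<open>The argument of \<open>\<zeta>0\<close> is
      \<open>arg qC - arg pC - arg qB - arg pB\<close>. By monotone rotation its derivative is at
      most \<open>1 / Q0^2\<close> times the sum of the angular speeds of \<open>pB\<close> and
      \<open>pC\<close>; subtracting that fraction of their arguments makes \<open>\<Phi>\<close>
      nonincreasing.\<close>
    define \<Phi> where "\<Phi> = (\<lambda>a. Im (\<Lambda> a) - (Im (LB a) + Im (LC a)) / Q0\<^sup>2)"
    have "\<Phi> hi \<le> \<Phi> lo"
    proof (rule DERIV_nonpos_imp_decreasing_open[of lo hi \<Phi>])
      show "continuous_on {lo..hi} \<Phi>"
        unfolding \<Phi>_def using Q0(1)
      proof (intro continuous_on_diff continuous_on_divide continuous_on_add)
        show "continuous_on {lo..hi} (\<lambda>a. Im (\<Lambda> a))"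
          using \<open>continuous_on {lo..hi} \<Lambda>\<close> by (rule continuous_on_Im)
        show "continuous_on {lo..hi} (\<lambda>a. Im (LB a))" "continuous_on {lo..hi} (\<lambda>a. Im (LC a))"
          by (intro continuous_on_Im continuous_on_subset[OF LB(1)] continuous_on_subset[OF LC(1)]; simp)+
      qed auto
      fix a assume "lo < a" "a < hi"
      then have a: "a \<in> {lo<..<hi}" "a \<in> {lo..hi}" by auto
      define pB qB pC qC where "pB = cp (B a)" and "qB = cq (B a)" and "pC = cp (C a)" and "qC = cq (C a)"
      note nz = qB0[OF a(2), folded qB_def] qC0[OF a(2), folded qC_def] dB(4)[of a, folded pB_def] dC(4)[of a, folded pC_def]
      have D\<zeta>0: "(\<zeta>0 has_vector_derivative
         \<zeta>0 a * (qC' a / qC - pC' a / pC + (cnj (qB' a) / cnj qB - pB' a / pB))) (at a)"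
      proof -
        have "((\<lambda>a. cnj (cq (B a))) has_vector_derivative cnj (qB' a)) (at a)"
          using bounded_linear.has_vector_derivative[OF bounded_linear_cnj B'(2)] .
        then have "(\<zeta>0 has_vector_derivative
         (cq (C a) / cp (C a) * ((cnj (qB' a) * cp (B a) - cnj (cq (B a)) * pB' a) / (cp (B a) * cp (B a))) +
          (qC' a * cp (C a) - cq (C a) * pC' a) / (cp (C a) * cp (C a)) * (cnj (cq (B a)) / cp (B a)))) (at a)"
          unfolding \<zeta>0_def f_def
          by (intro has_vector_derivative_mult has_vector_derivative_quotient B' C' dB(4) dC(4))
        also have "(cq (C a) / cp (C a) * ((cnj (qB' a) * cp (B a) - cnj (cq (B a)) * pB' a) / (cp (B a) * cp (B a))) +
          (qC' a * cp (C a) - cq (C a) * pC' a) / (cp (C a) * cp (C a)) * (cnj (cq (B a)) / cp (B a))) =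
          \<zeta>0 a * (qC' a / qC - pC' a / pC + (cnj (qB' a) / cnj qB - pB' a / pB))"
          using nz unfolding \<zeta>0_def f_def pB_def[symmetric] qB_def[symmetric] pC_def[symmetric] qC_def[symmetric]
          by (simp add: field_simps)
        finally show ?thesis .
      qed
      have z0: "\<zeta>0 a \<noteq> 0" using exp\<Lambda>[OF a(2)] by (metis exp_not_eq_zero)
      have D\<Lambda>: "((\<lambda>a. Im (\<Lambda> a)) has_real_derivative
         Im (qC' a / qC - pC' a / pC + (cnj (qB' a) / cnj qB - pB' a / pB))) (at a)"
      proof -
        have "continuous_on {lo<..<hi} \<Lambda>"
          by (rule continuous_on_subset[OF \<open>continuous_on {lo..hi} \<Lambda>\<close>]) auto
        from has_real_derivative_Im_log[OF open_greaterThanLessThan a(1) this _ D\<zeta>0] exp\<Lambda> show ?thesis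
          using z0 by simp
      qed
      have DB: "((\<lambda>a. Im (LB a)) has_real_derivative Im (pB' a / pB)) (at a)"
        using has_real_derivative_Im_log[OF open_UNIV UNIV_I LB(1) LB(2) B'(1)] by (simp add: pB_def)
      have DC: "((\<lambda>a. Im (LC a)) has_real_derivative Im (pC' a / pC)) (at a)"
        using has_real_derivative_Im_log[OF open_UNIV UNIV_I LC(1) LC(2) C'(1)] by (simp add: pC_def)
      have Imdiv: "Im (z / w) = Im (cnj w * z) / (cmod w)\<^sup>2" for z w :: complex
        by (simp add: complex_div_cnj[of z w] mult.commute)
      \<comment> \<open>Monotone rotation bounds the speed of \<open>q\<close> by
        \<open>|p| / |q|\<close> times that of \<open>p\<close>, and
        \<open>|p| / |q| \<le> |p|^2 / |q|^2 = 1 + 1 / |q|^2\<close>.\<close>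
      have key: "\<bar>Im (q' / q)\<bar> - Im (p' / p) \<le> Im (p' / p) / Q0\<^sup>2"
        if le: "\<bar>Im (cnj q * q')\<bar> * cmod p \<le> cmod q * Im (cnj p * p')" and sq: "(cmod p)\<^sup>2 = 1 + (cmod q)\<^sup>2"
          and qQ: "Q0 \<le> cmod q" for p q p' q' :: complex
      proof -
        define x y Pn Qn where "x = Im (cnj p * p')" and "y = \<bar>Im (cnj q * q')\<bar>" and "Pn = cmod p" and "Qn = cmod q"
        have Q: "Qn \<ge> 1" using qQ Q0 by (simp add: Qn_def)
        have Psq: "Pn\<^sup>2 = 1 + Qn\<^sup>2" using sq by (simp add: Pn_def Qn_def)
        have PQ: "Pn > Qn" using Psq Q by (intro power2_less_imp_less[of Qn Pn]) (auto simp: Pn_def)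
        have le': "y * Pn \<le> Qn * x" using le by (simp add: x_def y_def Pn_def Qn_def)
        have "0 \<le> y * Pn" by (simp add: y_def Pn_def)
        then have x0: "x \<ge> 0" using le' Q by (smt (verit) mult_pos_neg)
        have "(y / Qn\<^sup>2 - x / Pn\<^sup>2) \<le> x / Pn\<^sup>2 / Qn\<^sup>2"
        proof -
          have "y / Qn\<^sup>2 \<le> x / (Pn * Qn)"
            using le' Q PQ by (simp add: field_simps power2_eq_square)
          also have "\<dots> \<le> x / Pn\<^sup>2 + x / Pn\<^sup>2 / Qn\<^sup>2"
          proof -
            have "Pn * Qn \<le> Pn * Pn" using PQ Q by simp
            then have "x * (Pn * Qn) \<le> x * (Qn\<^sup>2 + 1)" using Psq x0 by (intro mult_left_mono) (auto simp: power2_eq_square)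
            then have "x * (Pn * Qn) / (Pn\<^sup>2 * Qn\<^sup>2) \<le> x * (Qn\<^sup>2 + 1) / (Pn\<^sup>2 * Qn\<^sup>2)"
              by (rule divide_right_mono) simp
            then show ?thesis using Q PQ by (simp add: field_simps power2_eq_square)
          qed
          finally show ?thesis by simp
        qed
        also have "\<dots> \<le> x / Pn\<^sup>2 / Q0\<^sup>2"
          using x0 qQ Q0 Q by (intro divide_left_mono power_mono mult_pos_pos zero_less_power) (auto simp: Qn_def)
        finally show ?thesis unfolding Imdiv by (simp add: x_def y_def Pn_def Qn_def abs_div)
      qed
      have 1: "\<bar>Im (qB' a / qB)\<bar> - Im (pB' a / pB) \<le> Im (pB' a / pB) / Q0\<^sup>2"
        unfolding pB_def qB_def
        by (rule key[OF positive_rotation_ineq[OF B'(3) dB(3)] dB(1) cq_B[OF a(2)]])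
      have 2: "\<bar>Im (qC' a / qC)\<bar> - Im (pC' a / pC) \<le> Im (pC' a / pC) / Q0\<^sup>2"
        unfolding pC_def qC_def
        by (rule key[OF positive_rotation_ineq[OF C'(3) dC(3)] dC(1) cq_C[OF a(2)]])
      have 3: "Im (cnj (qB' a) / cnj qB) = - Im (qB' a / qB)"
        by (simp flip: complex_cnj_divide)
      have "(\<Phi> has_real_derivative (Im (qC' a / qC - pC' a / pC + (cnj (qB' a) / cnj qB - pB' a / pB)) -
         (Im (pB' a / pB) + Im (pC' a / pC)) / Q0\<^sup>2)) (at a)"
        unfolding \<Phi>_def by (intro DERIV_diff D\<Lambda> DERIV_cdivide DERIV_add DB DC)
      moreover have "(Im (qC' a / qC - pC' a / pC + (cnj (qB' a) / cnj qB - pB' a / pB)) -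
         (Im (pB' a / pB) + Im (pC' a / pC)) / Q0\<^sup>2) \<le> 0"
        using 1 2 3 by (simp add: add_divide_distrib)
      ultimately show "\<exists>y. (\<Phi> has_real_derivative y) (at a) \<and> y \<le> 0" by blast
    qed (use lohi in auto)
    \<comment> \<open>Each of the \<open>mB + mC\<close> steps moves the argument by at most
      \<open>2 * pi\<close>, so the hypothesis on \<open>Q0\<close> limits the total correction in
      \<open>\<Phi>\<close> to 1.\<close>
    moreover have "Im (LB hi) + Im (LC hi) - (Im (LB lo) + Im (LC lo)) \<le> Q0\<^sup>2"
    proof -
      have "Im (LB hi) - Im (LB lo) \<le> mB * (2 * pi)"
        using LB(3)[of hi lo] lohi mult_left_mono[of "\<bar>hi - lo\<bar> + pi" "2 * pi" "real mB"] by auto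
      moreover have "Im (LC hi) - Im (LC lo) \<le> mC * (2 * pi)"
        using LC(3)[of hi lo] lohi mult_left_mono[of "\<bar>hi - lo\<bar> + pi" "2 * pi" "real mC"] by auto
      ultimately show ?thesis using Q0(2) by (simp add: distrib_right)
    qed
    then have "(Im (LB hi) + Im (LC hi)) / Q0\<^sup>2 - (Im (LB lo) + Im (LC lo)) / Q0\<^sup>2 \<le> 1"
      using Q0(1) by (simp add: diff_divide_distrib[symmetric] divide_le_eq)
    ultimately have "Im (\<Lambda> hi) - Im (\<Lambda> lo) \<le> 1" by (simp add: \<Phi>_def)
    \<comment> \<open>The loss \<open>4 * pi\<close> consists of \<open>2 * pi\<close> from
      \<open>Ln \<zeta>\<close> and \<open>pi\<close> from each of the logarithms of
      \<open>1 + u\<close> and \<open>1 + u'\<close>. With \<open>K * (hi - lo) \<ge> 8 * pi\<close>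
      an increase of at least \<open>10 * pi\<close> remains, against the bound 1.\<close>
    moreover have "Im (\<Lambda> hi) - Im (\<Lambda> lo) \<ge> 2 * (K * (hi - lo) - pi) - 4 * pi"
    proof -
      have "\<bar>Im (Ln (\<zeta> a))\<bar> \<le> pi" if "a \<in> {lo..hi}" for a
        using \<zeta>[OF that] mpi_less_Im_Ln[of "\<zeta> a"] Im_Ln_le_pi[of "\<zeta> a"] by (cases "\<zeta> a = 0") auto
      from this[of lo] this[of hi] have "Im (Ln (\<zeta> hi)) - Im (Ln (\<zeta> lo)) \<ge> - 2 * pi" using lohi by auto
      moreover have "Im (Ln (1 + u' hi)) - Im (Ln (1 + u' lo)) \<le> pi"
        using Ln_one_plus(3)[OF u'1[of hi]] Ln_one_plus(3)[OF u'1[of lo]] lohi by auto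
      moreover have "Im (Ln (1 + u hi)) - Im (Ln (1 + u lo)) \<ge> - pi"
        using Ln_one_plus(3)[OF u1[of hi]] Ln_one_plus(3)[OF u1[of lo]] by linarith
      ultimately show ?thesis using LP(3) by (simp add: \<Lambda>_def)
    qed
    ultimately show False using K pi_gt3 by argo
  qed
qed

section \<open>Mean and fluctuations of the growth\<close>

lemma has_integral_ln_cmod_one_plus:
  assumes b: "cmod b < 1"
  shows "((\<lambda>t. ln (cmod (1 + b * cis (- 2 * t)))) has_integral 0) {0..2 * pi}"
proof -
  \<comment> \<open>Conjugation turns \<open>cis (- 2 * t)\<close> into \<open>(cis t)^2\<close>,
    the boundary value of a holomorphic function, and leaves the modulus unchanged.\<close>
  define f where "f = (\<lambda>z. Ln (1 + cnj b * z\<^sup>2))"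
  have lt: "1 + cnj b * z\<^sup>2 \<notin> \<real>\<^sub>\<le>\<^sub>0" "1 + cnj b * z\<^sup>2 \<noteq> 0" if "cmod z \<le> 1" for z
  proof -
    have "cmod (cnj b * z\<^sup>2) \<le> cmod b * 1"
      unfolding norm_mult norm_power complex_mod_cnj
      using that by (intro mult_left_mono) (auto simp: power_le_one)
    then have "Re (1 + cnj b * z\<^sup>2) > 0"
      using b abs_Re_le_cmod[of "cnj b * z\<^sup>2"] unfolding plus_complex.simps one_complex.simps by linarith
    then show "1 + cnj b * z\<^sup>2 \<notin> \<real>\<^sub>\<le>\<^sub>0" "1 + cnj b * z\<^sup>2 \<noteq> 0"
      by (auto simp: complex_nonpos_Reals_iff complex_eq_iff)
  qed
  have "f holomorphic_on cball 0 1"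
    unfolding f_def by (intro holomorphic_intros) (use lt in auto)
  then have "((\<lambda>u. f u / (u - 0)) has_contour_integral (2 * of_real pi * \<i> * f 0)) (circlepath 0 1)"
    by (rule Cauchy_integral_circlepath_simple) simp
  then have "((\<lambda>t. f (cis t) / cis t * \<i> * cis t) has_integral 0) {0..2 * pi}"
    unfolding circlepath_def by (subst (asm) has_contour_integral_part_circlepath_iff) (simp_all add: f_def)
  from has_integral_linear[OF this bounded_linear_Im]
  have "((\<lambda>t. Re (f (cis t))) has_integral 0) {0..2 * pi}"
    by (simp add: o_def)
  moreover have "Re (f (cis t)) = ln (cmod (1 + b * cis (- 2 * t)))" for t
  proof -
    have "Re (f (cis t)) = ln (cmod (1 + cnj b * (cis t)\<^sup>2))"
      unfolding f_def using lt(2)[of "cis t"] by (simp add: Re_Ln)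
    also have "1 + cnj b * (cis t)\<^sup>2 = cnj (1 + b * cis (- 2 * t))"
      by (simp add: cis_cnj Complex.DeMoivre)
    finally show ?thesis by (simp only: complex_mod_cnj)
  qed
  ultimately show ?thesis by simp
qed

lemma uniform_measure_J:
  "uniform_measure lborel {0..2 * pi} = density lborel (\<lambda>t. ennreal (indicator {0..2 * pi} t / (2 * pi)))"
  unfolding uniform_measure_def
proof (rule density_cong)
  show "AE t in lborel. indicator {0..2 * pi} t / emeasure lborel {0..2 * pi} =
      ennreal (indicator {0..2 * pi} t / (2 * pi))"
    by (auto simp: indicator_def divide_ennreal[symmetric] simp flip: ennreal_numeral ennreal_1)
qed auto

lemma integral_ln_cmod_one_plus:
  assumes b: "cmod b < 1"
  shows "integrable (uniform_measure lborel {0..2 * pi}) (\<lambda>t. ln (cmod (1 + b * cis (- 2 * t))))"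
    "(\<integral>t. ln (cmod (1 + b * cis (- 2 * t))) \<partial>uniform_measure lborel {0..2 * pi}) = 0"
proof -
  let ?g = "\<lambda>t. ln (cmod (1 + b * cis (- 2 * t)))"
  have nz: "1 + b * cis (- 2 * t) \<noteq> 0" for t
  proof
    assume "1 + b * cis (- 2 * t) = 0"
    then have "cmod (b * cis (- 2 * t)) = 1" by (metis add_eq_0_iff norm_minus_cancel norm_one)
    then show False using b by (simp add: norm_mult)
  qed
  have "continuous_on {0..2 * pi} ?g"
    by (intro continuous_intros) (use nz in auto)
  then have int: "set_integrable lborel {0..2 * pi} ?g"
    by (rule borel_integrable_atLeastAtMost')
  have "(LINT t:{0..2 * pi}|lborel. ?g t) = 0"
    using has_integral_set_lebesgue[of "{0..2*pi}"] set_borel_integral_eq_integral(2)[OF int]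
      integral_unique[OF has_integral_ln_cmod_one_plus[OF b]] by simp
  with int show "integrable (uniform_measure lborel {0..2 * pi}) ?g"
    "(\<integral>t. ?g t \<partial>uniform_measure lborel {0..2 * pi}) = 0"
    unfolding uniform_measure_J
  proof -
    have g: "?g \<in> borel_measurable lborel"
      using nz by (auto intro!: borel_measurable_continuous_onI continuous_intros)
    have e: "(\<lambda>t. (indicator {0..2 * pi} t / (2 * pi)) *\<^sub>R ?g t) =
        (\<lambda>t. (1 / (2 * pi)) *\<^sub>R (indicator {0..2 * pi} t *\<^sub>R ?g t))"
      by auto
    have m: "(\<lambda>t. indicator {0..2 * pi} t / (2 * pi)) \<in> borel_measurable lborel"
      by auto
    show "integrable (density lborel (\<lambda>t. ennreal (indicator {0..2 * pi} t / (2 * pi)))) ?g"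
    proof (subst integrable_density[OF g m])
      show "integrable lborel (\<lambda>t. (indicator {0..2 * pi} t / (2 * pi)) *\<^sub>R ?g t)"
        unfolding e by (rule integrable_scaleR_right) (use int in \<open>simp only: set_integrable_def\<close>)
    qed auto
    show "(\<integral>t. ?g t \<partial>density lborel (\<lambda>t. ennreal (indicator {0..2 * pi} t / (2 * pi)))) = 0"
      using \<open>(LINT t:{0..2 * pi}|lborel. ?g t) = 0\<close> unfolding set_lebesgue_integral_def
      by (subst integral_density[OF g m]) (simp_all only: e integral_scaleR_right, simp_all)
  qed
qed

section \<open>Measurability on the space of maps\<close>

lemma space_C1_borel: "space C1_borel = C1_SL2"
  and sets_C1_borel: "sets C1_borel = sigma_sets C1_SL2 {U. openin C1.mtopology U}"
proof -
  have "{U. openin C1.mtopology U} \<subseteq> Pow C1_SL2"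
    by (rule subsetI, rule PowI) (metis C1.topspace_mtopology mem_Collect_eq openin_subset)
  then show "space C1_borel = C1_SL2" "sets C1_borel = sigma_sets C1_SL2 {U. openin C1.mtopology U}"
    by (simp_all add: C1_borel_def space_measure_of sets_measure_of)
qed

lemma dist_le_C1_dist:
  assumes "f \<in> C1_SL2" "g \<in> C1_SL2" "a \<in> J"
  shows "dist (f a) (g a) \<le> C1_dist f g"
proof -
  let ?D = "\<lambda>f a. vector_derivative f (at a within J)"
  have c: "continuous_on J (\<lambda>a. f a - g a)" "continuous_on J (\<lambda>a. ?D f a - ?D g a)"
    using assms C1_SL2_D by (auto intro!: continuous_on_diff)
  show ?thesis
    using SUP_norm_J(2)[OF c(1) c(1) assms(3)] SUP_norm_J(1)[OF c(2) c(2)] assms(1,2)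
    by (simp add: C1_dist_def dist_norm)
qed

text \<open>Evaluation is 1-Lipschitz for \<open>C1_dist\<close>, so preimages of open sets are
  open.\<close>

lemma measurable_eval:
  assumes a: "a \<in> J"
  shows "(\<lambda>f. f a) \<in> borel_measurable C1_borel"
proof (rule borel_measurableI)
  fix S :: "(real^2^2) set" assume S: "open S"
  have "openin C1.mtopology ((\<lambda>f. f a) -` S \<inter> C1_SL2)"
    unfolding C1.openin_mtopology
  proof (intro conjI ballI allI impI)
    fix f assume f: "f \<in> (\<lambda>f. f a) -` S \<inter> C1_SL2"
    then obtain e where e: "e > 0" "\<And>y. dist y (f a) < e \<Longrightarrow> y \<in> S"
      using S unfolding open_dist by blast
    have "C1.mball f e \<subseteq> (\<lambda>f. f a) -` S \<inter> C1_SL2"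
    proof
      fix g assume "g \<in> C1.mball f e"
      then have g: "g \<in> C1_SL2" "C1_dist f g < e" by (auto simp: C1.in_mball)
      have "dist (g a) (f a) < e" using dist_le_C1_dist[of f g a] f g a by (simp add: dist_commute)
      then show "g \<in> (\<lambda>f. f a) -` S \<inter> C1_SL2" using e(2) g(1) by simp
    qed
    then show "\<exists>r>0. C1.mball f r \<subseteq> (\<lambda>f. f a) -` S \<inter> C1_SL2" using e(1) by blast
  qed auto
  then show "(\<lambda>f. f a) -` S \<inter> space C1_borel \<in> sets C1_borel"
    unfolding space_C1_borel sets_C1_borel by (intro sigma_sets.Basic) simp
qed

lemma borel_measurable_matrix_mult:
  fixes f g :: "'a \<Rightarrow> real^2^2"
  assumes "f \<in> borel_measurable M" "g \<in> borel_measurable M"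
  shows "(\<lambda>x. f x ** g x) \<in> borel_measurable M"
proof (rule borel_measurable_continuous_Pair[OF assms])
  interpret m: bounded_bilinear "(**) :: real^2^2 \<Rightarrow> real^2^2 \<Rightarrow> real^2^2"
    by (rule bounded_bilinear_matrix_mult)
  show "continuous_on UNIV (\<lambda>x :: (real^2^2) \<times> (real^2^2). fst x ** snd x)"
    by (intro m.continuous_on continuous_intros)
qed

lemma continuous_cp: "continuous_on S cp" and continuous_cq: "continuous_on S cq"
  unfolding cp_def cq_def Complex_eq by (intro continuous_intros; simp)+

lemma borel_measurable_cp [measurable]: "cp \<in> borel_measurable borel"
  and borel_measurable_cq [measurable]: "cq \<in> borel_measurable borel"
  by (intro borel_measurable_continuous_onI continuous_cp continuous_cq)+

section \<open>The effect of one random step\<close>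

definition rate :: "nat \<Rightarrow> real" where
  "rate j = (if \<exists>i. nseq i < j \<and> j \<le> 2 * nseq i then 100 else 2)"

lemma rate_ge: "rate j \<ge> 1" by (simp add: rate_def)

lemma step_law_eq: "step_law j = law (dg (rate j))"
  by (auto simp: step_law_def rate_def H1_eq H2_eq)

abbreviation unif :: "real measure" where
  "unif \<equiv> uniform_measure lborel {0..2 * pi}"

lemma prob_space_unif: "prob_space unif"
  by (rule prob_space_uniform_measure) auto

lemma det_dg_rate: "det (dg (rate j)) = 1"
  using rate_ge[of j] by (intro det_dg) auto

lemma rand_map_measurable_unif: "det H = 1 \<Longrightarrow> rand_map H \<in> unif \<rightarrow>\<^sub>M C1_borel"
  using measurable_rand_map[of H] by (simp cong: measurable_cong_sets)

lemma continuous_stp: "continuous_on S (\<lambda>t. stp \<sigma> t a)"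
proof -
  interpret m: bounded_bilinear "(**) :: real^2^2 \<Rightarrow> real^2^2 \<Rightarrow> real^2^2"
    by (rule bounded_bilinear_matrix_mult)
  show ?thesis unfolding stp_def
    by (intro m.continuous_on continuous_on_const continuous_on_Rot)
qed

text \<open>The random angle enters only through \<open>cis (- 2 * t)\<close>; the parameter
  \<open>a\<close> contributes a unimodular factor and disappears. The bound on \<open>b\<close>
  keeps the random term away from the singularity of \<open>ln\<close>, uniformly in
  \<open>S\<close>.\<close>

lemma ln_cmod_cp_stp:
  assumes S: "det S = 1" and \<sigma>: "\<sigma> \<ge> 1"
  defines "b \<equiv> of_real (dgq \<sigma> / dgp \<sigma>) * cnj (cq S) / cp S"
  shows "cmod b \<le> dgq \<sigma> / dgp \<sigma>" "cmod b < 1"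
    "ln (cmod (cp (stp \<sigma> t a ** S))) = ln (dgp \<sigma>) + ln (cmod (cp S)) + ln (cmod (1 + b * cis (- 2 * t)))"
proof -
  note d = det_one_cmod[OF S] and g = dgp_dgq[OF \<sigma>]
  have "cmod b = dgq \<sigma> / dgp \<sigma> * (cmod (cq S) / cmod (cp S))"
    using g by (simp add: b_def norm_mult norm_divide)
  also have "\<dots> \<le> dgq \<sigma> / dgp \<sigma> * 1"
    using g d by (intro mult_left_mono) (auto simp: divide_le_eq)
  finally show 1: "cmod b \<le> dgq \<sigma> / dgp \<sigma>" by simp
  also have "\<dots> < 1" using g by (simp add: divide_less_eq)
  finally show 2: "cmod b < 1" .
  have "cp (stp \<sigma> t a ** S) = of_real (dgp \<sigma>) * cis (a + t) * cp S + of_real (dgq \<sigma>) * cis (a - t) * cnj (cq S)"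
    by (simp add: cp_mult cp_stp cq_stp)
  also have "cis (a - t) = cis (a + t) * cis (- 2 * t)" by (simp add: cis_mult)
  also have "of_real (dgp \<sigma>) * cis (a + t) * cp S + of_real (dgq \<sigma>) * (cis (a + t) * cis (- 2 * t)) * cnj (cq S) =
    of_real (dgp \<sigma>) * cis (a + t) * cp S * (1 + b * cis (- 2 * t))"
    using g d by (simp add: b_def field_simps)
  finally have *: "cmod (cp (stp \<sigma> t a ** S)) = dgp \<sigma> * cmod (cp S) * cmod (1 + b * cis (- 2 * t))"
    using g by (simp add: norm_mult)
  have "cmod (1 + b * cis (- 2 * t)) > 0"
  proof -
    have "cmod (b * cis (- 2 * t)) < 1" using 2 by (simp add: norm_mult)
    from Ln_one_plus(1)[OF this] show ?thesis by simp
  qed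
  then show "ln (cmod (cp (stp \<sigma> t a ** S))) = ln (dgp \<sigma>) + ln (cmod (cp S)) + ln (cmod (1 + b * cis (- 2 * t)))"
    unfolding * using g d by (subst ln_mult_pos; simp add: ln_mult_pos)+
qed

lemma nn_integral_ln_cmod_cp_stp:
  assumes S: "det S = 1" and \<sigma>: "\<sigma> \<ge> 1"
  shows "(\<integral>\<^sup>+t. ennreal (ln (cmod (cp (stp \<sigma> t a ** S)))) \<partial>unif) = ennreal (ln (dgp \<sigma>) + ln (cmod (cp S)))"
proof -
  interpret U: prob_space unif by (rule prob_space_unif)
  define b where "b = of_real (dgq \<sigma> / dgp \<sigma>) * cnj (cq S) / cp S"
  note * = ln_cmod_cp_stp[OF S \<sigma>, folded b_def]
  note I = integral_ln_cmod_one_plus[OF *(2)]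
  have det: "det (stp \<sigma> t a ** S) = 1" for t using \<sigma> by (simp add: det_mul det_stp S)
  have "0 \<le> ln (cmod (cp (stp \<sigma> t a ** S)))" for t using det_one_cmod(2)[OF det] by simp
  then have "(\<integral>\<^sup>+t. ennreal (ln (cmod (cp (stp \<sigma> t a ** S)))) \<partial>unif) =
      ennreal (\<integral>t. ln (cmod (cp (stp \<sigma> t a ** S))) \<partial>unif)"
    unfolding *(3) by (intro nn_integral_eq_integral) (use I in auto)
  also have "(\<integral>t. ln (cmod (cp (stp \<sigma> t a ** S))) \<partial>unif) = ln (dgp \<sigma>) + ln (cmod (cp S))"
    unfolding *(3) using I by (simp add: U.prob_space)
  finally show ?thesis .
qed

text \<open>The random term \<open>Y\<close> has mean zero, so the cross term vanishes. For
  \<open>\<sigma> \<le> 100\<close> one has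
  \<open>|b| \<le> (100^2 - 1) / (100^2 + 1) = 9999 / 10001\<close>, whence
  \<open>|Y| \<le> ln 10001\<close>.\<close>

lemma nn_integral_square_stp:
  assumes S: "det S = 1" and \<sigma>: "1 \<le> \<sigma>" "\<sigma> \<le> 100"
  shows "(\<integral>\<^sup>+t. ennreal ((ln (cmod (cp (stp \<sigma> t a ** S))) - (x + ln (dgp \<sigma>)))\<^sup>2) \<partial>unif)
    \<le> ennreal ((ln (cmod (cp S)) - x)\<^sup>2 + (ln 10001)\<^sup>2)"
proof -
  interpret U: prob_space unif by (rule prob_space_unif)
  define b where "b = of_real (dgq \<sigma> / dgp \<sigma>) * cnj (cq S) / cp S"
  note * = ln_cmod_cp_stp[OF S \<sigma>(1), folded b_def]
  note I = integral_ln_cmod_one_plus[OF *(2)]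
  define Y where "Y = (\<lambda>t. ln (cmod (1 + b * cis (- 2 * t))))"
  define z where "z = ln (cmod (cp S)) - x"
  have "dgq \<sigma> / dgp \<sigma> \<le> 9999 / 10001"
  proof -
    have "1 / \<sigma> \<ge> \<sigma> / 10000"
      using \<sigma> mult_mono[of \<sigma> 100 \<sigma> 100] by (simp add: field_simps)
    then show ?thesis using \<sigma> dgp_dgq(2)[OF \<sigma>(1)] by (simp add: divide_le_eq) (simp add: dgp_def dgq_def)
  qed
  then have b: "cmod b \<le> 9999 / 10001" using *(1) by (rule order.trans[rotated])
  have Y: "\<bar>Y t\<bar> \<le> ln 10001" for t
  proof -
    let ?r = "cmod (1 + b * cis (- 2 * t))"
    have bb: "cmod (b * cis (- 2 * t)) \<le> 9999 / 10001" using b by (simp add: norm_mult)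
    have "?r \<ge> 1 - 9999 / 10001" using norm_diff_ineq[of 1 "b * cis (- 2 * t)"] bb by simp
    then have r1: "?r \<ge> 1 / 10001" by simp
    have "?r \<le> 1 + 9999 / 10001" using norm_triangle_ineq[of 1 "b * cis (- 2 * t)"] bb by simp
    then have r2: "?r \<le> 10001" by simp
    have r0: "?r > 0" using r1 by linarith
    have "ln ?r \<le> ln 10001" using r0 r2 by (subst ln_le_cancel_iff) auto
    moreover have "ln (1 / 10001) \<le> ln ?r" using r0 r1 by (subst ln_le_cancel_iff) auto
    ultimately show ?thesis by (simp add: Y_def ln_div abs_le_iff)
  qed
  have Ym[measurable]: "Y \<in> borel_measurable unif" using I(1) by (auto simp: Y_def)
  have Yi: "integrable unif Y" "(\<integral>t. Y t \<partial>unif) = 0" using I by (auto simp: Y_def)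
  have Y2: "(Y t)\<^sup>2 \<le> (ln 10001)\<^sup>2" for t using Y[of t] by (simp add: abs_le_square_iff[symmetric])
  have Y2i: "integrable unif (\<lambda>t. (Y t)\<^sup>2)"
    using Y2 by (intro U.integrable_const_bound[of _ "(ln 10001)\<^sup>2"]) auto
  have eq: "(ln (cmod (cp (stp \<sigma> t a ** S))) - (x + ln (dgp \<sigma>)))\<^sup>2 = z\<^sup>2 + 2 * z * Y t + (Y t)\<^sup>2" for t
    unfolding *(3) z_def Y_def by (simp add: power2_eq_square algebra_simps)
  have "(\<integral>\<^sup>+t. ennreal (z\<^sup>2 + 2 * z * Y t + (Y t)\<^sup>2) \<partial>unif) = ennreal (\<integral>t. z\<^sup>2 + 2 * z * Y t + (Y t)\<^sup>2 \<partial>unif)"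
  proof (rule nn_integral_eq_integral)
    show "integrable unif (\<lambda>t. z\<^sup>2 + 2 * z * Y t + (Y t)\<^sup>2)" using Yi(1) Y2i by auto
    show "AE t in unif. 0 \<le> z\<^sup>2 + 2 * z * Y t + (Y t)\<^sup>2"
      by (intro AE_I2) (metis eq zero_le_power2)
  qed
  also have "(\<integral>t. z\<^sup>2 + 2 * z * Y t + (Y t)\<^sup>2 \<partial>unif) = z\<^sup>2 + (\<integral>t. (Y t)\<^sup>2 \<partial>unif)"
    using Yi Y2i by (simp add: U.prob_space)
  also have "(\<integral>t. (Y t)\<^sup>2 \<partial>unif) \<le> (ln 10001)\<^sup>2"
    using Y2 Y2i by (intro U.integral_le_const) auto
  finally show ?thesis unfolding eq z_def by (simp add: ennreal_leI)
qed

text \<open>Otherwise the simplifier evaluates powers such as \<open>10 ^ (10 ^ 1000)\<close>.\<close>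
declare nseq.simps(2) [simp del]

section \<open>Growth of the sequence of scales\<close>

lemma nseq_Suc_gt: "10 * nseq i < nseq (Suc i)"
proof -
  have lt: "n < 10 ^ n" for n :: nat by (induction n) auto
  have "10 * nseq i < 10 * 10 ^ nseq i" using lt[of "nseq i"] by simp
  also have "\<dots> = 10 ^ (Suc (nseq i))" by simp
  also have "\<dots> \<le> 10 ^ (10 ^ nseq i)" using lt[of "nseq i"] by (intro power_increasing) auto
  finally show ?thesis unfolding nseq.simps(2) .
qed

lemma nseq_ge: "1000 \<le> nseq i"
proof (induction i)
  case (Suc i)
  then show ?case using nseq_Suc_gt[of i] by linarith
qed simp

lemma strict_mono_nseq: "strict_mono nseq"
  unfolding strict_mono_Suc_iff
proof
  fix i show "nseq i < nseq (Suc i)" using nseq_Suc_gt[of i] by linarith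
qed

lemma nseq_ge_power: "2 ^ i \<le> nseq i"
proof (induction i)
  case (Suc i)
  then show ?case using nseq_Suc_gt[of i] by simp
qed simp

lemma nn_integral_distr_measurable:
  "T \<in> M \<rightarrow>\<^sub>M M' \<Longrightarrow> f \<in> borel_measurable M' \<Longrightarrow>
    integral\<^sup>N (distr M M' T) f = (\<integral>\<^sup>+x. f (T x) \<partial>M)"
  by (rule nn_integral_distr) simp_all

section \<open>Moments of the growth of the random product\<close>

locale random_cocycle = prob_space M for M :: "'w measure" +
  fixes A :: "nat \<Rightarrow> 'w \<Rightarrow> real \<Rightarrow> real^2^2"
  assumes indep: "indep_vars (\<lambda>_. C1_borel) A {1..}"
    and law_A: "\<And>j. j \<ge> 1 \<Longrightarrow> distr M C1_borel (A j) = law (dg (rate j))"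
begin

lemma measurable_A: "j \<ge> 1 \<Longrightarrow> A j \<in> M \<rightarrow>\<^sub>M C1_borel"
  using indep by (auto simp: indep_vars_def)

lemma A_in_C1_SL2: "j \<ge> 1 \<Longrightarrow> \<omega> \<in> space M \<Longrightarrow> A j \<omega> \<in> C1_SL2"
  using measurable_space[OF measurable_A] by (simp add: space_C1_borel)

lemma measurable_A_eval: "j \<ge> 1 \<Longrightarrow> a \<in> J \<Longrightarrow> (\<lambda>\<omega>. A j \<omega> a) \<in> borel_measurable M"
  using measurable_compose[OF measurable_A measurable_eval] .

lemma det_rprod: "\<omega> \<in> space M \<Longrightarrow> a \<in> J \<Longrightarrow> det (rprod A n a \<omega>) = 1"
proof (induction n)
  case (Suc n)
  have "det (A (Suc n) \<omega> a) = 1" using A_in_C1_SL2[of "Suc n" \<omega>] Suc.prems by (auto simp: C1_SL2_def)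
  then show ?case using Suc by (simp add: det_mul)
qed simp

lemma measurable_rprod [measurable (raw)]: "a \<in> J \<Longrightarrow> rprod A n a \<in> borel_measurable M"
proof (induction n)
  case 0
  have "rprod A 0 a = (\<lambda>_. mat 1)" by (simp add: fun_eq_iff)
  then show ?case by simp
next
  case (Suc n)
  have "(\<lambda>\<omega>. A (Suc n) \<omega> a ** rprod A n a \<omega>) \<in> borel_measurable M"
    using Suc by (intro borel_measurable_matrix_mult measurable_A_eval) auto
  moreover have "rprod A (Suc n) a = (\<lambda>\<omega>. A (Suc n) \<omega> a ** rprod A n a \<omega>)" by (simp add: fun_eq_iff)
  ultimately show ?case by simp
qed

lemma measurable_rprod_PiM:
  assumes "a \<in> J" "m \<le> n"
  shows "(\<lambda>x. rprod (\<lambda>i x. x i) m a x) \<in> borel_measurable (PiM {1..n} (\<lambda>_. C1_borel))"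
  using assms(2)
proof (induction m)
  case 0
  have "rprod (\<lambda>i x. x i) 0 a = (\<lambda>_. mat 1)" by (simp add: fun_eq_iff)
  then show ?case by simp
next
  case (Suc m)
  have "(\<lambda>x. x (Suc m) a) \<in> borel_measurable (PiM {1..n} (\<lambda>_. C1_borel))"
    using Suc.prems by (intro measurable_compose[OF _ measurable_eval[OF assms(1)]] measurable_component_singleton) auto
  then show ?case using Suc by (auto intro!: borel_measurable_matrix_mult)
qed

lemma rprod_restrict:
  "m \<le> n \<Longrightarrow> rprod (\<lambda>i x. x i) m a (restrict (\<lambda>i. A i \<omega>) {1..n}) = rprod A m a \<omega>"
  by (induction m) auto

text \<open>Integration over the last step with the first \<open>n\<close> steps frozen:
  independence turns the joint law into a product measure, and Tonelli applies because
  \<open>F\<close> is nonnegative.\<close>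

lemma nn_integral_rprod_Suc:
  assumes a: "a \<in> J" and F: "F \<in> borel_measurable borel"
  shows "(\<integral>\<^sup>+\<omega>. F (rprod A (Suc n) a \<omega>) \<partial>M) =
    (\<integral>\<^sup>+\<omega>. (\<integral>\<^sup>+t. F (stp (rate (Suc n)) t a ** rprod A n a \<omega>) \<partial>unif) \<partial>M)"
proof -
  define P1 P2 where "P1 = PiM {Suc n} (\<lambda>_. C1_borel)" and "P2 = PiM {1..n} (\<lambda>_. C1_borel)"
  define R1 R2 where "R1 = (\<lambda>\<omega>. restrict (\<lambda>i. A i \<omega>) {Suc n})" and "R2 = (\<lambda>\<omega>. restrict (\<lambda>i. A i \<omega>) {1..n})"
  \<comment> \<open>The product formed from the coordinate maps, so that \<open>rprod A n a\<close>
    becomes a measurable function of the tuple of the first \<open>n\<close> maps, to which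
    independence applies.\<close>
  define g :: "(nat \<Rightarrow> real \<Rightarrow> real^2^2) \<Rightarrow> real^2^2" where "g = (\<lambda>x. rprod (\<lambda>i x. x i) n a x)"
  have "indep_var P1 R1 P2 R2"
    unfolding P1_def P2_def R1_def R2_def by (rule indep_var_restrict[OF indep]) auto
  then have R: "R1 \<in> M \<rightarrow>\<^sub>M P1" "R2 \<in> M \<rightarrow>\<^sub>M P2"
    and ind: "distr M P1 R1 \<Otimes>\<^sub>M distr M P2 R2 = distr M (P1 \<Otimes>\<^sub>M P2) (\<lambda>x. (R1 x, R2 x))"
    by (auto simp: indep_var_distribution_eq)
  interpret D1: prob_space "distr M P1 R1" by (rule prob_space_distr[OF R(1)])
  interpret D2: prob_space "distr M P2 R2" by (rule prob_space_distr[OF R(2)])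
  interpret D: pair_prob_space "distr M P1 R1" "distr M P2 R2" ..
  have ev: "(\<lambda>x. x (Suc n) a) \<in> borel_measurable P1"
    unfolding P1_def by (intro measurable_compose[OF _ measurable_eval[OF a]] measurable_component_singleton) auto
  have g: "g \<in> borel_measurable P2"
    unfolding P2_def g_def by (rule measurable_rprod_PiM[OF a order_refl])
  have m1: "(\<lambda>z. F (fst z (Suc n) a ** g (snd z))) \<in> borel_measurable (P1 \<Otimes>\<^sub>M P2)"
    by (intro measurable_compose[OF _ F] borel_measurable_matrix_mult measurable_compose[OF measurable_fst ev]
        measurable_compose[OF measurable_snd g])
  then have m1': "(\<lambda>z. F (fst z (Suc n) a ** g (snd z))) \<in> borel_measurable (distr M P1 R1 \<Otimes>\<^sub>M distr M P2 R2)"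
    by (simp cong: measurable_cong_sets sets_pair_measure_cong)
  have m2: "(\<lambda>z. F (snd z (Suc n) a ** g (fst z))) \<in> borel_measurable (P2 \<Otimes>\<^sub>M distr M P1 R1)"
  proof -
    have "(\<lambda>z. F (snd z (Suc n) a ** g (fst z))) \<in> borel_measurable (P2 \<Otimes>\<^sub>M P1)"
      by (intro measurable_compose[OF _ F] borel_measurable_matrix_mult measurable_compose[OF measurable_snd ev]
        measurable_compose[OF measurable_fst g])
    then show ?thesis by (simp cong: measurable_cong_sets sets_pair_measure_cong)
  qed
  have "(\<integral>\<^sup>+\<omega>. F (rprod A (Suc n) a \<omega>) \<partial>M) =
      (\<integral>\<^sup>+z. F (fst z (Suc n) a ** g (snd z)) \<partial>(distr M P1 R1 \<Otimes>\<^sub>M distr M P2 R2))"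
    unfolding ind by (subst nn_integral_distr_measurable[OF measurable_Pair[OF R] m1])
      (simp add: R1_def R2_def g_def rprod_restrict del: One_nat_def)
  also have "\<dots> = (\<integral>\<^sup>+y. (\<integral>\<^sup>+x. F (x (Suc n) a ** g y) \<partial>distr M P1 R1) \<partial>distr M P2 R2)"
    using D.nn_integral_snd[OF m1'] by simp
  also have "\<dots> = (\<integral>\<^sup>+\<omega>. (\<integral>\<^sup>+x. F (x (Suc n) a ** g (R2 \<omega>)) \<partial>distr M P1 R1) \<partial>M)"
    using D1.borel_measurable_nn_integral_fst[OF m2] by (subst nn_integral_distr_measurable[OF R(2)]) simp_all
  also have "\<dots> = (\<integral>\<^sup>+\<omega>. (\<integral>\<^sup>+t. F (stp (rate (Suc n)) t a ** rprod A n a \<omega>) \<partial>unif) \<partial>M)"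
  proof -
    have "(\<integral>\<^sup>+x. F (x (Suc n) a ** S) \<partial>distr M P1 R1) = (\<integral>\<^sup>+t. F (stp (rate (Suc n)) t a ** S) \<partial>unif)" for S
    proof -
      have 1: "(\<lambda>x. F (x (Suc n) a ** S)) \<in> borel_measurable P1"
        by (intro measurable_compose[OF _ F] borel_measurable_matrix_mult ev measurable_const) simp
      have 2: "(\<lambda>f. F (f a ** S)) \<in> borel_measurable C1_borel"
        by (intro measurable_compose[OF _ F] borel_measurable_matrix_mult measurable_eval[OF a] measurable_const) simp
      have "(\<integral>\<^sup>+x. F (x (Suc n) a ** S) \<partial>distr M P1 R1) = (\<integral>\<^sup>+\<omega>. F (A (Suc n) \<omega> a ** S) \<partial>M)"
        by (subst nn_integral_distr_measurable[OF R(1) 1]) (simp add: R1_def)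
      also have "\<dots> = (\<integral>\<^sup>+f. F (f a ** S) \<partial>distr M C1_borel (A (Suc n)))"
        by (subst nn_integral_distr_measurable[OF measurable_A 2]) auto
      also have "\<dots> = (\<integral>\<^sup>+t. F (stp (rate (Suc n)) t a ** S) \<partial>unif)"
        using a unfolding law_A[of "Suc n", simplified] law_def
        by (subst nn_integral_distr_measurable[OF rand_map_measurable_unif[OF det_dg_rate] 2]) (simp add: rand_map_def stp_def)
      finally show ?thesis .
    qed
    then show ?thesis by (simp add: R2_def g_def rprod_restrict del: One_nat_def)
  qed
  finally show ?thesis .
qed

text \<open>The exact expectation of \<open>ln (cmod (cp (rprod A n a \<omega>)))\<close>, for every
  parameter \<open>a\<close> in \<open>J\<close>.\<close>

definition mean_growth :: "nat \<Rightarrow> real" where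
  "mean_growth n = (\<Sum>j=1..n. ln (dgp (rate j)))"

lemma mean_growth_Suc: "mean_growth (Suc n) = mean_growth n + ln (dgp (rate (Suc n)))"
  by (simp add: mean_growth_def)

lemma mean_growth_nonneg: "mean_growth n \<ge> 0"
  unfolding mean_growth_def using dgp_dgq(2)[OF rate_ge] by (intro sum_nonneg) auto

lemma nn_integral_ln_cp_rprod:
  assumes a: "a \<in> J"
  shows "(\<integral>\<^sup>+\<omega>. ennreal (ln (cmod (cp (rprod A n a \<omega>)))) \<partial>M) = ennreal (mean_growth n)"
proof (induction n)
  case 0 show ?case by (simp add: mean_growth_def)
next
  case (Suc n)
  define l where "l = ln (dgp (rate (Suc n)))"
  have l: "l \<ge> 0" using dgp_dgq(2)[OF rate_ge, of "Suc n"] by (simp add: l_def)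
  have nn: "0 \<le> ln (cmod (cp (rprod A n a \<omega>)))" if "\<omega> \<in> space M" for \<omega>
    using det_one_cmod(2)[OF det_rprod[OF that a]] by simp
  have "(\<integral>\<^sup>+\<omega>. ennreal (ln (cmod (cp (rprod A (Suc n) a \<omega>)))) \<partial>M) =
     (\<integral>\<^sup>+\<omega>. (\<integral>\<^sup>+t. ennreal (ln (cmod (cp (stp (rate (Suc n)) t a ** rprod A n a \<omega>)))) \<partial>unif) \<partial>M)"
    by (rule nn_integral_rprod_Suc[OF a]) measurable
  also have "\<dots> = (\<integral>\<^sup>+\<omega>. ennreal l + ennreal (ln (cmod (cp (rprod A n a \<omega>)))) \<partial>M)"
    using l nn by (intro nn_integral_cong)
      (simp add: nn_integral_ln_cmod_cp_stp[OF det_rprod[OF _ a] rate_ge] l_def)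
  also have "\<dots> = ennreal l + ennreal (mean_growth n)"
    using measurable_rprod[OF a, of n]
    by (subst nn_integral_add) (auto simp: Suc.IH emeasure_space_1)
  also have "\<dots> = ennreal (mean_growth (Suc n))"
    using l mean_growth_nonneg[of n] by (simp add: mean_growth_Suc l_def add.commute)
  finally show ?case .
qed

text \<open>The centred process \<open>ln |cp|\<close> has martingale increments of second moment at
  most \<open>(ln 10001)^2\<close>, so the variance grows at most linearly.\<close>

lemma nn_integral_square_rprod:
  assumes a: "a \<in> J"
  shows "(\<integral>\<^sup>+\<omega>. ennreal ((ln (cmod (cp (rprod A n a \<omega>))) - mean_growth n)\<^sup>2) \<partial>M) \<le> ennreal (real n * (ln 10001)\<^sup>2)"
proof (induction n)
  case 0 show ?case by (simp add: mean_growth_def)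
next
  case (Suc n)
  have m[measurable]: "rprod A n a \<in> borel_measurable M" by (rule measurable_rprod[OF a])
  have "(\<integral>\<^sup>+\<omega>. ennreal ((ln (cmod (cp (rprod A (Suc n) a \<omega>))) - mean_growth (Suc n))\<^sup>2) \<partial>M) =
     (\<integral>\<^sup>+\<omega>. (\<integral>\<^sup>+t. ennreal ((ln (cmod (cp (stp (rate (Suc n)) t a ** rprod A n a \<omega>))) - mean_growth (Suc n))\<^sup>2) \<partial>unif) \<partial>M)"
    by (rule nn_integral_rprod_Suc[OF a]) measurable
  also have "\<dots> \<le> (\<integral>\<^sup>+\<omega>. ennreal ((ln (cmod (cp (rprod A n a \<omega>))) - mean_growth n)\<^sup>2) + ennreal ((ln 10001)\<^sup>2) \<partial>M)"
    unfolding mean_growth_Suc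
    by (intro nn_integral_mono order_trans[OF nn_integral_square_stp[OF det_rprod[OF _ a] rate_ge]])
      (auto simp: rate_def ennreal_plus)
  also have "\<dots> = (\<integral>\<^sup>+\<omega>. ennreal ((ln (cmod (cp (rprod A n a \<omega>))) - mean_growth n)\<^sup>2) \<partial>M) + ennreal ((ln 10001)\<^sup>2)"
    by (subst nn_integral_add) (auto simp: emeasure_space_1)
  also have "\<dots> \<le> ennreal (real n * (ln 10001)\<^sup>2) + ennreal ((ln 10001)\<^sup>2)"
    by (intro add_right_mono Suc.IH)
  also have "\<dots> = ennreal (real (Suc n) * (ln 10001)\<^sup>2)"
    by (simp flip: ennreal_plus add: distrib_right add.commute)
  finally show ?case .
qed

lemma log_norm_eq: "log_norm A n a \<omega> = ln (opn (rprod A n a \<omega>))"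
  by (simp add: log_norm_def onorm_eq_opn)

lemma log_norm_bounds:
  assumes "\<omega> \<in> space M" "a \<in> J"
  shows "0 \<le> log_norm A n a \<omega>" "ln (cmod (cp (rprod A n a \<omega>))) \<le> log_norm A n a \<omega>"
    "log_norm A n a \<omega> \<le> ln 2 + ln (cmod (cp (rprod A n a \<omega>)))"
proof -
  note d = det_one_cmod[OF det_rprod[OF assms], of n]
  have p: "0 < cmod (cp (rprod A n a \<omega>))" using d(2) by linarith
  show 1: "0 \<le> log_norm A n a \<omega>" using d(6) by (simp add: log_norm_eq)
  show "ln (cmod (cp (rprod A n a \<omega>))) \<le> log_norm A n a \<omega>"
    unfolding log_norm_eq using p by (subst ln_le_cancel_iff) (auto simp: opn_def intro: add_pos_nonneg)
  have "log_norm A n a \<omega> \<le> ln (2 * cmod (cp (rprod A n a \<omega>)))"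
    unfolding log_norm_eq using p d(5,6) by (subst ln_le_cancel_iff) auto
  then show "log_norm A n a \<omega> \<le> ln 2 + ln (cmod (cp (rprod A n a \<omega>)))"
    using p by (subst (asm) ln_mult_pos) auto
qed

lemma mean_log_norm_bounds:
  assumes a: "a \<in> J"
  shows "mean_growth n \<le> mean_log_norm M A n a" "mean_log_norm M A n a \<le> mean_growth n + ln 2"
proof -
  have m[measurable]: "rprod A n a \<in> borel_measurable M" by (rule measurable_rprod[OF a])
  have lm[measurable]: "(\<lambda>\<omega>. log_norm A n a \<omega>) \<in> borel_measurable M"
    unfolding log_norm_eq opn_def by measurable
  have nn: "AE \<omega> in M. 0 \<le> log_norm A n a \<omega>" "AE \<omega> in M. 0 \<le> ln (cmod (cp (rprod A n a \<omega>)))"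
    using log_norm_bounds(1)[OF _ a] det_one_cmod(2)[OF det_rprod[OF _ a]] by (auto intro!: AE_I2)
  have "(\<integral>\<^sup>+\<omega>. ennreal (log_norm A n a \<omega>) \<partial>M) \<le> (\<integral>\<^sup>+\<omega>. ennreal (ln 2) + ennreal (ln (cmod (cp (rprod A n a \<omega>)))) \<partial>M)"
    using log_norm_bounds(3)[OF _ a] det_one_cmod(2)[OF det_rprod[OF _ a]]
    by (intro nn_integral_mono) (auto simp flip: ennreal_plus intro!: ennreal_leI)
  also have "\<dots> = ennreal (ln 2) + ennreal (mean_growth n)"
    by (subst nn_integral_add) (auto simp: nn_integral_ln_cp_rprod[OF a] emeasure_space_1)
  also have "\<dots> = ennreal (mean_growth n + ln 2)"
    using mean_growth_nonneg[of n] by (simp add: add.commute)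
  finally have up: "(\<integral>\<^sup>+\<omega>. ennreal (log_norm A n a \<omega>) \<partial>M) \<le> ennreal (mean_growth n + ln 2)" .
  have lo: "ennreal (mean_growth n) \<le> (\<integral>\<^sup>+\<omega>. ennreal (log_norm A n a \<omega>) \<partial>M)"
    unfolding nn_integral_ln_cp_rprod[OF a, symmetric]
    using log_norm_bounds(2)[OF _ a] by (intro nn_integral_mono ennreal_leI) auto
  have eq: "mean_log_norm M A n a = enn2real (\<integral>\<^sup>+\<omega>. ennreal (log_norm A n a \<omega>) \<partial>M)"
    unfolding mean_log_norm_def by (rule integral_eq_nn_integral[OF lm nn(1)])
  show "mean_growth n \<le> mean_log_norm M A n a"
    unfolding eq using enn2real_mono[OF lo le_less_trans[OF up]] mean_growth_nonneg[of n] by simp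
  show "mean_log_norm M A n a \<le> mean_growth n + ln 2"
    unfolding eq using enn2real_mono[OF up] mean_growth_nonneg[of n] by (simp del: ennreal_plus)
qed

end

section \<open>Lower bounds for the mean exponent and at rational parameters\<close>

lemma strict_mono_2nseq: "strict_mono (\<lambda>i. 2 * nseq i)"
  using strict_mono_nseq by (simp add: strict_mono_def)

lemma Rot_0: "Rot 0 = mat 1"
  by (simp add: Rot_def mat_def vec_eq_iff forall_2)

lemma dense_Rats_J: "J \<subseteq> closure (J \<inter> \<rat>)"
proof -
  have "closure ({0<..<2 * pi} \<inter> \<rat>) = closure {0<..<2 * pi :: real}"
    by (rule closure_open_Int_superset) (auto simp: Rats_closure_real)
  then have "closure ({0<..<2 * pi} \<inter> \<rat>) = J" by simp
  moreover have "closure ({0<..<2 * pi} \<inter> \<rat>) \<subseteq> closure (J \<inter> \<rat>)" by (intro closure_mono) auto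
  ultimately show ?thesis by simp
qed

context random_cocycle
begin

lemma mean_growth_le: "mean_growth n \<le> n * ln 100"
proof -
  have "ln (dgp (rate j)) \<le> ln 100" for j
    using dgp_dgq[OF rate_ge, of j] by (subst ln_le_cancel_iff) (auto simp: rate_def split: if_splits)
  then have "mean_growth n \<le> (\<Sum>j=1..n. ln 100)" unfolding mean_growth_def by (intro sum_mono)
  then show ?thesis by simp
qed

text \<open>At time \<open>2 * n\<close> at least half of the steps are strong.
  \<open>dgp 2 = 5 / 4\<close> and \<open>dgp 100 > 50\<close> give the rate
  \<open>ln (125 / 2) / 2\<close>, and \<open>2 ^ 59 \<le> (125 / 2) ^ 10\<close> replaces it by the
  rational multiple \<open>59 / 20\<close> of \<open>ln 2\<close>.\<close>

lemma mean_growth_ge: "mean_growth (2 * nseq i) \<ge> 59 / 20 * ln 2 * real (2 * nseq i)"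
proof -
  define n where "n = nseq i"
  have 1: "ln (dgp (rate j)) \<ge> ln (5 / 4)" for j
    by (subst ln_le_cancel_iff) (auto simp: rate_def dgp_def)
  have 2: "ln (dgp (rate j)) \<ge> ln 50" if "j \<in> {n<..2 * n}" for j
    using that by (subst ln_le_cancel_iff) (auto simp: rate_def dgp_def n_def)
  have "{1..2 * n} = {1..n} \<union> {n<..2 * n}" by auto
  then have "mean_growth (2 * n) = (\<Sum>j=1..n. ln (dgp (rate j))) + (\<Sum>j\<in>{n<..2 * n}. ln (dgp (rate j)))"
    unfolding mean_growth_def by (subst sum.union_disjoint[symmetric]) auto
  also have "\<dots> \<ge> (\<Sum>j=1..n. ln (5 / 4)) + (\<Sum>j\<in>{n<..2 * n}. ln 50)"
    using 1 2 by (intro add_mono sum_mono) auto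
  also have "(\<Sum>j=1..n. ln (5 / 4 :: real)) + (\<Sum>j\<in>{n<..2 * n}. ln 50) = n * (ln (5 / 4) + ln 50)"
    by (simp add: algebra_simps)
  also have "ln (5 / 4 :: real) + ln 50 = ln (125 / 2)" by (subst ln_mult_pos[symmetric]) auto
  finally have *: "mean_growth (2 * n) \<ge> n * ln (125 / 2)" .
  have "59 * ln (2::real) = ln (2 ^ 59)" by (subst ln_realpow) auto
  also have "\<dots> \<le> ln ((125 / 2) ^ 10)" by (subst ln_le_cancel_iff) (auto simp: power_divide)
  also have "\<dots> = 10 * ln (125 / 2)" by (subst ln_realpow) auto
  finally have "59 / 10 * ln 2 \<le> ln (125 / 2 :: real)" by simp
  then have "n * (59 / 10 * ln 2) \<le> n * ln (125 / 2 :: real)" by (intro mult_left_mono) auto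
  with * show ?thesis by (simp add: n_def)
qed

text \<open>The norm and \<open>|cp|\<close> differ by a factor of at most 2, which is lost after
  division by \<open>n\<close>. The right-hand side does not contain \<open>a\<close>, whence the
  constancy of the mean exponent.\<close>

lemma upper_mean_exponent_eq:
  assumes a: "a \<in> J"
  shows "upper_mean_exponent M A a = limsup (\<lambda>n. ereal (mean_growth n / n))"
proof -
  define u where "u = (\<lambda>n. ereal ((mean_log_norm M A n a - mean_growth n) / n))"
  have "(\<lambda>n. (mean_log_norm M A n a - mean_growth n) / n) \<longlonglongrightarrow> 0"
  proof (rule tendsto_sandwich[of "\<lambda>_. 0" "\<lambda>n. (mean_log_norm M A n a - mean_growth n) / n" sequentially "\<lambda>n. ln 2 / n"])
    show "\<forall>\<^sub>F n in sequentially. 0 \<le> (mean_log_norm M A n a - mean_growth n) / n"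
      using mean_log_norm_bounds(1)[OF a] by (intro always_eventually) auto
    show "\<forall>\<^sub>F n in sequentially. (mean_log_norm M A n a - mean_growth n) / n \<le> ln 2 / n"
      using mean_log_norm_bounds(2)[OF a] by (intro always_eventually allI divide_right_mono) (auto simp: algebra_simps)
    show "(\<lambda>n. ln 2 / real n) \<longlonglongrightarrow> 0" by (rule lim_const_over_n)
  qed auto
  then have "u \<longlonglongrightarrow> 0" unfolding u_def zero_ereal_def by simp
  then have "limsup (\<lambda>n. u n + ereal (mean_growth n / n)) = 0 + limsup (\<lambda>n. ereal (mean_growth n / n))"
    by (rule ereal_limsup_lim_add) simp
  moreover have "u n + ereal (mean_growth n / n) = ereal (1 / real n * mean_log_norm M A n a)" for n
    by (simp add: u_def field_simps diff_divide_distrib)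
  ultimately show ?thesis by (simp add: upper_mean_exponent_def)
qed

lemma limsup_mean_growth:
  obtains c where "limsup (\<lambda>n. ereal (mean_growth n / n)) = ereal c" "59 / 20 * ln 2 \<le> c"
proof -
  let ?X = "\<lambda>n. ereal (mean_growth n / n)"
  have "ereal (59 / 20 * ln 2) \<le> limsup (?X \<circ> (\<lambda>i. 2 * nseq i))"
  proof (rule le_Limsup)
    show "\<forall>\<^sub>F i in sequentially. ereal (59 / 20 * ln 2) \<le> (?X \<circ> (\<lambda>i. 2 * nseq i)) i"
    proof (intro always_eventually allI)
      fix i
      have "real (2 * nseq i) > 0" using nseq_ge[of i] by simp
      then show "ereal (59 / 20 * ln 2) \<le> (?X \<circ> (\<lambda>i. 2 * nseq i)) i"
        using mean_growth_ge[of i] by (simp only: o_def ereal_less_eq pos_le_divide_eq)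
    qed
  qed simp
  also have "\<dots> \<le> limsup ?X" by (rule limsup_subseq_mono[OF strict_mono_2nseq])
  finally have lo: "ereal (59 / 20 * ln 2) \<le> limsup ?X" .
  have up: "limsup ?X \<le> ereal (ln 100)"
  proof (rule Limsup_bounded)
    show "\<forall>\<^sub>F n in sequentially. ?X n \<le> ereal (ln 100)"
      using mean_growth_le by (intro always_eventually allI) (simp add: divide_le_eq mult.commute)
  qed
  obtain c where "limsup ?X = ereal c" using lo up by (cases "limsup ?X") auto
  then show ?thesis using lo that by simp
qed

text \<open>Chebyshev with linear variance gives exceptional probabilities of order
  \<open>1 / N i\<close> at the times \<open>N i = 2 * nseq i\<close>. They are summable since
  \<open>N i \<ge> 2 ^ i\<close>, and a limsup only needs these times. The deviation
  \<open>3 / 100\<close> is the difference of \<open>59 / 20\<close> and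
  \<open>73 / 25\<close>.\<close>

lemma AE_upper_exponent_ge:
  assumes a: "a \<in> J"
  shows "AE \<omega> in M. ereal (73 / 25 * ln 2) \<le> upper_exponent A \<omega> a"
proof -
  define N where "N = (\<lambda>i. 2 * nseq i)"
  define \<epsilon> :: real where "\<epsilon> = 3 / 100 * ln 2"
  define C :: real where "C = (ln 10001)\<^sup>2"
  have \<epsilon>: "\<epsilon> > 0" by (simp add: \<epsilon>_def)
  have N: "N i > 0" "2 ^ i \<le> real (N i)" for i
  proof -
    show "N i > 0" using nseq_ge[of i] by (simp add: N_def)
    have "2 ^ i \<le> N i" using nseq_ge_power[of i] by (simp add: N_def)
    then show "2 ^ i \<le> real (N i)" by (metis of_nat_le_iff of_nat_numeral of_nat_power)
  qed
  define X where "X = (\<lambda>i \<omega>. ln (cmod (cp (rprod A (N i) a \<omega>))) - mean_growth (N i))"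
  have m[measurable]: "rprod A n a \<in> borel_measurable M" for n by (rule measurable_rprod[OF a])
  have Xm[measurable]: "X i \<in> borel_measurable M" for i unfolding X_def by measurable
  define E where "E = (\<lambda>i. {\<omega> \<in> space M. \<epsilon> * N i \<le> \<bar>X i \<omega>\<bar>})"
  have Em: "E i \<in> sets M" for i unfolding E_def by measurable
  have bound: "measure M (E i) \<le> C / \<epsilon>\<^sup>2 * (1 / 2) ^ i" for i
  proof -
    define c where "c = 1 / (\<epsilon> * N i)\<^sup>2"
    have c0: "c \<ge> 0" by (simp add: c_def)
    have eN: "\<epsilon> * N i > 0" using \<epsilon> N(1)[of i] by simp
    have "E i \<subseteq> {\<omega> \<in> space M. 1 \<le> ennreal c * ennreal ((X i \<omega>)\<^sup>2)}"
    proof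
      fix \<omega> assume w: "\<omega> \<in> E i"
      then have "(\<epsilon> * N i)\<^sup>2 \<le> (X i \<omega>)\<^sup>2"
        using eN by (auto simp: E_def abs_le_square_iff[symmetric])
      moreover have "0 < (\<epsilon> * N i)\<^sup>2" using eN by (rule zero_less_power)
      ultimately have "1 \<le> (X i \<omega>)\<^sup>2 / (\<epsilon> * N i)\<^sup>2" by (subst pos_le_divide_eq) simp_all
      then have "1 \<le> c * (X i \<omega>)\<^sup>2" by (simp only: c_def times_divide_eq_left mult_1)
      then have "ennreal 1 \<le> ennreal (c * (X i \<omega>)\<^sup>2)" by (rule ennreal_leI)
      then show "\<omega> \<in> {\<omega> \<in> space M. 1 \<le> ennreal c * ennreal ((X i \<omega>)\<^sup>2)}"
        using w c0 by (simp add: E_def ennreal_mult)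
    qed
    then have "emeasure M (E i) \<le> emeasure M {\<omega> \<in> space M. 1 \<le> ennreal c * ennreal ((X i \<omega>)\<^sup>2)}"
      by (rule emeasure_mono) measurable
    also have "\<dots> \<le> ennreal c * (\<integral>\<^sup>+\<omega>. ennreal ((X i \<omega>)\<^sup>2) * indicator (space M) \<omega> \<partial>M)"
      by (rule nn_integral_Markov_inequality) measurable
    also have "(\<integral>\<^sup>+\<omega>. ennreal ((X i \<omega>)\<^sup>2) * indicator (space M) \<omega> \<partial>M) = (\<integral>\<^sup>+\<omega>. ennreal ((X i \<omega>)\<^sup>2) \<partial>M)"
      by (intro nn_integral_cong) auto
    also have "\<dots> \<le> ennreal (N i * C)"
      using nn_integral_square_rprod[OF a, of "N i"] by (simp add: X_def C_def)
    also have "ennreal c * ennreal (N i * C) = ennreal (c * (N i * C))"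
      using c0 by (simp add: ennreal_mult C_def)
    finally have "emeasure M (E i) \<le> ennreal (c * (N i * C))" by (simp add: mult_left_mono)
    then have "measure M (E i) \<le> c * (N i * C)"
      using c0 by (simp add: emeasure_eq_measure C_def)
    also have "c * (N i * C) = C / \<epsilon>\<^sup>2 * (1 / N i)"
      using N(1)[of i] \<epsilon> by (simp add: c_def power2_eq_square field_simps)
    also have "\<dots> \<le> C / \<epsilon>\<^sup>2 * (1 / 2 ^ i)"
      using N[of i] by (intro mult_left_mono divide_left_mono) (auto simp: C_def)
    finally show ?thesis by (simp add: power_one_over)
  qed
  have "summable (\<lambda>i. measure M (E i))"
  proof (rule summable_comparison_test')
    show "summable (\<lambda>i. C / \<epsilon>\<^sup>2 * (1 / 2) ^ i)" by (intro summable_mult summable_geometric) simp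
    show "norm (measure M (E i)) \<le> C / \<epsilon>\<^sup>2 * (1 / 2) ^ i" if "0 \<le> i" for i
      unfolding real_norm_def abs_of_nonneg[OF measure_nonneg] by (rule bound)
  qed
  then have "AE \<omega> in M. \<forall>\<^sub>F i in sequentially. \<omega> \<in> space M - E i"
    by (intro borel_cantelli_AE1 Em) (auto simp: emeasure_eq_measure)
  then show ?thesis
  proof eventually_elim
    case (elim \<omega>)
    have "ereal (73 / 25 * ln 2) \<le> limsup ((\<lambda>n. ereal (1 / real n * log_norm A n a \<omega>)) \<circ> N)"
    proof (rule le_Limsup)
      show "\<forall>\<^sub>F i in sequentially. ereal (73 / 25 * ln 2) \<le> ((\<lambda>n. ereal (1 / real n * log_norm A n a \<omega>)) \<circ> N) i"
        using elim
      proof eventually_elim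
        case (elim i)
        have w: "\<omega> \<in> space M" and lt: "\<bar>X i \<omega>\<bar> < \<epsilon> * N i" using elim by (auto simp: E_def)
        have "59 / 20 * ln 2 * real (N i) \<le> mean_growth (N i)"
          unfolding N_def by (rule mean_growth_ge)
        moreover have "ln (cmod (cp (rprod A (N i) a \<omega>))) \<le> log_norm A (N i) a \<omega>"
          by (rule log_norm_bounds[OF w a])
        ultimately have "(59 / 20 * ln 2 - \<epsilon>) * N i \<le> log_norm A (N i) a \<omega>"
          using lt by (simp add: X_def left_diff_distrib abs_less_iff)
        also have "59 / 20 * ln 2 - \<epsilon> = 73 / 25 * ln 2" by (simp add: \<epsilon>_def)
        finally have "73 / 25 * ln 2 \<le> log_norm A (N i) a \<omega> / N i"
          using N(1)[of i] by (simp add: pos_le_divide_eq)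
        then show ?case by simp
      qed
    qed simp
    also have "\<dots> \<le> upper_exponent A \<omega> a"
      unfolding upper_exponent_def N_def by (rule limsup_subseq_mono[OF strict_mono_2nseq])
    finally show ?case .
  qed
qed

section \<open>The almost sure form of the random maps\<close>

lemma AE_law:
  assumes j: "j \<ge> 1" and S: "S \<in> sets C1_borel"
    and *: "\<And>t. t \<in> J \<Longrightarrow> rand_map (dg (rate j)) t \<in> S"
  shows "AE \<omega> in M. A j \<omega> \<in> S"
proof -
  have "AE t in unif. rand_map (dg (rate j)) t \<in> S"
    by (rule AE_uniform_measureI) (use * in auto)
  then have "AE f in law (dg (rate j)). f \<in> S"
    unfolding law_def using S
    by (subst AE_distr_iff[OF rand_map_measurable_unif[OF det_dg_rate]]) (auto simp: Int_def[symmetric] Int_commute)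
  then show ?thesis
    unfolding law_A[OF j, symmetric] by (rule AE_distrD[OF measurable_A[OF j]])
qed

text \<open>Only the laws of the maps are given, so their form has to be expressed by measurable
  events: the value at 0 lies in a compact set, and
  \<open>A j \<omega> q = Rot q ** A j \<omega> 0\<close> for the countably many rational
  \<open>q\<close>. Continuity of the maps extends this to \<open>J\<close>. The angles are chosen
  separately for each \<open>\<omega>\<close>, without measurability.\<close>

lemma AE_structure:
  "AE \<omega> in M. \<exists>\<alpha>. \<forall>j\<ge>1. \<forall>a\<in>J. A j \<omega> a = stp (rate j) (\<alpha> j) a"
proof -
  have *: "AE \<omega> in M. \<exists>t. \<forall>a\<in>J. A j \<omega> a = stp (rate j) t a" if j: "j \<ge> 1" for j
  proof -
    define K where "K = (\<lambda>t. stp (rate j) t 0) ` J"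
    have K: "closed K" unfolding K_def
      by (intro compact_imp_closed compact_continuous_image continuous_stp) auto
    have 0: "0 \<in> J" by simp
    have "AE \<omega> in M. A j \<omega> \<in> (\<lambda>f. f 0) -` K \<inter> space C1_borel"
      using K by (intro AE_law[OF j] measurable_sets[OF measurable_eval[OF 0]])
        (auto simp: K_def rand_map_def stp_def space_C1_borel intro!: rand_map_in_C1_SL2[unfolded rand_map_def] det_dg_rate)
    moreover have "AE \<omega> in M. \<forall>q\<in>J \<inter> \<rat>. A j \<omega> q = Rot q ** A j \<omega> 0"
    proof (rule AE_ball_countable')
      fix q assume q: "q \<in> J \<inter> \<rat>"
      have "(\<lambda>f. f q - Rot q ** f 0) \<in> borel_measurable C1_borel"
        using q by (intro borel_measurable_diff borel_measurable_matrix_mult measurable_eval borel_measurable_const 0) auto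
      from measurable_sets[OF this, of "{0}"]
      have "AE \<omega> in M. A j \<omega> \<in> (\<lambda>f. f q - Rot q ** f 0) -` {0} \<inter> space C1_borel"
        using q by (intro AE_law[OF j])
          (auto simp: rand_map_def matrix_mul_assoc Rot_0 space_C1_borel intro!: rand_map_in_C1_SL2[unfolded rand_map_def] det_dg_rate)
      then show "AE \<omega> in M. A j \<omega> q = Rot q ** A j \<omega> 0" by eventually_elim simp
    next
      show "countable (J \<inter> \<rat>)" by (rule countable_Int2[OF countable_rat])
    qed
    ultimately show ?thesis
      using AE_space
    proof eventually_elim
      case (elim \<omega>)
      from elim(1) obtain t where t: "A j \<omega> 0 = stp (rate j) t 0" by (auto simp: K_def)
      have "A j \<omega> a - Rot a ** A j \<omega> 0 = 0" if a: "a \<in> J" for a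
      proof (rule continuous_constant_on_closure[of "J \<inter> \<rat>" "\<lambda>a. A j \<omega> a - Rot a ** A j \<omega> 0" 0 a])
        interpret m: bounded_bilinear "(**) :: real^2^2 \<Rightarrow> real^2^2 \<Rightarrow> real^2^2"
          by (rule bounded_bilinear_matrix_mult)
        have "continuous_on J (A j \<omega>)" using A_in_C1_SL2[OF j elim(3)] by (rule C1_SL2_D)
        then have "continuous_on J (\<lambda>a. A j \<omega> a - Rot a ** A j \<omega> 0)"
          by (intro continuous_intros m.continuous_on continuous_on_Rot)
        moreover have "closure (J \<inter> \<rat>) \<subseteq> J" by (intro closure_minimal) auto
        ultimately show "continuous_on (closure (J \<inter> \<rat>)) (\<lambda>a. A j \<omega> a - Rot a ** A j \<omega> 0)"
          by (rule continuous_on_subset)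
        show "a \<in> closure (J \<inter> \<rat>)" using dense_Rats_J a by blast
        fix x assume "x \<in> J \<inter> \<rat>"
        with elim(2) have "A j \<omega> x = Rot x ** A j \<omega> 0" by blast
        then show "A j \<omega> x - Rot x ** A j \<omega> 0 = 0" by (rule right_minus_eq[THEN iffD2])
      qed
      then have "\<forall>a\<in>J. A j \<omega> a = stp (rate j) t a"
        unfolding t by (simp add: stp_def Rot_0 matrix_mul_assoc)
      then show ?case by blast
    qed
  qed
  have "AE \<omega> in M. \<forall>j\<in>{1..}. \<exists>t. \<forall>a\<in>J. A j \<omega> a = stp (rate j) t a"
    by (rule AE_ball_countable') (use * in auto)
  then show ?thesis
  proof eventually_elim
    case (elim \<omega>)
    then obtain \<alpha> where "\<forall>j\<in>{1..}. \<forall>a\<in>J. A j \<omega> a = stp (rate j) (\<alpha> j) a" by metis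
    then show ?case by auto
  qed
qed

end

section \<open>Rotating runs\<close>

text \<open>Over an interval of length \<open>10 ^ (-70 * unit_len i)\<close>, which contains one of the \<open>cells i\<close>
  equal parts of \<open>J\<close>, the norm of \<open>60 * unit_len i\<close> steps changes by at most
  \<open>100 ^ (31 * unit_len i)\<close>.\<close>
definition unit_len :: "nat \<Rightarrow> nat" where "unit_len i = nseq i div 100"
definition cells :: "nat \<Rightarrow> nat" where "cells i = 16 * 10 ^ (70 * unit_len i)"
text \<open>The number of disjoint stretches of \<open>8 * cells i\<close> steps that fit into
  \<open>unit_len (Suc i)\<close> steps, the part of the window in which a run is sought.\<close>

definition runs :: "nat \<Rightarrow> nat" where "runs i = unit_len (Suc i) div (8 * cells i)"

definition cell :: "nat \<Rightarrow> nat \<Rightarrow> real set" where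
  "cell G m = {2 * pi * m / G..2 * pi * (m + 1) / G}"

text \<open>The candidate runs have \<open>8 * cells i\<close> steps each; the cells of stage \<open>i\<close> are used for the runs in
  the window after \<open>nseq (Suc i)\<close>.\<close>
definition run_start :: "nat \<Rightarrow> nat \<Rightarrow> nat" where
  "run_start i t = nseq (Suc i) + 30 * unit_len (Suc i) + 8 * cells i * t"

lemma nseq_unit_len: "nseq i = 100 * unit_len i"
proof -
  have "100 dvd nseq i"
  proof (cases i)
    case (Suc k)
    have "2 \<le> nseq k" using nseq_ge[of k] by simp
    moreover have "nseq k < 10 ^ nseq k" by (rule less_exp[THEN less_le_trans]) (simp add: power_mono)
    ultimately have "2 \<le> (10::nat) ^ nseq k" by linarith
    then have "(10::nat) ^ 2 dvd 10 ^ (10 ^ nseq k)" by (rule le_imp_power_dvd)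
    then show ?thesis by (simp add: Suc nseq.simps(2))
  qed simp
  then show ?thesis by (simp add: unit_len_def)
qed

lemma unit_len_ge: "unit_len i \<ge> 10"
  using nseq_ge[of i] nseq_unit_len[of i] by linarith

lemma less_power_10: "n < (10::nat) ^ n"
  by (rule less_exp[THEN less_le_trans]) (simp add: power_mono)

lemma nseq_le_power: "nseq i \<le> 10 ^ (70 * unit_len i)"
proof -
  define l where "l = unit_len i"
  have "100 * l \<le> 10 ^ 2 * 10 ^ l" using less_power_10[of l] by simp
  also have "\<dots> = 10 ^ (2 + l)" by (simp add: power_add)
  also have "\<dots> \<le> (10::nat) ^ (70 * l)"
    using unit_len_ge[of i] by (intro power_increasing) (auto simp: l_def)
  finally show ?thesis using nseq_unit_len[of i] by (simp add: l_def)
qed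

lemma cells_ge: "cells i \<ge> 10000" "cells i \<ge> nseq i"
proof -
  define l where "l = unit_len i"
  have l: "l \<ge> 10" using unit_len_ge by (simp add: l_def)
  have "(10::nat) ^ 4 \<le> 10 ^ (70 * l)" using l by (intro power_increasing) auto
  then show "cells i \<ge> 10000" by (simp add: cells_def l_def)
  show "cells i \<ge> nseq i" using nseq_le_power[of i] by (simp add: cells_def)
qed

text \<open>Double exponential growth is spent here: with \<open>l = unit_len i\<close> the decimal
  logarithm of the left-hand side is of order \<open>l * 10 ^ (70 * l)\<close>, and that of
  \<open>nseq (Suc i)\<close> is \<open>10 ^ (100 * l)\<close>.\<close>

lemma cells_power_le: "100 * cells i ^ (4 * cells i + 3) \<le> nseq (Suc i)"
proof -
  define l where "l = unit_len i"
  define G where "G = cells i"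
  have l: "l \<ge> 10" using unit_len_ge by (simp add: l_def)
  have G: "G = 16 * 10 ^ (70 * l)" by (simp add: G_def cells_def l_def)
  have "G \<le> 10 ^ 2 * 10 ^ (70 * l)" by (simp add: G)
  also have "\<dots> = 10 ^ (2 + 70 * l)" by (simp add: power_add)
  also have "\<dots> \<le> 10 ^ (72 * l)" using l by (intro power_increasing) auto
  finally have "G ^ (4 * G + 3) \<le> (10 ^ (72 * l)) ^ (4 * G + 3)" by (intro power_mono) auto
  then have "100 * G ^ (4 * G + 3) \<le> 10 ^ 2 * 10 ^ (72 * l * (4 * G + 3))" by (simp add: power_mult)
  also have "\<dots> = 10 ^ (2 + 72 * l * (4 * G + 3))" by (simp add: power_add)
  also have "\<dots> \<le> 10 ^ (10 ^ (100 * l))"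
  proof (rule power_increasing)
    have "4 * G + 3 \<le> 5 * G" using cells_ge(1)[of i] by (simp add: G_def)
    then have "2 + 72 * l * (4 * G + 3) \<le> 2 + 72 * l * (5 * G)" by simp
    also have "\<dots> \<le> 73 * l * (5 * G)" using l cells_ge(1)[of i] mult_mono[of 10 l 10000 G] by (simp add: G_def)
    also have "\<dots> = 5840 * l * 10 ^ (70 * l)" by (simp add: G)
    also have "\<dots> \<le> 10 ^ 4 * 10 ^ l * 10 ^ (70 * l)"
      using less_power_10[of l] by (intro mult_mono) auto
    also have "\<dots> = 10 ^ (4 + l + 70 * l)" by (simp only: power_add)
    also have "\<dots> \<le> 10 ^ (100 * l)" using l by (intro power_increasing) auto
    finally show "2 + 72 * l * (4 * G + 3) \<le> 10 ^ (100 * l)" .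
  qed simp
  finally show ?thesis unfolding G_def nseq.simps(2) using nseq_unit_len[of i] by (simp add: l_def)
qed

text \<open>Of the three spare factors \<open>cells i\<close> in \<open>cells_power_le\<close>, two
  absorb the length \<open>8 * cells i\<close> of a run and the third makes the expected number of
  successes at least \<open>cells i\<close>.\<close>

lemma runs_ge: "runs i \<ge> cells i * cells i ^ (4 * cells i)"
proof -
  define G where "G = cells i"
  have G: "G \<ge> 10000" using cells_ge by (simp add: G_def)
  have "8 * G * (G * G ^ (4 * G)) \<le> G * G * (G * G ^ (4 * G))"
    using G by (intro mult_right_mono) auto
  also have "\<dots> = G ^ (4 * G + 3)" by (simp add: power_add power3_eq_cube mult_ac)
  also have "\<dots> \<le> unit_len (Suc i)"
    using cells_power_le[of i] nseq_unit_len[of "Suc i"] by (simp add: G_def)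
  finally have "8 * G * (G * G ^ (4 * G)) \<le> unit_len (Suc i)" .
  then have "(8 * G * (G * G ^ (4 * G))) div (8 * G) \<le> unit_len (Suc i) div (8 * G)" by (rule div_le_mono)
  then show ?thesis using G by (simp add: runs_def G_def)
qed

text \<open>The left-hand side is the union bound for the event that some cell has no run. With
  success probability \<open>x\<close> per attempt, \<open>runs i * x\<close> is at least
  \<open>cells i\<close>, so the bound decays like \<open>G * exp (- G)\<close>, which more than
  suffices for summability.\<close>

lemma cells_exp_le: "real (cells i) * (1 - (1 / cells i) ^ (4 * cells i)) ^ runs i \<le> (1 / 2) ^ i * 4"
proof -
  define G where "G = cells i"
  define x :: real where "x = (1 / G) ^ (4 * G)"
  have G: "G \<ge> 10000" using cells_ge by (simp add: G_def)
  have x: "0 < x" "x \<le> 1" using G by (auto simp: x_def power_le_one)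
  have "real G * real G ^ (4 * G) \<le> runs i"
    using runs_ge[of i] unfolding G_def by (metis of_nat_le_iff of_nat_mult of_nat_power)
  then have "real G \<le> runs i * x" using G by (simp add: x_def power_one_over field_simps)
  have "(1 - x) ^ runs i \<le> exp (- x) ^ runs i"
    using x exp_ge_add_one_self[of "- x"] by (intro power_mono) auto
  also have "\<dots> = exp (- (runs i * x))" by (simp add: exp_of_nat_mult[symmetric])
  also have "\<dots> \<le> exp (- real G)" using \<open>real G \<le> runs i * x\<close> by simp
  also have "\<dots> \<le> 4 / (real G)\<^sup>2"
  proof -
    have "real G / 2 \<le> exp (real G / 2)"
      using exp_ge_add_one_self[of "real G / 2"] by linarith
    then have "(real G / 2)\<^sup>2 \<le> (exp (real G / 2))\<^sup>2" by (rule power_mono) simp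
    also have "\<dots> = exp (real G)" by (simp add: exp_double[symmetric])
    finally show ?thesis using G by (simp add: exp_minus field_simps power2_eq_square)
  qed
  finally have "real G * (1 - x) ^ runs i \<le> real G * (4 / (real G)\<^sup>2)" by (intro mult_left_mono) auto
  also have "\<dots> = 4 / real G" using G by (simp add: power2_eq_square)
  also have "\<dots> \<le> 4 / 2 ^ i"
  proof -
    have "2 ^ i \<le> G" using nseq_ge_power[of i] cells_ge(2)[of i] by (simp add: G_def)
    then have "2 ^ i \<le> real G" by (metis of_nat_le_iff of_nat_numeral of_nat_power)
    then show ?thesis using G by (intro divide_left_mono) auto
  qed
  finally show ?thesis by (simp add: G_def x_def power_one_over)
qed

section \<open>Runs occur in all cells at once\<close>

context random_cocycle
begin

text \<open>An attempt \<open>t\<close> succeeds with probability at least \<open>r ^ K\<close> by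
  independence inside \<open>D t\<close>; attempts over disjoint index sets are independent of each
  other, so the probabilities of failure multiply.\<close>

lemma no_run_prob:
  fixes D :: "nat \<Rightarrow> nat set"
  assumes S: "\<And>i. S i \<in> sets C1_borel"
    and r: "0 \<le> r" "r \<le> 1" "\<And>i. i \<ge> 1 \<Longrightarrow> r \<le> prob (A i -` S i \<inter> space M)"
    and D: "\<And>t. finite (D t)" "\<And>t. card (D t) = K" "\<And>t. D t \<subseteq> {1..}" "disjoint_family D"
  shows "{\<omega> \<in> space M. \<forall>t<n. \<exists>i\<in>D t. A i \<omega> \<notin> S i} \<in> events"
    "prob {\<omega> \<in> space M. \<forall>t<n. \<exists>i\<in>D t. A i \<omega> \<notin> S i} \<le> (1 - r ^ K) ^ n"
proof -
  define B where "B = (\<lambda>t. space (PiM (D t) (\<lambda>_. C1_borel)) - (\<Pi>\<^sub>E i\<in>D t. S i))"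
  define X where "X = (\<lambda>t \<omega>. restrict (\<lambda>i. A i \<omega>) (D t))"
  have ev: "A i -` S i \<inter> space M \<in> events" if "i \<in> D t" for i t
    using measurable_sets[OF measurable_A S] D(3)[of t] that by auto
  \<comment> \<open>The outer intersection with \<open>space M\<close> covers an empty
    \<open>D t\<close>, where the inner intersection is \<open>UNIV\<close>.\<close>
  have set_eq: "{\<omega> \<in> space M. \<forall>t<n. \<exists>i\<in>D t. A i \<omega> \<notin> S i} = space M - (\<Union>t<n. space M \<inter> (\<Inter>i\<in>D t. A i -` S i \<inter> space M))"
    by (auto; blast)
  have ev2: "space M \<inter> (\<Inter>i\<in>D t. A i -` S i \<inter> space M) \<in> events" for t
  proof (cases "D t = {}")
    case False
    then show ?thesis by (intro sets.Int sets.top sets.finite_INT D(1) ev) auto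
  qed simp
  then show "{\<omega> \<in> space M. \<forall>t<n. \<exists>i\<in>D t. A i \<omega> \<notin> S i} \<in> events"
    unfolding set_eq by (intro sets.Diff sets.top sets.finite_UN ev2) auto
  have XB: "X t -` B t \<inter> space M = space M - (space M \<inter> (\<Inter>i\<in>D t. A i -` S i \<inter> space M))" for t
  proof -
    have "X t \<omega> \<in> space (PiM (D t) (\<lambda>_. C1_borel))" if "\<omega> \<in> space M" for \<omega>
      using that D(3)[of t] A_in_C1_SL2 by (auto simp: X_def space_PiM space_C1_borel)
    then show ?thesis by (auto simp: B_def X_def PiE_iff)
  qed
  have q: "prob (X t -` B t \<inter> space M) \<le> 1 - r ^ K" for t
  proof -
    have "r ^ K \<le> prob (space M \<inter> (\<Inter>i\<in>D t. A i -` S i \<inter> space M))"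
    proof (cases "D t = {}")
      case True
      then show ?thesis using D(2)[of t] by (simp add: prob_space)
    next
      case False
      have "r ^ K = (\<Prod>i\<in>D t. r)" using D(2) by simp
      also have "\<dots> \<le> (\<Prod>i\<in>D t. prob (A i -` S i \<inter> space M))"
        using r D(3)[of t] by (intro prod_mono) auto
      also have "\<dots> = prob (\<Inter>i\<in>D t. A i -` S i \<inter> space M)"
        using indep_varsD[OF indep False D(1) D(3) S] by simp
      also have "(\<Inter>i\<in>D t. A i -` S i \<inter> space M) = space M \<inter> (\<Inter>i\<in>D t. A i -` S i \<inter> space M)"
        using False by auto
      finally show ?thesis .
    qed
    then show ?thesis unfolding XB using ev2[of t] by (simp add: prob_compl)
  qed
  show "prob {\<omega> \<in> space M. \<forall>t<n. \<exists>i\<in>D t. A i \<omega> \<notin> S i} \<le> (1 - r ^ K) ^ n"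
  proof (cases "n = 0")
    case False
    have "{\<omega> \<in> space M. \<forall>t<n. \<exists>i\<in>D t. A i \<omega> \<notin> S i} = (\<Inter>t\<in>{..<n}. X t -` B t \<inter> space M)"
      unfolding XB using False by auto
    also have "prob \<dots> = (\<Prod>t\<in>{..<n}. prob (X t -` B t \<inter> space M))"
    proof (rule indep_varsD_finite)
      show "indep_vars (\<lambda>t. PiM (D t) (\<lambda>_. C1_borel)) X {..<n}"
        unfolding X_def by (rule indep_vars_restrict[OF indep]) (use D in \<open>auto simp: disjoint_family_on_def\<close>)
      show "B t \<in> sets (PiM (D t) (\<lambda>_. C1_borel))" for t
        unfolding B_def using S D(1) by (intro sets.compl_sets sets_PiM_I_finite) auto
    qed (use False in auto)
    also have "\<dots> \<le> (\<Prod>t\<in>{..<n}. 1 - r ^ K)"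
      using q by (intro prod_mono) auto
    finally show ?thesis by simp
  qed simp
qed

text \<open>Only the value at 0 is recorded. It determines the whole map almost surely, and it makes
  the set measurable as the preimage of a compact set under evaluation.\<close>

definition cell_maps :: "nat \<Rightarrow> nat \<Rightarrow> nat \<Rightarrow> (real \<Rightarrow> real^2^2) set" where
  "cell_maps G m j = (\<lambda>f. f 0) -` ((\<lambda>b. stp (rate j) (pi / 2 - b) 0) ` cell G m) \<inter> space C1_borel"

lemma cell_maps_sets: "cell_maps G m j \<in> sets C1_borel"
proof -
  have "compact ((\<lambda>b. stp (rate j) (pi / 2 - b) 0) ` cell G m)"
    unfolding cell_def
    by (intro compact_continuous_image continuous_on_compose2[OF continuous_stp[of UNIV]] continuous_intros) auto
  then show ?thesis
    unfolding cell_maps_def by (intro measurable_sets[OF measurable_eval] borel_closed compact_imp_closed) auto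
qed

text \<open>The angles \<open>pi / 2 - b\<close> with \<open>b\<close> in the cell form an arc of
  length \<open>2 * pi / G\<close>; \<open>c\<close> selects the representatives modulo
  \<open>2 * pi\<close> that lie in \<open>J\<close>. Since 4 divides \<open>G\<close>,
  \<open>pi / 2\<close> is an endpoint of cells and no arc is split.\<close>

lemma cell_maps_prob:
  assumes G: "4 dvd G" "m < G" and j: "j \<ge> 1"
  shows "1 / G \<le> prob (A j -` cell_maps G m j \<inter> space M)"
proof -
  define lo hi where "lo = 2 * pi * m / G" and "hi = 2 * pi * (m + 1) / G"
  define c where "c = (if 4 * (m + 1) \<le> G then pi / 2 else 5 * pi / 2)"
  have G0: "real G > 0" using G by simp
  have hl: "hi - lo = 2 * pi / G" using G0 by (simp add: hi_def lo_def field_simps)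
  have sub: "{c - hi..c - lo} \<subseteq> J"
  proof (cases "4 * (m + 1) \<le> G")
    case True
    then have "real (4 * (m + 1)) \<le> real G" by (rule of_nat_mono)
    then have "(2 * pi) * (4 * (real m + 1)) \<le> (2 * pi) * real G" by (intro mult_left_mono) auto
    then have "hi \<le> pi / 2" using G0 by (simp add: hi_def divide_le_eq mult_ac)
    moreover have "lo \<ge> 0" by (simp add: lo_def)
    ultimately show ?thesis using True pi_gt_zero by (auto simp: c_def)
  next
    case False
    then have "G \<le> 4 * m" using G by auto
    then have "real G \<le> real (4 * m)" by (rule of_nat_mono)
    then have "pi * real G \<le> pi * (4 * real m)" by (intro mult_left_mono) auto
    then have "lo \<ge> pi / 2" using G0 by (simp add: lo_def le_divide_eq mult_ac)
    moreover have "real (m + 1) \<le> real G" using G by (intro of_nat_mono) simp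
    then have "2 * pi * real (m + 1) \<le> 2 * pi * real G" by (intro mult_left_mono) auto
    then have "hi \<le> 2 * pi" using G0 by (simp add: hi_def divide_le_eq)
    ultimately show ?thesis using False pi_gt_zero by (auto simp: c_def)
  qed
  have rm: "rand_map (dg (rate j)) t \<in> cell_maps G m j" if t: "t \<in> {c - hi..c - lo}" for t
  proof -
    have "c - t \<in> cell G m" using t by (auto simp: cell_def hi_def lo_def)
    moreover have "stp (rate j) t 0 = stp (rate j) (pi / 2 - (c - t)) 0"
    proof -
      have "pi / 2 - (c - t) = t \<or> pi / 2 - (c - t) = t - 2 * pi" by (simp add: c_def)
      moreover have "Rot (t - 2 * pi) = Rot t" by (simp add: Rot_def cos_diff sin_diff)
      ultimately show ?thesis unfolding stp_def by metis
    qed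
    ultimately show ?thesis
      using rand_map_in_C1_SL2[OF det_dg_rate, of j t]
      by (auto simp: cell_maps_def space_C1_borel rand_map_def stp_def)
  qed
  have "ennreal (1 / G) = emeasure unif {c - hi..c - lo}"
  proof -
    have "J \<inter> {c - hi..c - lo} = {c - hi..c - lo}" using sub by auto
    moreover have "lo \<le> hi" using hl G0 pi_gt_zero by (smt (verit) divide_nonneg_pos)
    then have "emeasure lborel {c - hi..c - lo} = ennreal (2 * pi / G)"
      by (subst emeasure_lborel_Icc) (use hl in \<open>simp_all\<close>)
    moreover have "emeasure lborel J = ennreal (2 * pi)" by simp
    ultimately have "emeasure unif {c - hi..c - lo} = ennreal (2 * pi / G) / ennreal (2 * pi)"
      by (subst emeasure_uniform_measure) (simp_all only: sets_lborel atLeastAtMost_borel)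
    also have "\<dots> = ennreal (2 * pi / G / (2 * pi))" using G0 by (subst divide_ennreal) auto
    finally show ?thesis by simp
  qed
  also have "\<dots> \<le> emeasure unif (rand_map (dg (rate j)) -` cell_maps G m j \<inter> space unif)"
    using rm measurable_sets[OF rand_map_measurable_unif[OF det_dg_rate] cell_maps_sets]
    by (intro emeasure_mono) auto
  also have "\<dots> = emeasure (law (dg (rate j))) (cell_maps G m j)"
    unfolding law_def by (subst emeasure_distr[OF rand_map_measurable_unif[OF det_dg_rate] cell_maps_sets]) simp
  also have "\<dots> = emeasure M (A j -` cell_maps G m j \<inter> space M)"
    unfolding law_A[OF j, symmetric] by (subst emeasure_distr[OF measurable_A[OF j] cell_maps_sets]) simp
  finally show ?thesis by (simp add: emeasure_eq_measure)
qed

definition has_run :: "nat \<Rightarrow> 'w \<Rightarrow> nat \<Rightarrow> bool" where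
  "has_run i \<omega> m \<longleftrightarrow> (\<exists>t<runs i. \<forall>u<4 * cells i.
      A (run_start i t + 2 * u + 2) \<omega> \<in> cell_maps (cells i) m (run_start i t + 2 * u + 2))"

text \<open>The small parameter interval in which a run will be needed is not known in advance, so
  the failures over all cells are summed before Borel-Cantelli is applied.\<close>

lemma AE_has_run: "AE \<omega> in M. \<forall>\<^sub>F i in sequentially. \<forall>m<cells i. has_run i \<omega> m"
proof -
  define E where "E = (\<lambda>i. \<Union>m<cells i. {\<omega> \<in> space M. \<not> has_run i \<omega> m})"
  have *: "{\<omega> \<in> space M. \<not> has_run i \<omega> m} \<in> events \<and>
    prob {\<omega> \<in> space M. \<not> has_run i \<omega> m} \<le> (1 - (1 / cells i) ^ (4 * cells i)) ^ runs i"
    if m: "m < cells i" for i m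
  proof -
    define D where "D = (\<lambda>t. (\<lambda>u. run_start i t + 2 * u + 2) ` {..<4 * cells i})"
    have G: "4 dvd cells i" "1 \<le> cells i" using cells_ge(1)[of i] by (auto simp: cells_def)
    have eq: "{\<omega> \<in> space M. \<not> has_run i \<omega> m} = {\<omega> \<in> space M. \<forall>t<runs i. \<exists>j\<in>D t. A j \<omega> \<notin> cell_maps (cells i) m j}"
      unfolding has_run_def D_def by auto
    have disj: "disjoint_family D"
      unfolding disjoint_family_on_def
    proof (intro ballI impI)
      have "D t \<inter> D t' = {}" if "t < t'" for t t'
      proof -
        have "8 * cells i * (t + 1) \<le> 8 * cells i * t'" using that by (intro mult_left_mono) auto
        then show ?thesis by (auto simp: D_def run_start_def)
      qed
      then show "D t \<inter> D t' = {}" if "t \<noteq> t'" for t t'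
        using that by (metis Int_commute linorder_neqE_nat)
    qed
    have card: "card (D t) = 4 * cells i" for t
      unfolding D_def by (subst card_image) (auto simp: inj_on_def)
    have 1: "0 \<le> 1 / real (cells i)" "1 / real (cells i) \<le> 1" using G by auto
    show ?thesis
      unfolding eq
      by (intro conjI no_run_prob[where r = "1 / cells i" and K = "4 * cells i"] cell_maps_sets cell_maps_prob G m disj card 1)
        (auto simp: D_def)
  qed
  have Em: "E i \<in> events" for i unfolding E_def using * by (intro sets.finite_UN) auto
  have bound: "prob (E i) \<le> (1 / 2) ^ i * 4" for i
  proof -
    have "prob (E i) \<le> (\<Sum>m<cells i. prob {\<omega> \<in> space M. \<not> has_run i \<omega> m})"
      unfolding E_def using * by (intro finite_measure_subadditive_finite) auto
    also have "\<dots> \<le> (\<Sum>m<cells i. (1 - (1 / cells i) ^ (4 * cells i)) ^ runs i)"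
      using * by (intro sum_mono) auto
    also have "\<dots> \<le> (1 / 2) ^ i * 4" using cells_exp_le[of i] by simp
    finally show ?thesis .
  qed
  have "summable (\<lambda>i. prob (E i))"
  proof (rule summable_comparison_test')
    show "summable (\<lambda>i. (1 / 2) ^ i * 4 :: real)" by (intro summable_mult2 summable_geometric) simp
    show "norm (prob (E i)) \<le> (1 / 2) ^ i * 4" if "0 \<le> i" for i
      unfolding real_norm_def abs_of_nonneg[OF measure_nonneg] by (rule bound)
  qed
  then have "AE \<omega> in M. \<forall>\<^sub>F i in sequentially. \<omega> \<in> space M - E i"
    by (intro borel_cantelli_AE1 Em) (auto simp: emeasure_eq_measure)
  then show ?thesis
  proof eventually_elim
    case (elim \<omega>)
    then show ?case by (rule eventually_mono) (use E_def in blast)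
  qed
qed

text \<open>At the parameter 0, \<open>cp\<close> of a step is a positive number times
  \<open>cis\<close> of its angle, so the angle is recovered modulo \<open>2 * pi\<close>.\<close>

lemma cell_maps_cis:
  assumes "A j \<omega> \<in> cell_maps G m j" "A j \<omega> 0 = stp (rate j) t 0"
  shows "\<exists>b\<in>cell G m. cis t = cis (pi / 2 - b)"
proof -
  obtain b where b: "b \<in> cell G m" "stp (rate j) t 0 = stp (rate j) (pi / 2 - b) 0"
  proof -
    from assms(1) have "A j \<omega> 0 \<in> (\<lambda>b. stp (rate j) (pi / 2 - b) 0) ` cell G m"
      unfolding cell_maps_def by blast
    then show ?thesis unfolding assms(2) using that by blast
  qed
  have "of_real (dgp (rate j)) * cis t = of_real (dgp (rate j)) * cis (pi / 2 - b)"
    using arg_cong[OF b(2), of cp] unfolding cp_stp by (simp only: add_0)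
  then have "cis t = cis (pi / 2 - b)" using dgp_dgq(2)[OF rate_ge, of j] by auto
  then show ?thesis using b(1) by blast
qed

end

section \<open>Parameters with a cancellation in every window\<close>

lemma rate_le: "rate j \<le> 100" by (simp add: rate_def)

lemma rate_window: "nseq i < j \<Longrightarrow> j \<le> 2 * nseq i \<Longrightarrow> rate j = 100"
  by (auto simp: rate_def)

lemma rate_outside:
  assumes "2 * nseq i < j" "j \<le> nseq (Suc i)"
  shows "rate j = 2"
proof -
  have "\<not> (nseq k < j \<and> j \<le> 2 * nseq k)" for k
  proof (cases "k \<le> i")
    case True
    then have "nseq k \<le> nseq i" using strict_mono_nseq by (simp add: strict_mono_less_eq)
    then show ?thesis using assms by linarith
  next
    case False
    then have "nseq (Suc i) \<le> nseq k" using strict_mono_nseq by (simp add: strict_mono_less_eq)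
    then show ?thesis using assms by linarith
  qed
  then show ?thesis by (simp add: rate_def)
qed

lemma opn_blk_rate: "opn (blk rate \<alpha> k m a) \<le> 100 ^ m"
proof -
  have "opn (blk rate \<alpha> k m a) \<le> (\<Prod>j\<in>{k<..k + m}. rate j)" by (rule opn_blk[OF rate_ge])
  also have "\<dots> \<le> (\<Prod>j\<in>{k<..k + m}. 100)"
    using rate_ge by (intro prod_mono) (auto intro: rate_le order_trans[OF zero_le_one])
  finally show ?thesis by simp
qed

text \<open>The left-hand side is the operator norm of the difference. Changing the parameter in a
  single one of the \<open>m\<close> steps costs at most
  \<open>S ^ m * \<bar>a - a'\<bar>\<close>.\<close>

lemma blk_lipschitz:
  assumes s: "\<And>j. 1 \<le> s j" "\<And>j. s j \<le> S"
  shows "cmod (cp (blk s \<alpha> k m a) - cp (blk s \<alpha> k m a')) + cmod (cq (blk s \<alpha> k m a) - cq (blk s \<alpha> k m a'))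
    \<le> m * S ^ m * \<bar>a - a'\<bar>"
proof (induction m)
  case (Suc m)
  define \<sigma> \<beta> where "\<sigma> = s (Suc (k + m))" and "\<beta> = \<alpha> (Suc (k + m))"
  have \<sigma>: "1 \<le> \<sigma>" "\<sigma> \<le> S" using s by (auto simp: \<sigma>_def)
  define x x' y y' where "x = of_real (dgp \<sigma>) * cis (a + \<beta>)" and "x' = of_real (dgp \<sigma>) * cis (a' + \<beta>)"
    and "y = of_real (dgq \<sigma>) * cis (a - \<beta>)" and "y' = of_real (dgq \<sigma>) * cis (a' - \<beta>)"
  define p p' q q' where "p = cp (blk s \<alpha> k m a)" and "p' = cp (blk s \<alpha> k m a')"
    and "q = cq (blk s \<alpha> k m a)" and "q' = cq (blk s \<alpha> k m a')"
  have cis: "cmod (cis t - cis t') \<le> \<bar>t - t'\<bar>" for t t'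
  proof -
    have "cmod (cis t - cis t') = cmod (exp (\<i> * of_real (t - t')) - 1)"
    proof -
      have "cis t - cis t' = cis t' * (exp (\<i> * of_real (t - t')) - 1)"
        unfolding cis_conv_exp[symmetric] by (simp add: right_diff_distrib cis_mult)
      then show ?thesis by (simp add: norm_mult)
    qed
    also have "\<dots> = 2 * \<bar>sin ((t - t') / 2)\<bar>" using dist_exp_i_1[of "t - t'"] by (simp add: dist_norm)
    also have "\<dots> \<le> 2 * \<bar>(t - t') / 2\<bar>" by (intro mult_left_mono abs_sin_x_le_abs_x) auto
    finally show ?thesis by simp
  qed
  note g = dgp_dgq[OF \<sigma>(1)]
  have x: "cmod x = dgp \<sigma>" "cmod y = dgq \<sigma>" using g by (auto simp: x_def y_def norm_mult)
  have dx: "cmod (x - x') \<le> dgp \<sigma> * \<bar>a - a'\<bar>"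
    using g cis[of "a + \<beta>" "a' + \<beta>"] unfolding x_def x'_def right_diff_distrib[symmetric] norm_mult
    by (auto intro!: mult_left_mono)
  have dy: "cmod (y - y') \<le> dgq \<sigma> * \<bar>a - a'\<bar>"
    using g cis[of "a - \<beta>" "a' - \<beta>"] unfolding y_def y'_def right_diff_distrib[symmetric] norm_mult
    by (auto intro!: mult_left_mono)
  have opn': "cmod p' + cmod q' \<le> S ^ m"
  proof -
    have "opn (blk s \<alpha> k m a') \<le> (\<Prod>j\<in>{k<..k + m}. s j)" by (rule opn_blk[OF s(1)])
    also have "\<dots> \<le> (\<Prod>j\<in>{k<..k + m}. S)"
      using s by (intro prod_mono) (auto intro: order_trans[OF zero_le_one])
    finally show ?thesis by (simp add: opn_def p'_def q'_def)
  qed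
  have "cp (blk s \<alpha> k (Suc m) a) - cp (blk s \<alpha> k (Suc m) a') =
      (x * (p - p') + y * cnj (q - q')) + ((x - x') * p' + (y - y') * cnj q')"
    by (simp add: cp_mult cp_stp cq_stp x_def y_def p_def q_def x'_def y'_def p'_def q'_def \<sigma>_def \<beta>_def algebra_simps)
  moreover have "cmod \<dots> \<le> (cmod (x * (p - p')) + cmod (y * cnj (q - q'))) + (cmod ((x - x') * p') + cmod ((y - y') * cnj q'))"
    by (rule order_trans[OF norm_triangle_ineq add_mono[OF norm_triangle_ineq norm_triangle_ineq]])
  ultimately have 1: "cmod (cp (blk s \<alpha> k (Suc m) a) - cp (blk s \<alpha> k (Suc m) a')) \<le>
      cmod x * cmod (p - p') + cmod y * cmod (q - q') + (cmod (x - x') * cmod p' + cmod (y - y') * cmod q')"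
    by (simp only: norm_mult complex_mod_cnj)
  have "cq (blk s \<alpha> k (Suc m) a) - cq (blk s \<alpha> k (Suc m) a') =
      (x * (q - q') + y * cnj (p - p')) + ((x - x') * q' + (y - y') * cnj p')"
    by (simp add: cq_mult cp_stp cq_stp x_def y_def p_def q_def x'_def y'_def p'_def q'_def \<sigma>_def \<beta>_def algebra_simps)
  moreover have "cmod \<dots> \<le> (cmod (x * (q - q')) + cmod (y * cnj (p - p'))) + (cmod ((x - x') * q') + cmod ((y - y') * cnj p'))"
    by (rule order_trans[OF norm_triangle_ineq add_mono[OF norm_triangle_ineq norm_triangle_ineq]])
  ultimately have 2: "cmod (cq (blk s \<alpha> k (Suc m) a) - cq (blk s \<alpha> k (Suc m) a')) \<le>
      cmod x * cmod (q - q') + cmod y * cmod (p - p') + (cmod (x - x') * cmod q' + cmod (y - y') * cmod p')"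
    by (simp only: norm_mult complex_mod_cnj)
  have "cmod (cp (blk s \<alpha> k (Suc m) a) - cp (blk s \<alpha> k (Suc m) a')) + cmod (cq (blk s \<alpha> k (Suc m) a) - cq (blk s \<alpha> k (Suc m) a'))
     \<le> (cmod x + cmod y) * (cmod (p - p') + cmod (q - q')) + (cmod (x - x') + cmod (y - y')) * (cmod p' + cmod q')"
    using add_mono[OF 1 2] by (simp add: algebra_simps)
  also have "\<dots> \<le> S * (m * S ^ m * \<bar>a - a'\<bar>) + (S * \<bar>a - a'\<bar>) * S ^ m"
  proof (intro add_mono mult_mono)
    show "cmod x + cmod y \<le> S" using x g \<sigma> by simp
    show "cmod (p - p') + cmod (q - q') \<le> m * S ^ m * \<bar>a - a'\<bar>" using Suc by (simp add: p_def p'_def q_def q'_def)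
    have "cmod (x - x') + cmod (y - y') \<le> (dgp \<sigma> + dgq \<sigma>) * \<bar>a - a'\<bar>" using dx dy by (simp add: distrib_right)
    also have "\<dots> \<le> S * \<bar>a - a'\<bar>" using g \<sigma> by (intro mult_right_mono) auto
    finally show "cmod (x - x') + cmod (y - y') \<le> S * \<bar>a - a'\<bar>" .
    show "cmod p' + cmod q' \<le> S ^ m" by (rule opn')
  qed (use \<sigma> in auto)
  also have "\<dots> = Suc m * S ^ Suc m * \<bar>a - a'\<bar>" by (simp add: algebra_simps)
  finally show ?case .
qed simp

definition radius :: "nat \<Rightarrow> real" where "radius i = 1 / 10 ^ (70 * unit_len i)"

text \<open>The factor 5 exceeds the 2 obtained at a single parameter, so that the property survives
  on a whole interval of length \<open>radius i\<close>.\<close>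

definition cancelled :: "(nat \<Rightarrow> real) \<Rightarrow> nat \<Rightarrow> real \<Rightarrow> bool" where
  "cancelled \<alpha> i a \<longleftrightarrow> opn (blk rate \<alpha> (nseq i) (60 * unit_len i) a)
    \<le> 5 * real (nseq i) * (real (nseq i) + 1) * 100 ^ (31 * unit_len i)"

definition good_runs :: "(nat \<Rightarrow> real) \<Rightarrow> nat \<Rightarrow> bool" where
  "good_runs \<alpha> i \<longleftrightarrow> (\<forall>m<cells i. \<exists>t<runs i. \<forall>u<4 * cells i.
     \<exists>b\<in>cell (cells i) m. cis (\<alpha> (run_start i t + 2 * u + 2)) = cis (pi / 2 - b))"

lemma radius_pos: "radius i > 0" by (simp add: radius_def)

lemma radius_Suc_le: "radius (Suc i) \<le> radius i"
proof -
  have "unit_len i \<le> unit_len (Suc i)" using nseq_unit_len[of i] nseq_unit_len[of "Suc i"] nseq_Suc_gt[of i] by linarith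
  then have "(10::real) ^ (70 * unit_len i) \<le> 10 ^ (70 * unit_len (Suc i))" by (intro power_increasing) auto
  then show ?thesis unfolding radius_def by (intro divide_left_mono) auto
qed

lemma cells_radius: "cells i * radius i = 16"
  by (simp add: cells_def radius_def)

text \<open>A cell has length \<open>2 * pi / G\<close>, so \<open>4 * G\<close> pairs give the
  turning \<open>8 * pi\<close> that \<open>cancellation\<close> asks for. The run begins between
  \<open>30 * l\<close> and \<open>31 * l\<close> steps into the window, so both outer blocks have
  norm at most \<open>100 ^ (31 * l)\<close>; \<open>n\<close> serves as \<open>Q0\<close>.\<close>

lemma cell_cancelled:
  assumes good: "good_runs \<alpha> i" and m: "m < cells i"
  shows "\<exists>a\<in>cell (cells i) m. opn (blk rate \<alpha> (nseq (Suc i)) (60 * unit_len (Suc i)) a)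
    \<le> 2 * real (nseq (Suc i)) * (real (nseq (Suc i)) + 1) * 100 ^ (31 * unit_len (Suc i))"
proof -
  define n l G where "n = nseq (Suc i)" and "l = unit_len (Suc i)" and "G = cells i"
  have n: "n = 100 * l" using nseq_unit_len by (simp add: n_def l_def)
  have G: "G \<ge> 10000" using cells_ge by (simp add: G_def)
  from good m obtain t where t: "t < runs i"
    "\<And>u. u < 4 * G \<Longrightarrow> \<exists>b\<in>cell G m. cis (\<alpha> (run_start i t + 2 * u + 2)) = cis (pi / 2 - b)"
    unfolding good_runs_def G_def by blast
  have tl: "8 * G * (t + 1) \<le> l"
  proof -
    have "t + 1 \<le> l div (8 * G)" using t(1) by (simp add: runs_def l_def G_def)
    then have "8 * G * (t + 1) \<le> 8 * G * (l div (8 * G))" by (intro mult_left_mono) auto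
    also have "\<dots> \<le> l" by simp
    finally show ?thesis .
  qed
  define mB mC where "mB = 30 * l + 8 * G * t" and "mC = 60 * l - (mB + 8 * G)"
  have mBC: "mB + 8 * G \<le> 31 * l" "mB + 8 * G + mC = 60 * l" "mC \<le> 30 * l"
    using tl by (auto simp: mB_def mC_def)
  have start: "run_start i t = n + mB" by (simp add: run_start_def n_def mB_def l_def G_def)
  define lo hi where "lo = 2 * pi * m / G" and "hi = 2 * pi * (m + 1) / G"
  have hl: "hi - lo = 2 * pi / G" using G by (simp add: hi_def lo_def field_simps)
  \<comment> \<open>The run has \<open>8 * G\<close> steps, and
    \<open>100 ^ (8 * G) = 10000 ^ (4 * G)\<close> is at most \<open>G ^ (4 * G)\<close> because
    there are at least 10000 cells.\<close>
  have nQ: "(100::real) ^ (8 * G) \<le> n"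
  proof -
    have "(100::nat) ^ (8 * G) = (100 ^ 2) ^ (4 * G)" by (simp only: power_mult[symmetric]) simp
    also have "\<dots> \<le> G ^ (4 * G)" using G by (intro power_mono) auto
    also have "\<dots> \<le> 100 * G ^ (4 * G + 3)" using G by (intro trans_le_add1 order_trans[OF power_increasing[of "4 * G" "4 * G + 3" G]]) auto
    also have "\<dots> \<le> n" using cells_power_le[of i] by (simp add: n_def G_def)
    finally have "(100::nat) ^ (8 * G) \<le> n" .
    then show ?thesis by (metis of_nat_le_iff of_nat_numeral of_nat_power)
  qed
  have l10: "l \<ge> 10" using unit_len_ge by (simp add: l_def)
  have "\<exists>a\<in>{lo..hi}. opn (blk rate \<alpha> n (mB + 2 * (4 * G) + mC) a) \<le> 2 * real n * (real n + 1) * 100 ^ (31 * l)"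
  proof (rule cancellation[where \<sigma> = 100])
    show "1 \<le> rate j" for j by (rule rate_ge)
    show "rate j = 100" if "j \<in> {n + mB<..n + mB + 2 * (4 * G)}" for j
    proof (rule rate_window)
      show "nseq (Suc i) < j" using that by (simp add: n_def)
      show "j \<le> 2 * nseq (Suc i)" using that mBC(1) n by (simp add: n_def)
    qed
    have "0 < 2 * pi / G" "2 * pi / G < pi" using G pi_gt_zero by (auto simp: divide_less_eq)
    then show "lo < hi" "hi - lo < pi" using hl by auto
    show "\<exists>b\<in>{lo..hi}. cis (\<alpha> (n + mB + 2 * j + 2)) = cis (pi / 2 - b)" if "j < 4 * G" for j
      using t(2)[OF that] unfolding start by (simp add: cell_def lo_def hi_def)
    show "8 * pi \<le> real (4 * G) * (hi - lo)" using G by (simp add: hl)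
    show "1 \<le> real n" using n l10 by simp
    show "real (mB + mC) * (2 * pi) \<le> (real n)\<^sup>2"
    proof -
      have "real (mB + mC) * (2 * pi) \<le> real (60 * l) * (2 * 4)"
        using mBC pi_less_4 by (intro mult_mono) auto
      also have "\<dots> \<le> real (100 * l) * real (100 * l)"
        using l10 by (intro mult_mono) auto
      finally show ?thesis by (simp add: n power2_eq_square)
    qed
    show "opn (blk rate \<alpha> (n + mB) (2 * (4 * G)) a) \<le> real n" for a
      using order_trans[OF opn_blk_rate nQ] by simp
    show "opn (blk rate \<alpha> n mB a) \<le> 100 ^ (31 * l)" for a
      using mBC by (intro order_trans[OF opn_blk_rate] power_increasing) auto
    show "opn (blk rate \<alpha> (n + mB + 2 * (4 * G)) mC a) \<le> 100 ^ (31 * l)" for a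
      using mBC by (intro order_trans[OF opn_blk_rate] power_increasing) auto
  qed
  moreover have "mB + 2 * (4 * G) + mC = 60 * l" using mBC(2) by simp
  ultimately show ?thesis
    unfolding cell_def by (simp only: n_def[symmetric] l_def[symmetric] G_def[symmetric] lo_def hi_def)
qed

text \<open>One stage of the nested intervals: every interval of length \<open>radius i\<close> in
  \<open>J\<close> contains an interval of length \<open>radius (Suc i)\<close> on which the next
  cancellation takes place.\<close>

lemma stage:
  assumes good: "good_runs \<alpha> i" and u: "0 \<le> u" "u + radius i \<le> 2 * pi"
  shows "\<exists>u'\<ge>u. u' + radius (Suc i) \<le> u + radius i \<and> (\<forall>a\<in>{u'..u' + radius (Suc i)}. cancelled \<alpha> (Suc i) a)"
proof -
  define n l G where "n = nseq (Suc i)" and "l = unit_len (Suc i)" and "G = cells i"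
  have G: "real G > 0" using cells_ge(1)[of i] by (simp add: G_def)
  have GR: "G * radius i = 16" using cells_radius by (simp add: G_def)
  \<comment> \<open>The first cell that begins at or after \<open>u\<close>. It ends within two cell
    lengths of \<open>u\<close>, and \<open>cells i * radius i = 16 > 4 * pi\<close> keeps it inside
    the interval.\<close>
  define m where "m = nat \<lceil>u * G / (2 * pi)\<rceil>"
  have m: "u * G / (2 * pi) \<le> real m" "real m < u * G / (2 * pi) + 1"
  proof -
    have "0 \<le> u * G / (2 * pi)" using u G by simp
    then show "u * G / (2 * pi) \<le> real m" "real m < u * G / (2 * pi) + 1"
      unfolding m_def using ceiling_correct[of "u * G / (2 * pi)"] by (auto simp: of_nat_nat)
  qed
  have lo: "u \<le> 2 * pi * m / G" using m(1) G by (simp add: field_simps)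
  have "2 * pi * (real m + 1) < u * G + 4 * pi" using m(2) by (simp add: field_simps)
  also have "\<dots> \<le> u * G + G * radius i" using GR pi_less_4 by simp
  also have "\<dots> = (u + radius i) * G" by (simp add: algebra_simps)
  finally have hi': "2 * pi * (real m + 1) < (u + radius i) * G" .
  then have hi: "2 * pi * (m + 1) / G \<le> u + radius i" using G by (simp add: divide_le_eq add.commute)
  have "(u + radius i) * G \<le> 2 * pi * G" using u G by (intro mult_right_mono) auto
  then have "2 * pi * (real m + 1) < 2 * pi * G" using hi' by linarith
  then have mG: "m < G" by simp
  obtain a0 where a0: "a0 \<in> cell G m"
    "opn (blk rate \<alpha> n (60 * l) a0) \<le> 2 * real n * (real n + 1) * 100 ^ (31 * l)"
    using cell_cancelled[OF good, of m] mG unfolding n_def l_def G_def by blast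
  have a0u: "u \<le> a0" "a0 \<le> u + radius i" using a0(1) lo hi by (auto simp: cell_def)
  define r where "r = radius (Suc i)"
  \<comment> \<open>The minimum keeps the new interval inside the old one; \<open>a0\<close> belongs
    to it in either case.\<close>
  define u' where "u' = min a0 (u + radius i - r)"
  have r: "r \<le> radius i" using radius_Suc_le by (simp add: r_def)
  have "u \<le> u'" "u' + r \<le> u + radius i" using a0u r by (auto simp: u'_def)
  moreover have "cancelled \<alpha> (Suc i) a" if a: "a \<in> {u'..u' + r}" for a
  proof -
    have ab: "\<bar>a - a0\<bar> \<le> r" using a a0u by (auto simp: u'_def min_def split: if_splits)
    let ?b = "blk rate \<alpha> n (60 * l)"
    have "opn (?b a) \<le> opn (?b a0) + (cmod (cp (?b a) - cp (?b a0)) + cmod (cq (?b a) - cq (?b a0)))"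
      unfolding opn_def using norm_triangle_sub[of "cp (?b a)" "cp (?b a0)"] norm_triangle_sub[of "cq (?b a)" "cq (?b a0)"] by linarith
    also have "\<dots> \<le> 2 * real n * (real n + 1) * 100 ^ (31 * l) + real (60 * l) * 100 ^ (60 * l) * \<bar>a - a0\<bar>"
      by (intro add_mono a0(2) blk_lipschitz rate_ge rate_le)
    also have "real (60 * l) * 100 ^ (60 * l) * \<bar>a - a0\<bar> \<le> real (60 * l) * 100 ^ (60 * l) * r"
      using ab by (intro mult_left_mono) auto
    \<comment> \<open>Origin of the exponent 70 in \<open>radius\<close>: the Lipschitz constant is
      at most \<open>10 ^ (12 * l + 120 * l)\<close>, and \<open>132 - 70 = 62\<close> is the
      exponent of \<open>100 ^ (31 * l)\<close> in base 10.\<close>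
    also have "\<dots> \<le> 100 ^ (31 * l)"
    proof -
      have "60 * l \<le> 10 ^ (12 * l)"
      proof -
        have "60 * l \<le> 10 ^ 2 * 10 ^ l" using less_power_10[of l] by simp
        also have "\<dots> = 10 ^ (2 + l)" by (simp only: power_add)
        also have "\<dots> \<le> (10::nat) ^ (12 * l)" using unit_len_ge[of "Suc i"] by (intro power_increasing) (auto simp: l_def)
        finally show ?thesis .
      qed
      then have "real (60 * l) \<le> 10 ^ (12 * l)" by (metis of_nat_le_iff of_nat_numeral of_nat_power)
      then have "real (60 * l) * 10 ^ (120 * l) \<le> 10 ^ (12 * l) * 10 ^ (120 * l)" by (intro mult_right_mono) auto
      also have "\<dots> = 10 ^ (62 * l) * (10::real) ^ (70 * l)" by (simp only: power_add[symmetric]) simp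
      finally have "real (60 * l) * 10 ^ (120 * l) / 10 ^ (70 * l) \<le> 10 ^ (62 * l)" by (simp add: divide_le_eq)
      moreover have "(100::real) ^ (k * l) = 10 ^ (2 * k * l)" for k
      proof -
        have "(100::real) = 10 ^ 2" by simp
        then show ?thesis by (metis power_mult mult.assoc)
      qed
      from this[of 60] this[of 31] have "(100::real) ^ (60 * l) = 10 ^ (120 * l)" "(100::real) ^ (31 * l) = 10 ^ (62 * l)"
        by simp_all
      ultimately show ?thesis by (simp add: r_def radius_def l_def)
    qed
    also have "2 * real n * (real n + 1) * 100 ^ (31 * l) + 100 ^ (31 * l) \<le> 5 * real n * (real n + 1) * 100 ^ (31 * l)"
    proof -
      have "1 \<le> real n" using nseq_ge[of "Suc i"] by (simp add: n_def)
      then have "1 * 1 \<le> real n * (real n + 1)" by (intro mult_mono) auto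
      then have "2 * (real n * (real n + 1)) + 1 \<le> 5 * (real n * (real n + 1))" by argo
      then have "(2 * (real n * (real n + 1)) + 1) * 100 ^ (31 * l) \<le> (5 * (real n * (real n + 1))) * 100 ^ (31 * l)"
        by (intro mult_right_mono) auto
      then show ?thesis by (simp add: distrib_right mult_ac)
    qed
    finally show ?thesis by (simp add: cancelled_def n_def l_def)
  qed
  ultimately show ?thesis unfolding r_def by blast
qed

section \<open>Deterministic bounds between consecutive windows\<close>

lemma ln_100_le: "ln (100::real) \<le> 20 / 3 * ln 2"
proof -
  have "3 * ln (100::real) = ln (100 ^ 3)" by (subst ln_realpow) auto
  also have "\<dots> \<le> ln (2 ^ 20)" by (subst ln_le_cancel_iff) auto
  also have "\<dots> = 20 * ln 2" by (subst ln_realpow) auto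
  finally show ?thesis by simp
qed

definition logn :: "(nat \<Rightarrow> real) \<Rightarrow> nat \<Rightarrow> real \<Rightarrow> real" where
  "logn \<alpha> t a = ln (opn (blk rate \<alpha> 0 t a))"

lemma opn_blk_ge: "1 \<le> opn (blk rate \<alpha> k m a)"
  by (rule det_one_cmod(6)[OF det_blk[OF rate_ge]])

lemma logn_le_add:
  assumes "opn (blk rate \<alpha> t k a) \<le> c"
  shows "logn \<alpha> (t + k) a \<le> logn \<alpha> t a + ln c"
proof -
  have "opn (blk rate \<alpha> 0 (t + k) a) \<le> opn (blk rate \<alpha> t k a) * opn (blk rate \<alpha> 0 t a)"
    using opn_mult[of "blk rate \<alpha> t k a" "blk rate \<alpha> 0 t a"] by (simp add: blk_add)
  also have "\<dots> \<le> c * opn (blk rate \<alpha> 0 t a)" using assms by (intro mult_right_mono opn_nonneg)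
  finally have "logn \<alpha> (t + k) a \<le> ln (c * opn (blk rate \<alpha> 0 t a))"
    unfolding logn_def using opn_blk_ge[of \<alpha> 0 "t + k" a] by (subst ln_le_cancel_iff) auto
  also have "\<dots> = ln c + logn \<alpha> t a"
    unfolding logn_def using opn_blk_ge[of \<alpha> t k a] opn_blk_ge[of \<alpha> 0 t a] assms by (subst ln_mult_pos) auto
  finally show ?thesis by simp
qed

lemma logn_fast: "logn \<alpha> (t + k) a \<le> logn \<alpha> t a + k * (20 / 3 * ln 2)"
proof -
  have "ln (100 ^ k) = k * ln (100::real)" by (simp add: ln_realpow)
  also have "\<dots> \<le> k * (20 / 3 * ln 2)" using ln_100_le by (intro mult_left_mono) auto
  finally show ?thesis using logn_le_add[OF opn_blk_rate, of \<alpha> t k a] by linarith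
qed

text \<open>Going back in time also costs at most the norms of the steps. Thus a cancellation at a
  later time bounds the norm before that time too.\<close>

lemma logn_back: "logn \<alpha> t a \<le> logn \<alpha> (t + k) a + k * (20 / 3 * ln 2)"
proof -
  have "opn (blk rate \<alpha> 0 t a) \<le> opn (blk rate \<alpha> t k a) * opn (blk rate \<alpha> 0 (t + k) a)"
    using opn_le_mult[where A = "blk rate \<alpha> t k a" and B = "blk rate \<alpha> 0 t a", OF det_blk[OF rate_ge]] by (simp add: blk_add)
  also have "\<dots> \<le> 100 ^ k * opn (blk rate \<alpha> 0 (t + k) a)" by (intro mult_right_mono opn_nonneg opn_blk_rate)
  finally have "logn \<alpha> t a \<le> ln (100 ^ k * opn (blk rate \<alpha> 0 (t + k) a))"
    unfolding logn_def using opn_blk_ge[of \<alpha> 0 t a] by (subst ln_le_cancel_iff) auto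
  also have "\<dots> = k * ln 100 + logn \<alpha> (t + k) a"
    unfolding logn_def using opn_blk_ge[of \<alpha> 0 "t + k" a] by (subst ln_mult_pos) (auto simp: ln_realpow)
  also have "k * ln (100::real) \<le> k * (20 / 3 * ln 2)" using ln_100_le by (intro mult_left_mono) auto
  finally show ?thesis by simp
qed

lemma logn_slow:
  assumes "2 * nseq i \<le> t" "t + k \<le> nseq (Suc i)"
  shows "logn \<alpha> (t + k) a \<le> logn \<alpha> t a + k * ln 2"
proof -
  have "opn (blk rate \<alpha> t k a) \<le> (\<Prod>j\<in>{t<..t + k}. rate j)" by (rule opn_blk[OF rate_ge])
  also have "\<dots> = (\<Prod>j\<in>{t<..t + k}. 2)"
    using assms by (intro prod.cong refl rate_outside[of i]) auto
  finally have "opn (blk rate \<alpha> t k a) \<le> 2 ^ k" by simp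
  from logn_le_add[OF this] show ?thesis by (simp add: ln_realpow)
qed

text \<open>In units of \<open>ln 2\<close>, with \<open>n = 100 * l\<close> and the errors
  \<open>E'\<close> at most \<open>5 * l\<close>, three ranges are compared with the slope
  \<open>29 / 10\<close>. Up to \<open>45 * l\<close> steps into the window the trivial bound gives
  \<open>405 \<le> 420.5\<close> (times \<open>l\<close>) at the end of the range. From there to
  \<open>60 * l\<close> the bound after the cancellation is used backwards, at worst about
  \<open>411.7 \<le> 420.5\<close>. Up to the end of the window it is used forwards, at worst about
  \<open>578.4 \<le> 580\<close>. Beyond the window the slope is 1.\<close>

lemma logn_window:
  fixes i :: nat
  defines "n \<equiv> nseq (Suc i)"
  assumes canc: "cancelled \<alpha> (Suc i) a"
    and E: "14 * real (nseq i) + ln (5 * real n * (real n + 1)) / ln 2 \<le> real n / 20"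
    and t: "n < t" "t \<le> nseq (Suc (Suc i))"
  shows "logn \<alpha> t a \<le> 29 / 10 * ln 2 * t"
proof -
  define l where "l = unit_len (Suc i)"
  define E' where "E' = 14 * real (nseq i) + ln (5 * real n * (real n + 1)) / ln 2"
  define h where "h = (\<lambda>t. logn \<alpha> t a / ln 2)"
  have ln2: "ln (2::real) > 0" by simp
  have n: "n = 100 * l" using nseq_unit_len by (simp add: n_def l_def)
  have E'n: "E' \<le> real n / 20" using E by (simp add: E'_def)
  have h_fast: "h (t + k) \<le> h t + 20 / 3 * k" and h_back: "h t \<le> h (t + k) + 20 / 3 * k" for t k
    using logn_fast[of \<alpha> t k a] logn_back[of \<alpha> t a k] ln2 by (auto simp: h_def field_simps)
  have h_slow: "h (t + k) \<le> h t + k" if "2 * nseq i \<le> t" "t + k \<le> nseq (Suc i)" for i t k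
    using logn_slow[OF that, of \<alpha> a] ln2 by (simp add: h_def field_simps)
  have n1: "n \<ge> 1000" using nseq_ge by (simp add: n_def)
  have lnE: "ln (5 * real n * (real n + 1)) / ln 2 \<ge> 0"   proof (intro divide_nonneg_pos ln_ge_zero)
    have "1 * 1 \<le> 5 * real n * (real n + 1)" using n1 by (intro mult_mono) auto
    then show "1 \<le> 5 * real n * (real n + 1)" by simp
  qed simp
  have h0: "h 0 = 0" by (simp add: h_def logn_def)
  have "h (0 + 2 * nseq i) \<le> h 0 + 20 / 3 * real (2 * nseq i)" by (rule h_fast)
  then have 1: "h (2 * nseq i) \<le> 40 / 3 * nseq i" by (simp add: h0)
  have lt: "2 * nseq i \<le> n" using nseq_Suc_gt[of i] by (simp add: n_def)
  then have "h (2 * nseq i + (n - 2 * nseq i)) \<le> h (2 * nseq i) + real (n - 2 * nseq i)"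
    by (intro h_slow[of i]) (auto simp: n_def)
  \<comment> \<open>The earlier steps cost at most \<open>40 / 3 * nseq i\<close> instead of
    \<open>2 * nseq i\<close>, an excess of \<open>34 / 3 \<le> 12\<close>.\<close>
  then have hn: "h n \<le> real n + 12 * nseq i" using 1 lt by (simp add: of_nat_diff)
  have h16: "h (n + 60 * l) \<le> real n + 31 * l * (20 / 3) + E'"
  proof -
    have "logn \<alpha> (n + 60 * l) a \<le> logn \<alpha> n a + ln (5 * real n * (real n + 1) * 100 ^ (31 * l))"
      using canc unfolding cancelled_def n_def[symmetric] l_def[symmetric] by (rule logn_le_add)
    also have "ln (5 * real n * (real n + 1) * 100 ^ (31 * l)) = ln (5 * real n * (real n + 1)) + 31 * l * ln 100"
      using n1 by (subst ln_mult_pos) (auto simp: ln_realpow)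
    also have "31 * l * ln (100::real) \<le> 31 * l * (20 / 3 * ln 2)" using ln_100_le by (intro mult_left_mono) auto
    finally have "h (n + 60 * l) \<le> h n + ln (5 * real n * (real n + 1)) / ln 2 + 31 * l * (20 / 3)"
      using ln2 by (simp add: h_def field_simps)
    then show ?thesis using hn by (simp add: E'_def)
  qed
  have hn': "h n \<le> real n + E'" using hn lnE by (simp add: E'_def)
  have rn: "real n = 100 * real l" by (simp add: n)
  have goal2: "h (n + k) \<le> 29 / 10 * real (n + k)" if "k \<le> 100 * l" for k
  proof -
    consider "k \<le> 45 * l" | "45 * l < k" "k \<le> 60 * l" | "60 * l < k" by linarith
    then show ?thesis
    proof cases
      case 1
      then have "real k \<le> 45 * real l" by (metis of_nat_le_iff of_nat_mult of_nat_numeral)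
      then show ?thesis using h_fast[of n k] hn' E'n rn by simp
    next
      case 2
      have "h (n + k) \<le> h (n + k + (60 * l - k)) + 20 / 3 * real (60 * l - k)" by (rule h_back)
      also have "n + k + (60 * l - k) = n + 60 * l" using 2 by simp
      also have "real (60 * l - k) = 60 * real l - real k" using 2 by (simp add: of_nat_diff)
      finally have "h (n + k) \<le> h (n + 60 * l) + 20 / 3 * (60 * real l - real k)" .
      moreover have "45 * real l \<le> real k" using 2(1) by (metis less_imp_le of_nat_le_iff of_nat_mult of_nat_numeral)
      ultimately show ?thesis using h16 E'n of_nat_0_le_iff[of l, where 'a = real] unfolding of_nat_add of_nat_mult of_nat_numeral rn by argo
    next
      case 3
      have "h (n + 60 * l + (k - 60 * l)) \<le> h (n + 60 * l) + 20 / 3 * real (k - 60 * l)" by (rule h_fast)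
      also have "n + 60 * l + (k - 60 * l) = n + k" using 3 by simp
      also have "real (k - 60 * l) = real k - 60 * real l" using 3 by (simp add: of_nat_diff)
      finally have "h (n + k) \<le> h (n + 60 * l) + 20 / 3 * (real k - 60 * real l)" .
      moreover have "real k \<le> 100 * real l" using that by (metis of_nat_le_iff of_nat_mult of_nat_numeral)
      ultimately show ?thesis using h16 E'n of_nat_0_le_iff[of l, where 'a = real] unfolding of_nat_add of_nat_mult of_nat_numeral rn by argo
    qed
  qed
  have "h t \<le> 29 / 10 * t"
  proof (cases "t \<le> 2 * n")
    case True
    then show ?thesis using goal2[of "t - n"] t n by simp
  next
    case False
    have "h (2 * n + (t - 2 * n)) \<le> h (2 * n) + real (t - 2 * n)"
      using False t(2) by (intro h_slow[of "Suc i"]) (auto simp: n_def)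
    moreover have "h (2 * n) \<le> 29 / 10 * real (2 * n)" using goal2[of n] n by (simp add: mult_2[symmetric])
    ultimately show ?thesis using False by (simp add: of_nat_diff)
  qed
  then show ?thesis using ln2 by (simp add: h_def field_simps)
qed

lemma filterlim_nseq: "filterlim nseq at_top sequentially"
  using strict_mono_nseq by (rule filterlim_subseq)

lemma eventually_window_error:
  "\<forall>\<^sub>F i in sequentially. 14 * real (nseq i) +
     ln (5 * real (nseq (Suc i)) * (real (nseq (Suc i)) + 1)) / ln 2 \<le> real (nseq (Suc i)) / 20"
proof -
  have "\<forall>\<^sub>F x in at_top. ln (5 * x * (x + 1)) / ln 2 \<le> x / (40::real)" by real_asymp
  moreover have "filterlim (\<lambda>i. real (nseq (Suc i))) at_top sequentially"
    by (intro filterlim_compose[OF filterlim_real_sequentially] filterlim_compose[OF filterlim_nseq filterlim_Suc])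
  ultimately have 1: "\<forall>\<^sub>F i in sequentially. ln (5 * real (nseq (Suc i)) * (real (nseq (Suc i)) + 1)) / ln 2 \<le> real (nseq (Suc i)) / 40"
    by (rule eventually_compose_filterlim)
  have 2: "560 * real (nseq i) \<le> nseq (Suc i)" for i
  proof -
    have "6 * nseq i \<le> cells i * cells i" using cells_ge[of i] by (intro mult_mono) auto
    also have "\<dots> = cells i ^ 2" by (simp add: power2_eq_square)
    also have "\<dots> \<le> cells i ^ (4 * cells i + 3)" using cells_ge(1)[of i] by (intro power_increasing) auto
    finally have "560 * nseq i \<le> 100 * cells i ^ (4 * cells i + 3)" by linarith
    also have "\<dots> \<le> nseq (Suc i)" by (rule cells_power_le)
    finally have "real (560 * nseq i) \<le> real (nseq (Suc i))" by (rule of_nat_mono)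
    then show ?thesis by simp
  qed
  show ?thesis using 1
  proof eventually_elim
    case (elim i)
    then show ?case using 2[of i] by linarith
  qed
qed

lemma eventually_logn_le:
  assumes "\<forall>\<^sub>F i in sequentially. cancelled \<alpha> (Suc i) a"
  shows "\<forall>\<^sub>F t in sequentially. logn \<alpha> t a \<le> 29 / 10 * ln 2 * t"
proof -
  from eventually_conj[OF assms eventually_window_error] obtain i0 where
    i0: "\<And>i. i \<ge> i0 \<Longrightarrow> cancelled \<alpha> (Suc i) a"
      "\<And>i. i \<ge> i0 \<Longrightarrow> 14 * real (nseq i) + ln (5 * real (nseq (Suc i)) * (real (nseq (Suc i)) + 1)) / ln 2 \<le> real (nseq (Suc i)) / 20"
    unfolding eventually_sequentially by blast
  show ?thesis
    unfolding eventually_sequentially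
  proof (intro exI allI impI)
    fix t assume t: "nseq (Suc i0) + 1 \<le> t"
    define k where "k = (LEAST k. t \<le> nseq k)"
    have ex: "t \<le> nseq t" using strict_mono_imp_increasing[OF strict_mono_nseq] by simp
    have k: "t \<le> nseq k" unfolding k_def by (rule LeastI[of "\<lambda>k. t \<le> nseq k", OF ex])
    have kmin: "nseq j < t" if "j < k" for j using not_less_Least[of j "\<lambda>k. t \<le> nseq k"] that by (simp add: k_def)
    have "nseq (Suc i0) < nseq k" using t k by linarith
    then have "Suc i0 < k" using strict_mono_nseq by (simp add: strict_mono_less)
    \<comment> \<open>\<open>logn_window\<close> for the index \<open>i\<close> treats the times
      between \<open>nseq (Suc i)\<close> and \<open>nseq (Suc (Suc i))\<close>, hence the shift by
      2.\<close>
    define i where "i = k - 2"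
    have i: "k = Suc (Suc i)" "i0 \<le> i" using \<open>Suc i0 < k\<close> by (auto simp: i_def)
    show "logn \<alpha> t a \<le> 29 / 10 * ln 2 * t"
    proof (rule logn_window[OF i0(1)[OF i(2)] i0(2)[OF i(2)]])
      show "nseq (Suc i) < t" by (rule kmin) (simp add: i(1))
      show "t \<le> nseq (Suc (Suc i))" using k unfolding i(1) .
    qed
  qed
qed

text \<open>Starting from an interval around \<open>x\<close> at a late stage, \<open>stage\<close>
  is iterated; the supremum of the left endpoints lies in all the intervals, so every later
  cancellation holds there.\<close>

lemma dense_cancelled:
  assumes good: "\<forall>\<^sub>F i in sequentially. good_runs \<alpha> i"
  shows "J \<subseteq> closure {a \<in> J. \<forall>\<^sub>F i in sequentially. cancelled \<alpha> (Suc i) a}"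
proof
  fix x assume x: "x \<in> J"
  show "x \<in> closure {a \<in> J. \<forall>\<^sub>F i in sequentially. cancelled \<alpha> (Suc i) a}"
    unfolding closure_approachable
  proof (intro allI impI)
    fix e :: real assume e: "e > 0"
    have "radius \<longlonglongrightarrow> 0"
    proof (rule tendsto_sandwich[of "\<lambda>_. 0" radius sequentially "\<lambda>i. (1 / 2) ^ i"])
      have "radius i \<le> (1 / 2) ^ i" for i
      proof -
        have "2 ^ i \<le> (10::nat) ^ (70 * unit_len i)"
          using nseq_ge_power[of i] nseq_le_power[of i] by (rule order_trans)
        then have "real (2 ^ i) \<le> real (10 ^ (70 * unit_len i))" by (rule of_nat_mono)
        then have "1 / (10::real) ^ (70 * unit_len i) \<le> 1 / 2 ^ i" by (intro divide_left_mono) auto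
        then show ?thesis by (simp add: radius_def power_one_over)
      qed
      then show "\<forall>\<^sub>F i in sequentially. radius i \<le> (1 / 2) ^ i" by simp
      show "\<forall>\<^sub>F i in sequentially. 0 \<le> radius i" using radius_pos by (simp add: less_imp_le)
      show "(\<lambda>i. (1 / 2 :: real) ^ i) \<longlonglongrightarrow> 0" by (rule LIMSEQ_realpow_zero) auto
    qed auto
    then have "\<forall>\<^sub>F i in sequentially. radius i < min e (2 * pi)"
      by (rule order_tendstoD(2)) (use e in auto)
    from eventually_conj[OF good this] obtain i0 where
      "\<And>i. i \<ge> i0 \<Longrightarrow> good_runs \<alpha> i \<and> radius i < min e (2 * pi)"
      unfolding eventually_sequentially by blast
    then have i0: "\<And>i. i \<ge> i0 \<Longrightarrow> good_runs \<alpha> i" "radius i0 < e" "radius i0 < 2 * pi"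
      by auto
    \<comment> \<open>The minimum keeps the first interval inside \<open>J\<close> when
      \<open>x\<close> is close to the right endpoint; \<open>x\<close> belongs to it in either
      case.\<close>
    define u0 where "u0 = min x (2 * pi - radius i0)"
    have u0: "0 \<le> u0" "u0 + radius i0 \<le> 2 * pi" "u0 \<le> x" "x \<le> u0 + radius i0"
      using x i0(3) less_imp_le[OF radius_pos[of i0]] by (auto simp: u0_def)
    have "\<exists>u. u 0 = u0 \<and> (\<forall>k. (0 \<le> u k \<and> u k + radius (i0 + k) \<le> 2 * pi) \<and>
       (u k \<le> u (Suc k) \<and> u (Suc k) + radius (i0 + Suc k) \<le> u k + radius (i0 + k) \<and>
       (\<forall>a\<in>{u (Suc k)..u (Suc k) + radius (i0 + Suc k)}. cancelled \<alpha> (Suc (i0 + k)) a)))"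
    proof -
      \<comment> \<open>The conjunct for \<open>k = 0\<close> is part of the invariant because
        dependent choice does not otherwise fix the first member of the sequence.\<close>
      have "\<exists>f. \<forall>k. (0 \<le> f k \<and> f k + radius (i0 + k) \<le> 2 * pi \<and> (k = 0 \<longrightarrow> f k = u0)) \<and>
       (f k \<le> f (Suc k) \<and> f (Suc k) + radius (i0 + Suc k) \<le> f k + radius (i0 + k) \<and>
       (\<forall>a\<in>{f (Suc k)..f (Suc k) + radius (i0 + Suc k)}. cancelled \<alpha> (Suc (i0 + k)) a))"
      proof (rule dependent_nat_choice)
        show "\<exists>x. 0 \<le> x \<and> x + radius (i0 + 0) \<le> 2 * pi \<and> (0 = (0::nat) \<longrightarrow> x = u0)"
          using u0 by auto
        fix v k assume v: "0 \<le> v \<and> v + radius (i0 + k) \<le> 2 * pi \<and> (k = 0 \<longrightarrow> v = u0)"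
        obtain u' where "u' \<ge> v" "u' + radius (Suc (i0 + k)) \<le> v + radius (i0 + k)"
          "\<forall>a\<in>{u'..u' + radius (Suc (i0 + k))}. cancelled \<alpha> (Suc (i0 + k)) a"
          using stage[OF i0(1)[of "i0 + k"], of v] v by auto
        then show "\<exists>y. (0 \<le> y \<and> y + radius (i0 + Suc k) \<le> 2 * pi \<and> (Suc k = 0 \<longrightarrow> y = u0)) \<and>
          (v \<le> y \<and> y + radius (i0 + Suc k) \<le> v + radius (i0 + k) \<and>
          (\<forall>a\<in>{y..y + radius (i0 + Suc k)}. cancelled \<alpha> (Suc (i0 + k)) a))"
          using v by (intro exI[of _ u']) auto
      qed
      then show ?thesis by blast
    qed
    then obtain u where u: "u 0 = u0" "\<And>k. u k \<le> u (Suc k)"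
      "\<And>k. u (Suc k) + radius (i0 + Suc k) \<le> u k + radius (i0 + k)"
      "\<And>k a. a \<in> {u (Suc k)..u (Suc k) + radius (i0 + Suc k)} \<Longrightarrow> cancelled \<alpha> (Suc (i0 + k)) a"
      by blast
    have inc: "incseq u" using u(2) by (rule incseq_SucI)
    have dec: "decseq (\<lambda>k. u k + radius (i0 + k))" using u(3) by (rule decseq_SucI)
    have ub: "u j \<le> u k + radius (i0 + k)" for j k
    proof -
      have "u j \<le> u (max j k)" using inc by (simp add: incseq_def)
      also have "\<dots> \<le> u (max j k) + radius (i0 + max j k)" using radius_pos[of "i0 + max j k"] by simp
      also have "\<dots> \<le> u k + radius (i0 + k)" using dec by (simp add: decseq_def)
      finally show ?thesis .
    qed
    define a where "a = (SUP j. u j)"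
    have bdd: "bdd_above (range u)" using ub[of _ 0] by (auto intro!: bdd_aboveI)
    have ain: "u k \<le> a" "a \<le> u k + radius (i0 + k)" for k
    proof -
      show "u k \<le> a" unfolding a_def by (rule cSUP_upper[OF _ bdd]) simp
      show "a \<le> u k + radius (i0 + k)" unfolding a_def by (rule cSUP_least) (auto intro: ub)
    qed
    have "cancelled \<alpha> (Suc i) a" if "i \<ge> i0" for i
      using u(4)[of a "i - i0"] ain[of "Suc (i - i0)"] that by simp
    then have ev: "\<forall>\<^sub>F i in sequentially. cancelled \<alpha> (Suc i) a" unfolding eventually_sequentially by blast
    have "u0 \<le> a" "a \<le> u0 + radius i0" using ain[of 0] u(1) by auto
    then have "a \<in> J" "dist a x < e" using u0 i0(2) by (auto simp: dist_real_def)
    then show "\<exists>y\<in>{a \<in> J. \<forall>\<^sub>F i in sequentially. cancelled \<alpha> (Suc i) a}. dist y x < e"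
      using ev by blast
  qed
qed

section \<open>From deterministic geometry to almost sure statements\<close>

context random_cocycle
begin

lemma rprod_eq_blk:
  assumes "\<forall>j\<ge>1. \<forall>a\<in>J. A j \<omega> a = stp (rate j) (\<alpha> j) a" "a \<in> J"
  shows "rprod A n a \<omega> = blk rate \<alpha> 0 n a"
  using assms by (induction n) auto

lemma good_runs_of_has_run:
  assumes "\<forall>j\<ge>1. \<forall>a\<in>J. A j \<omega> a = stp (rate j) (\<alpha> j) a" "\<forall>m<cells i. has_run i \<omega> m"
  shows "good_runs \<alpha> i"
  unfolding good_runs_def
proof (intro allI impI)
  fix m assume "m < cells i"
  then obtain t where t: "t < runs i" "\<And>u. u < 4 * cells i \<Longrightarrow>
      A (run_start i t + 2 * u + 2) \<omega> \<in> cell_maps (cells i) m (run_start i t + 2 * u + 2)"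
    using assms(2) unfolding has_run_def by blast
  have "\<exists>b\<in>cell (cells i) m. cis (\<alpha> (run_start i t + 2 * u + 2)) = cis (pi / 2 - b)" if "u < 4 * cells i" for u
    by (rule cell_maps_cis[OF t(2)[OF that]]) (use assms(1) in auto)
  then show "\<exists>t<runs i. \<forall>u<4 * cells i. \<exists>b\<in>cell (cells i) m. cis (\<alpha> (run_start i t + 2 * u + 2)) = cis (pi / 2 - b)"
    using t(1) by blast
qed

lemma AE_dense_small:
  "AE \<omega> in M. \<exists>X. X \<subseteq> J \<and> J \<subseteq> closure X \<and> (\<forall>a\<in>X. upper_exponent A \<omega> a \<le> ereal (29 / 10 * ln 2))"
  using AE_structure AE_has_run
proof eventually_elim
  case (elim \<omega>)
  then obtain \<alpha> where \<alpha>: "\<forall>j\<ge>1. \<forall>a\<in>J. A j \<omega> a = stp (rate j) (\<alpha> j) a" by blast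
  have good: "\<forall>\<^sub>F i in sequentially. good_runs \<alpha> i"
    using elim(2) by (rule eventually_mono) (rule good_runs_of_has_run[OF \<alpha>])
  define X where "X = {a \<in> J. \<forall>\<^sub>F i in sequentially. cancelled \<alpha> (Suc i) a}"
  have "upper_exponent A \<omega> a \<le> ereal (29 / 10 * ln 2)" if "a \<in> X" for a
  proof -
    have a: "a \<in> J" and "\<forall>\<^sub>F i in sequentially. cancelled \<alpha> (Suc i) a" using that by (auto simp: X_def)
    from eventually_logn_le[OF this(2)]
    have "\<forall>\<^sub>F n in sequentially. ereal (1 / real n * log_norm A n a \<omega>) \<le> ereal (29 / 10 * ln 2)"
      using eventually_gt_at_top[of 0]
    proof eventually_elim
      case (elim n)
      then show ?case
        unfolding log_norm_eq rprod_eq_blk[OF \<alpha> a] logn_def by (simp add: divide_le_eq)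
    qed
    then show ?thesis unfolding upper_exponent_def by (rule Limsup_bounded)
  qed
  moreover have "J \<subseteq> closure X" unfolding X_def by (rule dense_cancelled[OF good])
  ultimately show ?case by (intro exI[of _ X]) (auto simp: X_def)
qed

end

theorem propositionB1:
  fixes M :: "'w measure" and A :: "nat \<Rightarrow> 'w \<Rightarrow> real \<Rightarrow> real^2^2"
  assumes "prob_space M"
    and "prob_space.indep_vars M (\<lambda>_. C1_borel) A {1..}"
    and "\<forall>j\<ge>1. distr M C1_borel (A j) = step_law j"
  shows "(AE \<omega> in M. \<exists>X. X \<subseteq> J \<and> J \<subseteq> closure X \<and>
            (\<forall>a\<in>X. upper_exponent A \<omega> a < upper_mean_exponent M A a))
       \<and> (AE \<omega> in M. \<not> continuous_on J (upper_exponent A \<omega>))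
       \<and> continuous_on J (upper_mean_exponent M A)
       \<and> (\<exists>c::real. \<forall>a\<in>J. upper_mean_exponent M A a = ereal c)"
proof -
  have axioms: "random_cocycle_axioms M A"
  proof (rule random_cocycle_axioms.intro)
    show "prob_space.indep_vars M (\<lambda>_. C1_borel) A {1..}" by (rule assms(2))
    show "distr M C1_borel (A j) = law (dg (rate j))" if "1 \<le> j" for j
      by (rule assms(3)[rule_format, OF that, unfolded step_law_eq])
  qed
  interpret random_cocycle M A
    by (rule random_cocycle.intro[OF assms(1) axioms])
  obtain c where c: "limsup (\<lambda>n. ereal (mean_growth n / n)) = ereal c" "59 / 20 * ln 2 \<le> c"
    by (rule limsup_mean_growth)
  have mean: "upper_mean_exponent M A a = ereal c" if "a \<in> J" for a
    using upper_mean_exponent_eq[OF that] c(1) by simp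
  have ln2: "ln (2::real) > 0" by simp
  have "AE \<omega> in M. \<exists>X. X \<subseteq> J \<and> J \<subseteq> closure X \<and> (\<forall>a\<in>X. upper_exponent A \<omega> a < upper_mean_exponent M A a)"
    using AE_dense_small
  proof eventually_elim
    case (elim \<omega>)
    then obtain X where X: "X \<subseteq> J" "J \<subseteq> closure X" "\<And>a. a \<in> X \<Longrightarrow> upper_exponent A \<omega> a \<le> ereal (29 / 10 * ln 2)"
      by blast
    have "upper_exponent A \<omega> a < upper_mean_exponent M A a" if "a \<in> X" for a
    proof -
      have "29 / 10 * ln 2 < c" using c(2) ln2 by argo
      have "upper_exponent A \<omega> a \<le> ereal (29 / 10 * ln 2)" by (rule X(3)[OF that])
      also have "\<dots> < ereal c" using \<open>29 / 10 * ln 2 < c\<close> by simp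
      also have "\<dots> = upper_mean_exponent M A a" using mean X(1) that by auto
      finally show ?thesis .
    qed
    with X show ?case by blast
  qed
  moreover have "AE \<omega> in M. \<not> continuous_on J (upper_exponent A \<omega>)"
  proof -
    \<comment> \<open>The bound for fixed parameters holds simultaneously at the countably many
      rational ones. Continuity would extend it to all of \<open>J\<close>, in particular to points
      of \<open>X\<close>, where the exponent is at most
      \<open>29 / 10 * ln 2 < 73 / 25 * ln 2\<close>.\<close>
    have "AE \<omega> in M. \<forall>a\<in>J \<inter> \<rat>. ereal (73 / 25 * ln 2) \<le> upper_exponent A \<omega> a"
      by (rule AE_ball_countable'[OF _ countable_Int2[OF countable_rat]]) (rule AE_upper_exponent_ge, blast)
    with AE_dense_small show ?thesis
    proof eventually_elim
      case (elim \<omega>)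
      then obtain X where X: "X \<subseteq> J" "J \<subseteq> closure X" "\<And>a. a \<in> X \<Longrightarrow> upper_exponent A \<omega> a \<le> ereal (29 / 10 * ln 2)"
        by blast
      have "X \<noteq> {}" using X(2) by auto
      then obtain a where a: "a \<in> X" by blast
      show ?case
      proof
        assume cont: "continuous_on J (upper_exponent A \<omega>)"
        have "closure (J \<inter> \<rat>) \<subseteq> J" by (intro closure_minimal) auto
        then have J: "closure (J \<inter> \<rat>) = J" using dense_Rats_J by blast
        have "ereal (73 / 25 * ln 2) \<le> upper_exponent A \<omega> a"
        proof -
          have "closed (J \<inter> upper_exponent A \<omega> -` {ereal (73 / 25 * ln 2)..})"
            by (rule continuous_closed_preimage[OF cont]) auto
          moreover have "J \<inter> \<rat> \<subseteq> J \<inter> upper_exponent A \<omega> -` {ereal (73 / 25 * ln 2)..}"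
            using elim(2) by blast
          ultimately have "closure (J \<inter> \<rat>) \<subseteq> J \<inter> upper_exponent A \<omega> -` {ereal (73 / 25 * ln 2)..}"
            by (rule closure_minimal[rotated])
          then show ?thesis using J X(1) a by blast
        qed
        also have "\<dots> \<le> ereal (29 / 10 * ln 2)" by (rule X(3)[OF a])
        finally show False using ln2 by simp
      qed
    qed
  qed
  moreover have "continuous_on J (upper_mean_exponent M A)"
    using continuous_on_cong[OF refl mean, of J] continuous_on_const by auto
  ultimately show ?thesis using mean by blast
qed

end
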